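(* Consider the interval model $Y_t={\bf Z}_t'{\boldsymbol\theta}^0+u_t$, $t=1,\dots,T$, described in the context, with fixed dimension $p$. Write ${\boldsymbol\theta}^0=({\boldsymbol\theta}_1^{0\prime},{\boldsymbol\theta}_2^{0\prime})'$, where (after relabeling the coordinates) ${\boldsymbol\theta}_1^0\in\mathbb{R}^{k_0}$ has all entries nonzero and ${\boldsymbol\theta}_2^0={\bf 0}\in\mathbb{R}^{p-k_0}$; write correspondingly $\hat{\boldsymbol\theta}_T=(\hat{\boldsymbol\theta}_{1T}',\hat{\boldsymbol\theta}_{2T}')'$ and let ${\bf Z}_{1t}$ be the vector of the first $k_0$ components of ${\bf Z}_t$. Suppose: (A1) $\{Y_t,X_{1,t},\dots,X_{J,t}\}$ are strictly stationary and ergodic interval stochastic processes with $\mathbb{E}\|Y_t\|_K^4<\infty$, $\mathbb{E}\|X_{j,t}\|_K^4<\infty$ for all $j$; $\mathbb{E}(u_t\mid\mathcal{I}_{t-1})=[0,0]$ a.s. and $\mathbb{E}(\|u_t\|_K^2\mid\mathcal{I}_{t-1})=\sigma^2$; (A2) the parameter space $\Theta$ is a compact subset of $\mathbb{R}^p$ and ${\boldsymbol\theta}^0$ is an interior point of $\Theta$; (A3) $\mathbb{E}[\langle s_{{\bf Z}_t},s'_{{\bf Z}_t}\rangle_K]$ and $\mathbb{E}[\langle s_{{\bf Z}_t},s_{u_t({\boldsymbol\theta})}\rangle_K\langle s_{u_t({\boldsymbol\theta})},s'_{{\bf Z}_t}\rangle_K]$, with $u_t({\boldsymbol\theta})=Y_t-{\bf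 Z}_t'{\boldsymbol\theta}$, are positive definite for all ${\boldsymbol\theta}$ in a small neighborhood of ${\boldsymbol\theta}^0$; (A4) $\lambda_T/\sqrt T\to0$ and $\lambda_T T^{(\gamma-1)/2}\to\infty$ as $T\to\infty$. Then: (i) $\lim_{T\to\infty}P(\hat{\boldsymbol\theta}_{2T}={\bf 0})=1$; (ii) as $T\to\infty$, $\sqrt{T}(\hat{\boldsymbol\theta}_{1T}-{\boldsymbol\theta}_1^0)\xrightarrow{d}N\big({\bf 0},\,C_{11}^{-1}\mathbb{E}[\langle s_{{\bf Z}_{1t}},s_{u_t}\rangle_K\langle s_{u_t},s'_{{\bf Z}_{1t}}\rangle_K]C_{11}^{-1}\big)$, where $C_{11}$ is the upper-left $k_0\times k_0$ block of $\mathbb{E}[\langle s_{{\bf Z}_t},s'_{{\bf Z}_t}\rangle_K]$.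
   Context: Intervals: an (extended) interval is an ordered pair $A=[A_L,A_R]$ of real numbers, where $A_R<A_L$ is allowed. Operations: $A+B=[A_L+B_L,A_R+B_R]$, $A-B=[A_L-B_L,A_R-B_R]$, $cA=[cA_L,cA_R]$ for $c\in\mathbb{R}$. The support function of $A$ on $\{-1,1\}$ is $s_A(1)=A_R$, $s_A(-1)=-A_L$. Fix a symmetric positive definite kernel $K:\{-1,1\}^2\to\mathbb{R}$: $K(1,-1)=K(-1,1)$, $K(1,1)>0$, $K(1,1)K(-1,-1)>K(1,-1)^2$. Define $\langle s_A,s_B\rangle_K=\sum_{u,v\in\{-1,1\}}K(u,v)s_A(u)s_B(v)$ and $\|A\|_K^2=\langle s_A,s_A\rangle_K$. For a column vector of intervals ${\bf A}=(A_1,\dots,A_p)'$ and an interval $C$: $\langle s_{\bf A},s'_{\bf A}\rangle_K$ is the $p\times p$ matrix with entries $\langle s_{A_i},s_{A_j}\rangle_K$, $\langle s_{\bf A},s_C\rangle_K$ is the $p$-vector with entries $\langle s_{A_i},s_C\rangle_K$, $\langle s_C,s'_{\bf A}\rangle_K$ its transpose; ${\bf A}'{\boldsymbol\theta}=\sum_j\theta_jA_j$ for ${\boldsymbol\theta}\in\mathbb R^p$. Model: $Y_t$, $X_{1,t},\dots,X_{J,t}$ interval-valued time series; $I_0=[-1/2,1/2]$; ${\bf X}_t=(X_{1,t},\dots,X_{J,t})'$; ${\bf Z}_t=([1,1],I_0,Y_{t-1},\dots,Y_{t-q},{\bf X}_t',\dots,{\bf X}_{t-s}')'$ (a vector of $p$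 intervals); $Y_t={\bf Z}_t'{\boldsymbol\theta}^0+u_t$ with true ${\boldsymbol\theta}^0\in\mathbb{R}^p$ and interval innovation $u_t$; $\mathcal{I}_{t-1}$ is the information set at time $t-1$. Estimators: $\tilde{\boldsymbol\theta}_T=(\tilde\theta_1,\dots,\tilde\theta_p)'=\arg\min_{\boldsymbol\theta}\sum_{t=1}^T\|Y_t-{\bf Z}_t'{\boldsymbol\theta}\|_K^2$ (minimum $D_K$-distance estimator) and $\hat{\boldsymbol\theta}_T=\arg\min_{\boldsymbol\theta}\sum_{t=1}^T\|Y_t-{\bf Z}_t'{\boldsymbol\theta}\|_K^2+\lambda_T\sum_{j=1}^p|\theta_j|/|\tilde\theta_j|^\gamma$ with tuning parameter $\lambda_T>0$ and constant $\gamma>0$.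
   Formalization: The information set at time t−1 is taken to contain the current X_t (so Z_t is known given it), without which the claim fails; the penalty is read as infinite where the first-stage estimate of a coordinate is 0; both minimizations are over Θ and the lasso estimator is assumed measurable. *)

theory Defs
  imports "HOL-Probability.Probability"
begin

section \<open>Extended intervals as pairs (left endpoint, right endpoint)\<close>

type_synonym interval = "real \<times> real"

definition iadd :: "interval \<Rightarrow> interval \<Rightarrow> interval" where
  "iadd A B = (fst A + fst B, snd A + snd B)"

definition isub :: "interval \<Rightarrow> interval \<Rightarrow> interval" where
  "isub A B = (fst A - fst B, snd A - snd B)"

definition iscale :: "real \<Rightarrow> interval \<Rightarrow> interval" where
  "iscale c A = (c * fst A, c * snd A)"

definition ilin :: "nat \<Rightarrow> (nat \<Rightarrow> interval) \<Rightarrow> (nat \<Rightarrow> real) \<Rightarrow> interval" where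
  "ilin p A \<theta> = ((\<Sum>i<p. \<theta> i * fst (A i)), (\<Sum>i<p. \<theta> i * snd (A i)))"

text \<open>Support function on {-1,1}: s_A(1) = A_R, s_A(-1) = - A_L.\<close>
definition supp :: "interval \<Rightarrow> int \<Rightarrow> real" where
  "supp A u = (if u = 1 then snd A else - fst A)"

definition innerK :: "(int \<Rightarrow> int \<Rightarrow> real) \<Rightarrow> interval \<Rightarrow> interval \<Rightarrow> real" where
  "innerK K A B = (\<Sum>u\<in>{-1,1}. \<Sum>v\<in>{-1,1}. K u v * supp A u * supp B v)"

definition normK2 :: "(int \<Rightarrow> int \<Rightarrow> real) \<Rightarrow> interval \<Rightarrow> real" where
  "normK2 K A = innerK K A A"

definition kernel_pd :: "(int \<Rightarrow> int \<Rightarrow> real) \<Rightarrow> bool" where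
  "kernel_pd K \<longleftrightarrow> K 1 (-1) = K (-1) 1 \<and> K 1 1 > 0 \<and> K 1 1 * K (-1) (-1) > (K 1 (-1))\<^sup>2"

text \<open>X j is the exogenous series X_{j+1} (j < J).  p = 2 + q + J (s+1).\<close>
definition dimZ :: "nat \<Rightarrow> nat \<Rightarrow> nat \<Rightarrow> nat" where
  "dimZ q s J = 2 + q + J * (s + 1)"

text \<open>Z_t = ([1,1], I_0, Y_{t-1},...,Y_{t-q}, X_t', ..., X_{t-s}')' with
  X_{t-l}' = (X_{1,t-l}, ..., X_{J,t-l}).  Component i (0-based).\<close>
definition Zvec :: "nat \<Rightarrow> nat \<Rightarrow> nat \<Rightarrow> (int \<Rightarrow> 'a \<Rightarrow> interval) \<Rightarrow> (nat \<Rightarrow> int \<Rightarrow> 'a \<Rightarrow> interval)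
    \<Rightarrow> int \<Rightarrow> 'a \<Rightarrow> nat \<Rightarrow> interval" where
  "Zvec q s J Y X t \<omega> i =
     (if i = 0 then (1, 1)
      else if i = 1 then (-1/2, 1/2)
      else if i < 2 + q then Y (t - int (i - 1)) \<omega>
      else X ((i - (2 + q)) mod J) (t - int ((i - (2 + q)) div J)) \<omega>)"

definition resid :: "nat \<Rightarrow> nat \<Rightarrow> nat \<Rightarrow> (int \<Rightarrow> 'a \<Rightarrow> interval) \<Rightarrow> (nat \<Rightarrow> int \<Rightarrow> 'a \<Rightarrow> interval)
    \<Rightarrow> (nat \<Rightarrow> real) \<Rightarrow> int \<Rightarrow> 'a \<Rightarrow> interval" where
  "resid q s J Y X \<theta> t \<omega> = isub (Y t \<omega>) (ilin (dimZ q s J) (Zvec q s J Y X t \<omega>) \<theta>)"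

definition coord :: "(int \<Rightarrow> 'a \<Rightarrow> interval) \<Rightarrow> (nat \<Rightarrow> int \<Rightarrow> 'a \<Rightarrow> interval) \<Rightarrow> nat \<Rightarrow> int \<Rightarrow> 'a \<Rightarrow> real" where
  "coord Y X c t \<omega> =
     (if c = 0 then fst (Y t \<omega>) else if c = 1 then snd (Y t \<omega>)
      else if even c then fst (X ((c - 2) div 2) t \<omega>) else snd (X ((c - 2) div 2) t \<omega>))"

definition process_measurable :: "'a measure \<Rightarrow> (int \<Rightarrow> 'a \<Rightarrow> interval) \<Rightarrow> (nat \<Rightarrow> int \<Rightarrow> 'a \<Rightarrow> interval) \<Rightarrow> nat \<Rightarrow> bool" where
  "process_measurable M Y X J \<longleftrightarrow> (\<forall>c < 2 + 2 * J. \<forall>t. coord Y X c t \<in> borel_measurable M)"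

definition path :: "(int \<Rightarrow> 'a \<Rightarrow> interval) \<Rightarrow> (nat \<Rightarrow> int \<Rightarrow> 'a \<Rightarrow> interval) \<Rightarrow> nat \<Rightarrow> 'a \<Rightarrow> (int \<times> nat \<Rightarrow> real)" where
  "path Y X J \<omega> = (\<lambda>(t, c). if c < 2 + 2 * J then coord Y X c t \<omega> else 0)"

definition PS :: "(int \<times> nat \<Rightarrow> real) measure" where
  "PS = Pi\<^sub>M UNIV (\<lambda>_. borel)"

definition shift1 :: "(int \<times> nat \<Rightarrow> real) \<Rightarrow> (int \<times> nat \<Rightarrow> real)" where
  "shift1 x = (\<lambda>(t, c). x (t + 1, c))"

definition law :: "'a measure \<Rightarrow> (int \<Rightarrow> 'a \<Rightarrow> interval) \<Rightarrow> (nat \<Rightarrow> int \<Rightarrow> 'a \<Rightarrow> interval) \<Rightarrow> nat \<Rightarrow> (int \<times> nat \<Rightarrow> real) measure" where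
  "law M Y X J = distr M PS (path Y X J)"

definition strictly_stationary :: "'a measure \<Rightarrow> (int \<Rightarrow> 'a \<Rightarrow> interval) \<Rightarrow> (nat \<Rightarrow> int \<Rightarrow> 'a \<Rightarrow> interval) \<Rightarrow> nat \<Rightarrow> bool" where
  "strictly_stationary M Y X J \<longleftrightarrow> distr (law M Y X J) PS shift1 = law M Y X J"

definition ergodic :: "'a measure \<Rightarrow> (int \<Rightarrow> 'a \<Rightarrow> interval) \<Rightarrow> (nat \<Rightarrow> int \<Rightarrow> 'a \<Rightarrow> interval) \<Rightarrow> nat \<Rightarrow> bool" where
  "ergodic M Y X J \<longleftrightarrow>
     (\<forall>A \<in> sets PS. shift1 -` A \<inter> space PS = A \<longrightarrow>
        measure (law M Y X J) A = 0 \<or> measure (law M Y X J) A = 1)"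

text \<open>Information set I_{t-1} used in the equation for Y_t:
  generated by Y_r (r <= t-1) and X_{j,r} (r <= t).\<close>
definition info :: "'a measure \<Rightarrow> (int \<Rightarrow> 'a \<Rightarrow> interval) \<Rightarrow> (nat \<Rightarrow> int \<Rightarrow> 'a \<Rightarrow> interval) \<Rightarrow> nat \<Rightarrow> int \<Rightarrow> 'a measure" where
  "info M Y X J t = sigma (space M)
     {coord Y X c r -` B \<inter> space M | c r B. B \<in> sets borel \<and>
        ((c < 2 \<and> r \<le> t - 1) \<or> (2 \<le> c \<and> c < 2 + 2 * J \<and> r \<le> t))}"

definition DKobj :: "(int \<Rightarrow> int \<Rightarrow> real) \<Rightarrow> nat \<Rightarrow> nat \<Rightarrow> nat \<Rightarrow> (int \<Rightarrow> 'a \<Rightarrow> interval)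
   \<Rightarrow> (nat \<Rightarrow> int \<Rightarrow> 'a \<Rightarrow> interval) \<Rightarrow> nat \<Rightarrow> 'a \<Rightarrow> (nat \<Rightarrow> real) \<Rightarrow> real" where
  "DKobj K q s J Y X T \<omega> \<theta> = (\<Sum>t = 1..T. normK2 K (resid q s J Y X \<theta> (int t) \<omega>))"

definition adapt_pen :: "nat \<Rightarrow> real \<Rightarrow> (nat \<Rightarrow> real) \<Rightarrow> (nat \<Rightarrow> real) \<Rightarrow> real" where
  "adapt_pen p \<gamma> \<theta>t \<theta> = (\<Sum>j<p. \<bar>\<theta> j\<bar> / \<bar>\<theta>t j\<bar> powr \<gamma>)"

definition Rp :: "nat \<Rightarrow> (nat \<Rightarrow> real) set" where
  "Rp p = {\<theta>. \<forall>i \<ge> p. \<theta> i = 0}"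

definition posdef_on :: "nat set \<Rightarrow> (nat \<Rightarrow> nat \<Rightarrow> real) \<Rightarrow> bool" where
  "posdef_on S A \<longleftrightarrow> (\<forall>i\<in>S. \<forall>j\<in>S. A i j = A j i) \<and>
     (\<forall>v. (\<exists>i\<in>S. v i \<noteq> 0) \<longrightarrow> (\<Sum>i\<in>S. \<Sum>j\<in>S. v i * A i j * v j) > 0)"

definition inv_on :: "nat set \<Rightarrow> (nat \<Rightarrow> nat \<Rightarrow> real) \<Rightarrow> (nat \<Rightarrow> nat \<Rightarrow> real)" where
  "inv_on S A = (THE B. (\<forall>i\<in>S. \<forall>j\<in>S. (\<Sum>k\<in>S. A i k * B k j) = (if i = j then 1 else 0)) \<and>
                         (\<forall>i j. i \<notin> S \<or> j \<notin> S \<longrightarrow> B i j = 0))"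

definition gaussian_on :: "nat set \<Rightarrow> (nat \<Rightarrow> nat \<Rightarrow> real) \<Rightarrow> (nat \<Rightarrow> real) measure \<Rightarrow> bool" where
  "gaussian_on S V \<mu> \<longleftrightarrow> prob_space \<mu> \<and> sets \<mu> = sets (Pi\<^sub>M S (\<lambda>_. borel)) \<and>
     (\<forall>\<xi> :: nat \<Rightarrow> real. (\<integral>x. cis (\<Sum>i\<in>S. \<xi> i * x i) \<partial>\<mu>) =
         complex_of_real (exp (- (\<Sum>i\<in>S. \<Sum>j\<in>S. \<xi> i * V i j * \<xi> j) / 2)))"

definition conv_dist_to :: "'a measure \<Rightarrow> nat set \<Rightarrow> (nat \<Rightarrow> 'a \<Rightarrow> (nat \<Rightarrow> real)) \<Rightarrow> (nat \<Rightarrow> real) measure \<Rightarrow> bool" where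
  "conv_dist_to M S Xs \<mu> \<longleftrightarrow>
     (\<forall>f :: (nat \<Rightarrow> real) \<Rightarrow> real.
        continuous_on (PiE S (\<lambda>_. UNIV)) f \<and> bounded (f ` PiE S (\<lambda>_. UNIV)) \<longrightarrow>
        (\<lambda>n. \<integral>\<omega>. f (Xs n \<omega>) \<partial>M) \<longlonglongrightarrow> (\<integral>x. f x \<partial>\<mu>))"


definition Cmat :: "'a measure \<Rightarrow> (int \<Rightarrow> int \<Rightarrow> real) \<Rightarrow> nat \<Rightarrow> nat \<Rightarrow> nat \<Rightarrow> (int \<Rightarrow> 'a \<Rightarrow> interval)
   \<Rightarrow> (nat \<Rightarrow> int \<Rightarrow> 'a \<Rightarrow> interval) \<Rightarrow> int \<Rightarrow> nat \<Rightarrow> nat \<Rightarrow> real" where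
  "Cmat M K q s J Y X t i j = (\<integral>\<omega>. innerK K (Zvec q s J Y X t \<omega> i) (Zvec q s J Y X t \<omega> j) \<partial>M)"

definition Bmat :: "'a measure \<Rightarrow> (int \<Rightarrow> int \<Rightarrow> real) \<Rightarrow> nat \<Rightarrow> nat \<Rightarrow> nat \<Rightarrow> (int \<Rightarrow> 'a \<Rightarrow> interval)
   \<Rightarrow> (nat \<Rightarrow> int \<Rightarrow> 'a \<Rightarrow> interval) \<Rightarrow> (nat \<Rightarrow> real) \<Rightarrow> int \<Rightarrow> nat \<Rightarrow> nat \<Rightarrow> real" where
  "Bmat M K q s J Y X \<theta> t i j = (\<integral>\<omega>. innerK K (Zvec q s J Y X t \<omega> i) (resid q s J Y X \<theta> t \<omega>) *
                                     innerK K (resid q s J Y X \<theta> t \<omega>) (Zvec q s J Y X t \<omega> j) \<partial>M)"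

definition sandwich :: "nat set \<Rightarrow> (nat \<Rightarrow> nat \<Rightarrow> real) \<Rightarrow> (nat \<Rightarrow> nat \<Rightarrow> real) \<Rightarrow> nat \<Rightarrow> nat \<Rightarrow> real" where
  "sandwich S A B i j = (\<Sum>k\<in>S. \<Sum>l\<in>S. inv_on S A i k * B k l * inv_on S A l j)"

end

theory Submission
  imports Defs
begin

text \<open>
  Writing \<open>h = \<theta> - \<theta>\<^sup>0\<close>, the objective is the quadratic \<open>h'A h - 2 h'G\<close> plus a constant, where
  \<open>A = \<Sum> \<langle>s\<^sub>Z, s\<^sub>Z'\<rangle>\<close> and \<open>G = \<Sum> \<langle>s\<^sub>Z, s\<^sub>u\<rangle>\<close>. By the ergodic theorem \<open>A/T\<close> tends to a positive definite
  matrix \<open>C\<close>, and orthogonality of martingale differences gives \<open>G = O(\<surd>T)\<close>; hence both estimators are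
  \<open>\<surd>T\<close>-consistent. Setting a coordinate \<open>j\<close> with \<open>\<theta>\<^sup>0\<^sub>j = 0\<close> to zero changes the quadratic part by
  \<open>|\<theta>\<^sub>j| O(\<surd>T)\<close> but saves a penalty \<open>|\<theta>\<^sub>j| \<lambda> |\<theta>~\<^sub>j|\<^bsup>-\<gamma>\<^esup>\<close>, which is of order at least \<open>|\<theta>\<^sub>j| \<lambda> T\<^bsup>\<gamma>/2\<^esup>\<close>
  and dominates: this is sparsity. On the
  remaining coordinates the first order condition reads \<open>A h - G = O(\<lambda>) = o(\<surd>T)\<close>, so \<open>\<surd>T h\<close> behaves like
  \<open>C\<^bsup>-1\<^esup> G / \<surd>T\<close>, whose characteristic function converges by the martingale central limit theorem.
\<close>

text \<open>For the estimators, randomness enters through a single event: \<open>A/T\<close> is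
  entrywise close to \<open>C\<close> and the entries of \<open>G\<close> are at most
  \<open>R * sqrt T\<close>. On it, every claim about them is a deterministic inequality between
  values of the objective. Minimisation runs over \<open>\<Theta>\<close> only, so each competitor
  must be shown to lie there: the rate is proved by comparison with \<open>\<theta>0\<close> itself,
  and this rate then keeps all one-coordinate changes inside a box around \<open>\<theta>0\<close>.
  As the absolute value has no derivative at 0, the first order condition is an inequality extracted
  from small moves of one coordinate. On the probabilistic side the obstacle is that the target
  concerns integrals of all bounded continuous functions of several variables, while the martingale
  argument yields characteristic functions of linear combinations. Trigonometric polynomials bridge
  this gap, and the tightness that they require is already contained in the \<open>sqrt T\<close>
  rate. Fourth moments enter because a score is a product of a regressor and an innovation whose
  square must be integrable.\<close>

section \<open>The pointwise ergodic theorem\<close>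

text \<open>The maximum of the Birkhoff sums \<open>S\<^sub>0, \<dots>, S\<^sub>n\<close>.\<close>
primrec run_max :: "('a \<Rightarrow> real) \<Rightarrow> ('a \<Rightarrow> 'a) \<Rightarrow> nat \<Rightarrow> 'a \<Rightarrow> real" where
  "run_max f T 0 x = 0"
| "run_max f T (Suc n) x = max 0 (f x + run_max f T n (T x))"

lemma run_max_nonneg: "0 \<le> run_max f T n x"
  by (cases n) auto

lemma run_max_mono_Suc: "run_max f T n x \<le> run_max f T (Suc n) x"
proof (induction n arbitrary: x)
  case (Suc n)
  show ?case using Suc[of "T x"] by (simp add: max_def)
qed simp

lemma run_max_mono: "mono (\<lambda>n. run_max f T n x)"
  using run_max_mono_Suc by (rule mono_iff_le_Suc[THEN iffD2, OF allI])

lemma birkhoff_sum_le_run_max: "(\<Sum>k<n. f ((T ^^ k) x)) \<le> run_max f T n x"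
proof (induction n arbitrary: x)
  case (Suc n)
  have "(\<Sum>k<Suc n. f ((T ^^ k) x)) = f x + (\<Sum>k<n. f ((T ^^ k) (T x)))"
    by (simp add: sum.lessThan_Suc_shift funpow_swap1 del: sum.lessThan_Suc)
  then show ?case using Suc[of "T x"] by simp
qed simp

lemma run_max_integrable:
  assumes T: "T \<in> measurable M M" and inv: "distr M M T = M" and f: "integrable M f"
  shows "integrable M (run_max f T n)"
proof (induction n)
  case 0
  then show ?case by (simp add: fun_eq_iff[symmetric] cong: integrable_cong)
next
  case (Suc n)
  have "integrable (distr M M T) (run_max f T n)" using Suc inv by simp
  then have "integrable M (\<lambda>x. run_max f T n (T x))"
    by (subst (asm) integrable_distr_eq[OF T]) (use Suc in auto)
  then have "integrable M (\<lambda>x. max 0 (f x + run_max f T n (T x)))"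
    using f by (intro integrable_max) auto
  then show ?case by (simp cong: integrable_cong)
qed

text \<open>On the invariant set where the running maxima \<open>m\<^sub>n\<close> diverge, \<open>m\<^bsub>n+1\<^esub> - m\<^sub>n \<circ> T\<close> converges to \<open>f\<close>
  and has nonnegative integral, so this set cannot have full measure if \<open>f\<close> has negative mean.\<close>
lemma birkhoff_sums_bdd_above:
  fixes M :: "'a measure" and f :: "'a \<Rightarrow> real"
  assumes "prob_space M" and T: "T \<in> measurable M M" and inv: "distr M M T = M"
    and erg: "\<forall>A\<in>sets M. T -` A \<inter> space M = A \<longrightarrow> measure M A = 0 \<or> measure M A = 1"
    and f: "integrable M f" and neg: "(\<integral>x. f x \<partial>M) < 0"
  shows "AE x in M. bdd_above (range (\<lambda>n. \<Sum>k<n. f ((T ^^ k) x)))"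
proof -
  interpret prob_space M by fact
  let ?m = "run_max f T"
  note int = run_max_integrable[OF T inv f]
  have [measurable]: "f \<in> borel_measurable M" "\<And>n. ?m n \<in> borel_measurable M" "T \<in> measurable M M"
    using f int T by auto
  \<comment> \<open>The bound ranges over naturals, so that \<open>A\<close> is a countable
    combination of measurable sets; \<open>bd\<close> returns to real bounds.\<close>
  define A where "A = {x \<in> space M. \<not> (\<exists>B::nat. \<forall>n. ?m n x \<le> real B)}"
  have A[measurable]: "A \<in> sets M" unfolding A_def by measurable
  have bd: "(\<exists>B::nat. \<forall>n. ?m n x \<le> real B) \<longleftrightarrow> (\<exists>B. \<forall>n. ?m n x \<le> B)" for x
    by (meson order_trans real_arch_simple)
  \<comment> \<open>The recursion turns a bound B at \<open>T x\<close> into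
    \<open>max 0 (f x + B)\<close> at \<open>x\<close>, and a bound B at \<open>x\<close> into
    \<open>B - f x\<close> at \<open>T x\<close>. Hence boundedness of the running maxima is
    invariant under \<open>T\<close>.\<close>
  have iff: "(\<exists>B. \<forall>n. ?m n (T x) \<le> B) \<longleftrightarrow> (\<exists>B. \<forall>n. ?m n x \<le> B)" for x
  proof
    assume "\<exists>B. \<forall>n. ?m n (T x) \<le> B"
    then obtain B where B: "\<And>n. ?m n (T x) \<le> B" by auto
    have "?m n x \<le> max 0 (f x + B)" for n
      using B by (cases n) (auto simp: max_def intro: order_trans)
    then show "\<exists>B. \<forall>n. ?m n x \<le> B" by auto
  next
    assume "\<exists>B. \<forall>n. ?m n x \<le> B"
    then obtain B where B: "\<And>n. ?m n x \<le> B" by auto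
    have "?m n (T x) \<le> B - f x" for n
      using B[of "Suc n"] by simp
    then show "\<exists>B. \<forall>n. ?m n (T x) \<le> B" by auto
  qed
  have invA: "T -` A \<inter> space M = A"
    using measurable_space[OF T] unfolding A_def bd vimage_def by (auto simp only: iff mem_Collect_eq Int_iff)
  have int_T: "integrable M (\<lambda>x. ?m n (T x))" "(\<integral>x. ?m n (T x) \<partial>M) = (\<integral>x. ?m n x \<partial>M)" for n
  proof -
    have "integrable (distr M M T) (?m n)" using int inv by simp
    then show "integrable M (\<lambda>x. ?m n (T x))" by (subst (asm) integrable_distr_eq[OF T]) auto
    have "(\<integral>x. ?m n x \<partial>distr M M T) = (\<integral>x. ?m n (T x) \<partial>M)" by (rule integral_distr) auto
    then show "(\<integral>x. ?m n (T x) \<partial>M) = (\<integral>x. ?m n x \<partial>M)" using inv by simp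
  qed
  have "prob A \<noteq> 1"
  proof
    assume "prob A = 1"
    then have AE: "AE x in M. x \<in> A" using AE_in_set_eq_1[OF A] by simp
    \<comment> \<open>\<open>D n\<close> lies between \<open>f\<close> and \<open>max 0 f\<close>,
      which provides the dominating function; it equals \<open>f\<close> as soon as the running
      maximum at \<open>T x\<close> exceeds \<open>- f x\<close>.\<close>
    define D where "D n x = ?m (Suc n) x - ?m n (T x)" for n x
    have D: "D n x = max (- ?m n (T x)) (f x)" for n x
      by (auto simp: D_def max_def)
    have "(\<lambda>n. \<integral>x. D n x \<partial>M) \<longlonglongrightarrow> (\<integral>x. f x \<partial>M)"
    proof (rule integral_dominated_convergence[where w="\<lambda>x. \<bar>f x\<bar>"])
      show "AE x in M. (\<lambda>n. D n x) \<longlonglongrightarrow> f x"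
        using AE
      proof eventually_elim
        case (elim x)
        then have "\<not> (\<exists>B. \<forall>n. ?m n (T x) \<le> B)" unfolding A_def bd iff by simp
        then obtain N where "?m N (T x) > - f x" by (meson not_le)
        then have "D n x = f x" if "n \<ge> N" for n
          using monoD[OF run_max_mono[of f T "T x"] that] unfolding D by simp
        then show ?case by (intro tendsto_eventually) (auto simp: eventually_sequentially)
      qed
      show "AE x in M. norm (D n x) \<le> \<bar>f x\<bar>" for n
      proof (rule AE_I2)
        show "norm (D n x) \<le> \<bar>f x\<bar>" for x
          using run_max_nonneg[of f T n "T x"] unfolding D by (auto simp: max_def abs_if)
      qed
    qed (use f in \<open>auto simp: D_def\<close>)
    \<comment> \<open>By invariance \<open>T\<close> may be dropped under the integral, leaving the
      difference of two consecutive running maxima, which increase with \<open>n\<close>.\<close>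
    moreover have "(\<integral>x. D n x \<partial>M) \<ge> 0" for n
    proof -
      have "(\<integral>x. D n x \<partial>M) = (\<integral>x. ?m (Suc n) x \<partial>M) - (\<integral>x. ?m n x \<partial>M)"
        unfolding D_def by (subst Bochner_Integration.integral_diff[OF int int_T(1)]) (simp add: int_T(2))
      moreover have "(\<integral>x. ?m n x \<partial>M) \<le> (\<integral>x. ?m (Suc n) x \<partial>M)"
        using run_max_mono_Suc by (rule integral_mono[OF int int])
      ultimately show ?thesis by simp
    qed
    ultimately have "(\<integral>x. f x \<partial>M) \<ge> 0" by (auto intro: LIMSEQ_le_const)
    then show False using neg by simp
  qed
  then have "prob A = 0" using mp[OF bspec[OF erg A] invA] by simp
  then have "AE x in M. x \<notin> A" using prob_eq_0[OF A] by simp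
  then show ?thesis
    using AE_space
  proof eventually_elim
    case (elim x)
    then obtain B where B: "\<And>n. ?m n x \<le> B" unfolding A_def by auto
    show ?case
      by (rule bdd_aboveI2[of _ _ B]) (rule order_trans[OF birkhoff_sum_le_run_max B])
  qed
qed

text \<open>Subtracting slightly more than the mean makes the mean negative, so the sums of the
  shifted function stay bounded above and vanish after division by \<open>n\<close>. The excess runs
  through the countable family \<open>1 / Suc m\<close>, which gives one null set for all
  \<open>e\<close>.\<close>

lemma ergodic_theorem_upper:
  fixes M :: "'a measure" and f :: "'a \<Rightarrow> real"
  assumes "prob_space M" and T: "T \<in> measurable M M" and inv: "distr M M T = M"
    and erg: "\<forall>A\<in>sets M. T -` A \<inter> space M = A \<longrightarrow> measure M A = 0 \<or> measure M A = 1"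
    and f: "integrable M f"
  shows "AE x in M. \<forall>e>0. \<forall>\<^sub>F n in sequentially. (\<Sum>k<n. f ((T ^^ k) x)) / real n < (\<integral>x. f x \<partial>M) + e"
proof -
  interpret prob_space M by fact
  let ?I = "\<integral>x. f x \<partial>M"
  define g where "g m x = f x - (?I + 1 / real (Suc m))" for m x
  have "AE x in M. bdd_above (range (\<lambda>n. \<Sum>k<n. g m ((T ^^ k) x)))" for m
    by (rule birkhoff_sums_bdd_above[OF assms(1) T inv erg])
       (use f in \<open>auto simp: g_def prob_space field_simps\<close>)
  then have "AE x in M. \<forall>m. bdd_above (range (\<lambda>n. \<Sum>k<n. g m ((T ^^ k) x)))"
    by (simp add: AE_all_countable)
  then show ?thesis
  proof eventually_elim
    case (elim x)
    show ?case
    proof (intro allI impI)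
      fix e :: real assume "e > 0"
      then obtain m where m: "1 / real (Suc m) < e / 2" using nat_approx_posE[of "e/2"] by auto
      obtain B where B: "\<And>n. (\<Sum>k<n. g m ((T ^^ k) x)) \<le> B"
        using elim[rule_format, of m] unfolding bdd_above_def by auto
      have "(\<lambda>n. B / real n) \<longlonglongrightarrow> 0" by (rule lim_const_over_n)
      then have "\<forall>\<^sub>F n in sequentially. B / real n < e / 2"
        using \<open>e > 0\<close> by (intro order_tendstoD) auto
      then show "\<forall>\<^sub>F n in sequentially. (\<Sum>k<n. f ((T ^^ k) x)) / real n < ?I + e"
        using eventually_gt_at_top[of 0]
      proof eventually_elim
        case (elim n)
        have "(\<Sum>k<n. f ((T ^^ k) x)) \<le> B + real n * (?I + 1 / real (Suc m))"
          using B[of n] by (simp add: g_def sum_subtractf)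
        then have "(\<Sum>k<n. f ((T ^^ k) x)) / real n \<le> (B + real n * (?I + 1 / real (Suc m))) / real n"
          by (rule divide_right_mono) simp
        also have "\<dots> = B / real n + (?I + 1 / real (Suc m))"
          using elim(2) by (simp only: add_divide_distrib) simp
        finally have "(\<Sum>k<n. f ((T ^^ k) x)) / real n \<le> B / real n + (?I + 1 / real (Suc m))" .
        then show ?case using elim(1) m by linarith
      qed
    qed
  qed
qed

text \<open>The one-sided bound applied to \<open>f\<close> and to \<open>- f\<close> encloses the
  averages from both sides.\<close>

theorem ergodic_theorem:
  fixes M :: "'a measure" and f :: "'a \<Rightarrow> real"
  assumes "prob_space M" and T: "T \<in> measurable M M" and inv: "distr M M T = M"
    and erg: "\<forall>A\<in>sets M. T -` A \<inter> space M = A \<longrightarrow> measure M A = 0 \<or> measure M A = 1"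
    and f: "integrable M f"
  shows "AE x in M. (\<lambda>n. (\<Sum>k<n. f ((T ^^ k) x)) / real n) \<longlonglongrightarrow> (\<integral>x. f x \<partial>M)"
proof -
  have "integrable M (\<lambda>x. - f x)" using f by simp
  from ergodic_theorem_upper[OF assms] ergodic_theorem_upper[OF assms(1) T inv erg this]
  show ?thesis
  proof eventually_elim
    case (elim x)
    show ?case
    proof (rule order_tendstoI)
      fix a assume "a < (\<integral>x. f x \<partial>M)"
      then show "\<forall>\<^sub>F n in sequentially. a < (\<Sum>k<n. f ((T ^^ k) x)) / real n"
        using elim(2)[rule_format, of "(\<integral>x. f x \<partial>M) - a"] by (simp add: sum_negf)
    next
      fix a assume "(\<integral>x. f x \<partial>M) < a"
      then show "\<forall>\<^sub>F n in sequentially. (\<Sum>k<n. f ((T ^^ k) x)) / real n < a"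
        using elim(1)[rule_format, of "a - (\<integral>x. f x \<partial>M)"] by simp
    qed
  qed
qed

section \<open>A central limit theorem for martingale differences\<close>

lemma abs_mult_le_sum_squares: "\<bar>a * b\<bar> \<le> a\<^sup>2 + b\<^sup>2" for a b :: real
proof -
  have "2 * (\<bar>a\<bar> * \<bar>b\<bar>) \<le> a\<^sup>2 + b\<^sup>2" using sum_squares_bound[of "\<bar>a\<bar>" "\<bar>b\<bar>"] by simp
  moreover have "0 \<le> \<bar>a\<bar> * \<bar>b\<bar>" by simp
  ultimately have "\<bar>a\<bar> * \<bar>b\<bar> \<le> a\<^sup>2 + b\<^sup>2" by linarith
  then show ?thesis by (simp add: abs_mult)
qed

lemma integrable_mult_if_squares:
  fixes f g :: "'a \<Rightarrow> real"
  assumes [measurable]: "f \<in> borel_measurable M" "g \<in> borel_measurable M"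
    and "integrable M (\<lambda>x. (f x)\<^sup>2)" "integrable M (\<lambda>x. (g x)\<^sup>2)"
  shows "integrable M (\<lambda>x. f x * g x)"
proof (rule Bochner_Integration.integrable_bound)
  show "integrable M (\<lambda>x. (f x)\<^sup>2 + (g x)\<^sup>2)" using assms by simp
  show "AE x in M. norm (f x * g x) \<le> norm ((f x)\<^sup>2 + (g x)\<^sup>2)"
    using abs_mult_le_sum_squares by (auto intro: order_trans)
qed measurable

section \<open>Truncated squares and the compensated exponential factor\<close>

definition trunc_sq :: "real \<Rightarrow> real" where "trunc_sq x = min (x\<^sup>2) 1"
text \<open>This is the size of the Taylor remainder: cubic near 0, so that \<open>n\<close> terms
  at scale \<open>1 / sqrt n\<close> sum to something negligible, and quadratic far out, so that a
  second moment suffices to integrate it.\<close>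

definition cub_sq :: "real \<Rightarrow> real" where "cub_sq x = min (\<bar>x\<bar> ^ 3) (x\<^sup>2)"

lemma trunc_sq_measurable[measurable]: "trunc_sq \<in> borel_measurable borel"
  unfolding trunc_sq_def by measurable

lemma cub_sq_measurable[measurable]: "cub_sq \<in> borel_measurable borel"
  unfolding cub_sq_def by measurable

lemma trunc_sq_bounds: "0 \<le> trunc_sq x" "trunc_sq x \<le> 1" "trunc_sq x \<le> x\<^sup>2" "trunc_sq 0 = 0"
  by (auto simp: trunc_sq_def)

lemma cub_sq_bounds: "0 \<le> cub_sq x" "cub_sq x \<le> x\<^sup>2" "cub_sq 0 = 0"
  by (auto simp: cub_sq_def)

text \<open>For \<open>\<bar>x\<bar> \<le> 1\<close> the exponent \<open>x\<^sup>2 / 2\<close>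
  cancels the quadratic term of \<open>cis x\<close>, and only terms of third order remain. For
  larger \<open>x\<close> each summand is estimated separately; the constant 4 comes from this case,
  where 3 + |x| is at most 4 times the square of x.\<close>

lemma exp_compensated_remainder:
  "cmod (cis x * of_real (exp (trunc_sq x / 2)) - 1 - \<i> * of_real x) \<le> 4 * cub_sq x"
proof (cases "\<bar>x\<bar> \<le> 1")
  case True
  define y where "y = x\<^sup>2 / 2"
  have x2: "x\<^sup>2 \<le> 1" using True by (simp add: abs_square_le_1)
  have m: "trunc_sq x / 2 = y" using x2 by (simp add: trunc_sq_def y_def)
  have cub: "cub_sq x = \<bar>x\<bar> ^ 3"
  proof -
    have "\<bar>x\<bar> ^ 3 \<le> \<bar>x\<bar> ^ 2" using True by (intro power_decreasing) auto
    then show ?thesis by (simp add: cub_sq_def)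
  qed
  have x43: "x^4 \<le> \<bar>x\<bar> ^ 3"
  proof -
    have "\<bar>x\<bar> ^ 4 \<le> \<bar>x\<bar> ^ 3" using True by (intro power_decreasing) auto
    then show ?thesis by simp
  qed
  have y0: "0 \<le> y" "y \<le> 1/2" using x2 by (auto simp: y_def)
  have y2: "y\<^sup>2 \<le> \<bar>x\<bar> ^ 3 / 4"
    using x43 by (simp add: y_def power_divide flip: power_mult)
  define s where "s = exp y - 1 - y"
  have s: "0 \<le> s" "s \<le> y\<^sup>2"
    using exp_ge_add_one_self[of y] exp_bound[of y] y0 unfolding s_def by linarith+
  define r where "r = cis x - (1 + \<i> * of_real x - of_real y)"
  have r: "cmod r \<le> \<bar>x\<bar> ^ 3 / 6"
  proof -
    have "cmod (iexp x - (\<Sum>k \<le> 2. (\<i> * x)^k / fact k)) \<le> \<bar>x\<bar>^(Suc 2) / fact (Suc 2)"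
      by (rule iexp_approx1)
    moreover have "iexp x - (\<Sum>k \<le> 2. (\<i> * x)^k / fact k) = r"
      by (simp add: r_def cis_conv_exp y_def numeral_2_eq_2 power2_eq_square of_real_mult algebra_simps)
    ultimately show ?thesis by (simp add: eval_nat_numeral fact_numeral)
  qed
  have "cis x * of_real (exp y) - 1 - \<i> * of_real x
      = cis x * (1 + of_real y + of_real s) - 1 - \<i> * of_real x" by (simp add: s_def)
  \<comment> \<open>Here \<open>cis x\<close> is replaced by \<open>1 + \<i> * x - y + r\<close>; in
    its product with \<open>1 + y\<close> the two terms of first order in \<open>y\<close>
    cancel.\<close>
  also have "\<dots> = \<i> * of_real (x * y) - of_real (y\<^sup>2) + of_real (1 + y) * r + of_real s * cis x"
    by (simp add: r_def algebra_simps power2_eq_square)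
  also have "cmod \<dots> \<le> \<bar>x\<bar> * y + y\<^sup>2 + (1 + y) * cmod r + s"
  proof -
    have "cmod (\<i> * of_real (x * y) - of_real (y\<^sup>2) + of_real (1 + y) * r + of_real s * cis x)
      \<le> cmod (\<i> * of_real (x * y)) + cmod (of_real (y\<^sup>2)) + cmod (of_real (1 + y) * r) + cmod (of_real s * cis x)"
      by (meson add_right_mono norm_triangle_ineq norm_triangle_ineq4 order_trans)
    also have "\<dots> = \<bar>x\<bar> * y + y\<^sup>2 + (1 + y) * cmod r + s"
      using y0 s by (simp only: norm_mult norm_of_real norm_ii norm_cis) (simp add: abs_mult)
    finally show ?thesis .
  qed
  also have "\<dots> \<le> \<bar>x\<bar> ^ 3 / 2 + \<bar>x\<bar> ^ 3 / 4 + (1 + 1/2) * (\<bar>x\<bar> ^ 3 / 6) + \<bar>x\<bar> ^ 3 / 4"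
  proof (intro add_mono)
    show "\<bar>x\<bar> * y \<le> \<bar>x\<bar> ^ 3 / 2" by (simp add: y_def eval_nat_numeral)
    show "(1 + y) * cmod r \<le> (1 + 1/2) * (\<bar>x\<bar> ^ 3 / 6)" using y0 r by (intro mult_mono) auto
  qed (use y2 s in auto)
  also have "\<dots> \<le> 4 * \<bar>x\<bar> ^ 3" by simp
  finally show ?thesis by (simp only: m cub)
next
  case False
  then have x: "\<bar>x\<bar> > 1" by simp
  then have x2: "x\<^sup>2 \<ge> \<bar>x\<bar>" using mult_left_mono[of 1 "\<bar>x\<bar>" "\<bar>x\<bar>"] by (simp add: power2_eq_square)
  have m: "trunc_sq x = 1" using x x2 by (simp add: trunc_sq_def)
  have cub: "cub_sq x = x\<^sup>2"
  proof -
    have "\<bar>x\<bar> ^ 2 \<le> \<bar>x\<bar> ^ 3" using x by (intro power_increasing) auto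
    then show ?thesis by (simp add: cub_sq_def)
  qed
  have "cmod (cis x * of_real (exp (1/2)) - 1 - \<i> * of_real x)
      \<le> cmod (cis x * of_real (exp (1/2))) + cmod 1 + cmod (\<i> * of_real x)"
    by (meson add_right_mono norm_triangle_ineq4 order_trans)
  also have "\<dots> = exp (1/2) + 1 + \<bar>x\<bar>" by (simp only: norm_mult) simp
  also have "\<dots> \<le> 2 + 1 + \<bar>x\<bar>" using exp_bound[of "1/2"] by (simp add: power2_eq_square)
  also have "\<dots> \<le> 4 * x\<^sup>2" using x x2 by linarith
  finally show ?thesis by (simp only: m cub)
qed

text \<open>This turns smallness in probability of a bounded integrand into smallness of its
  expectation. It serves in the martingale argument, in the approximation of test functions and in
  the comparison of the estimator with its linearisation.\<close>

lemma (in prob_space) norm_expectation_le_off_event: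
  fixes f :: "'a \<Rightarrow> 'b::{banach, second_countable_topology}"
  assumes f: "f \<in> borel_measurable M" and E: "E \<in> events" and e: "0 \<le> e"
    and small: "\<And>x. x \<in> E \<Longrightarrow> norm (f x) \<le> e" and bd: "\<And>x. x \<in> space M \<Longrightarrow> norm (f x) \<le> C"
  shows "norm (expectation f) \<le> e + C * prob (space M - E)"
proof -
  have fi: "integrable M f" by (rule integrable_const_bound[of _ C]) (use f bd in auto)
  have "norm (expectation f) \<le> expectation (\<lambda>x. norm (f x))" by (rule integral_norm_bound)
  also have "\<dots> \<le> expectation (\<lambda>x. e + C * indicator (space M - E) x)"
  proof (rule integral_mono)
    show "integrable M (\<lambda>x. norm (f x))" using fi by simp
    show "integrable M (\<lambda>x. e + C * indicator (space M - E) x)"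
      using E by (intro Bochner_Integration.integrable_add integrable_mult_right integrable_real_indicator)
        (auto simp: emeasure_eq_measure)
    show "norm (f x) \<le> e + C * indicator (space M - E) x" if "x \<in> space M" for x
      using that small[of x] bd[of x] e by (auto simp: indicator_def)
  qed
  also have "\<dots> = e + C * prob (space M - E)"
    using E by (subst Bochner_Integration.integral_add) (auto simp: prob_space emeasure_eq_measure)
  finally show ?thesis .
qed

text \<open>With \<open>x\<^sub>t = d\<^sub>t/\<surd>n\<close>, the factor \<open>exp (i x + min(x\<^sup>2, 1)/2)\<close> equals \<open>1 + i x\<close> up to a remainder that sums
  to \<open>o(1)\<close>, so the partial products of these factors have mean close to 1. Stopping once
  \<open>\<Sum> min(x\<^sub>t\<^sup>2, 1)\<close> exceeds \<open>v + 1\<close> keeps the products bounded; since that sum tends to \<open>v\<close> in probability,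
  stopping is asymptotically negligible.\<close>
lemma (in prob_space) martingale_clt:
  fixes F :: "nat \<Rightarrow> 'a measure" and d :: "nat \<Rightarrow> 'a \<Rightarrow> real"
  assumes sub: "\<And>t. subalgebra M (F t)" and incr: "\<And>t. sets (F t) \<subseteq> sets (F (Suc t))"
    and adapted: "\<And>t. d t \<in> borel_measurable (F (Suc t))"
    and mds: "\<And>t g. g \<in> borel_measurable (F t) \<Longrightarrow> integrable M (\<lambda>x. (g x)\<^sup>2) \<Longrightarrow> expectation (\<lambda>x. g x * d t x) = 0"
    and id: "\<And>t. distr M borel (d t) = distr M borel (d 0)"
    and sq: "integrable M (\<lambda>x. (d 0 x)\<^sup>2)"
    and v: "v = expectation (\<lambda>x. (d 0 x)\<^sup>2)"
    and lln: "\<And>e. e > 0 \<Longrightarrow> (\<lambda>n. prob {x \<in> space M. \<bar>(\<Sum>t<n. (d t x)\<^sup>2) / real n - v\<bar> > e}) \<longlonglongrightarrow> 0"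
  shows "(\<lambda>n. expectation (\<lambda>x. cis ((\<Sum>t<n. d t x) / sqrt (real n)))) \<longlonglongrightarrow> of_real (exp (- v / 2))"
proof -
  have Fspace: "space (F t) = space M" for t using sub by (simp add: subalgebra_def)
  have Fmono: "sets (F s) \<subseteq> sets (F t)" if "s \<le> t" for s t
    using that incr by (induction rule: dec_induct) auto
  have FM: "g \<in> borel_measurable M" if "g \<in> borel_measurable (F t)" for g :: "'a \<Rightarrow> 'b::topological_space" and t
    using measurable_from_subalg[OF sub that] .
  have dF: "d s \<in> borel_measurable (F t)" if "s < t" for s t
  proof -
    have "subalgebra (F t) (F (Suc s))"
      using Fmono[of "Suc s" t] that by (auto simp: subalgebra_def Fspace)
    then show ?thesis using adapted measurable_from_subalg by blast
  qed
  have dM[measurable]: "d t \<in> borel_measurable M" for t using FM[OF adapted] .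
  have exp_id: "expectation (\<lambda>x. f (d t x)) = expectation (\<lambda>x. f (d 0 x))"
    if "f \<in> borel_measurable borel" for f :: "real \<Rightarrow> real" and t
    using integral_distr[OF dM[of t] that] integral_distr[OF dM[of 0] that] id[of t] by simp
  have int_id: "integrable M (\<lambda>x. f (d t x))"
    if "f \<in> borel_measurable borel" "integrable M (\<lambda>x. f (d 0 x))" for f :: "real \<Rightarrow> real" and t
    using integrable_distr_eq[OF dM[of t] that(1)] integrable_distr_eq[OF dM[of 0] that(1)] id[of t] that(2) by simp
  have sqt: "integrable M (\<lambda>x. (d t x)\<^sup>2)" for t using int_id[of "\<lambda>x. x\<^sup>2" t] sq by simp
  have intd: "integrable M (d t)" for t
    by (rule square_integrable_imp_integrable[OF dM sqt])
  have v0: "v \<ge> 0" unfolding v by simp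
  define V where "V n k x = (\<Sum>t<k. trunc_sq (d t x / sqrt (real n)))" for n k x
  \<comment> \<open>\<open>V n t\<close> involves only \<open>d 0\<close> up to
    \<open>d (t - 1)\<close>, so the stopping indicator is measurable for \<open>F t\<close> and
    multiplying \<open>d t\<close> by it preserves the martingale property.\<close>
  define y where "y n t x = (if V n t x \<le> v + 1 then d t x / sqrt (real n) else 0)" for n t x
  define Q where "Q n k x = (\<Sum>t<k. trunc_sq (y n t x))" for n k x
  define \<phi> where "\<phi> n k x = cis (\<Sum>t<k. y n t x) * of_real (exp (Q n k x / 2))" for n k x
  have Vmono: "V n k x \<le> V n l x" if "k \<le> l" for n k l x
    unfolding V_def using that by (intro sum_mono2) (auto simp: trunc_sq_bounds)
  have QV: "Q n k x \<le> V n k x" for n k x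
    unfolding Q_def V_def y_def by (intro sum_mono) (auto simp: trunc_sq_bounds)
  have Qbd: "Q n k x \<le> v + 2" for n k x
  proof (induction k)
    case (Suc k)
    show ?case
    proof (cases "V n k x \<le> v + 1")
      case True
      then show ?thesis using QV[of n k x] trunc_sq_bounds(2)[of "y n k x"] by (simp add: Q_def)
    next
      case False
      then show ?thesis using Suc by (simp add: Q_def y_def trunc_sq_bounds)
    qed
  qed (use v0 in \<open>simp add: Q_def\<close>)
  have VF[measurable]: "V n k \<in> borel_measurable (F t)" if "k \<le> t" for n k t
    unfolding V_def using that by (auto intro!: borel_measurable_sum measurable_compose[OF _ trunc_sq_measurable]
      borel_measurable_divide dF)
  have yF: "y n k \<in> borel_measurable (F t)" if "k < t" for n k t
    unfolding y_def using VF[of k t n] dF[OF that] that by simp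
  have \<phi>F: "\<phi> n k \<in> borel_measurable (F t)" if "k \<le> t" for n k t
  proof -
    have [measurable]: "y n j \<in> borel_measurable (F t)" if "j < k" for j using yF[of j t n] that \<open>k \<le> t\<close> by simp
    have [measurable]: "(\<lambda>x. \<Sum>j<k. y n j x) \<in> borel_measurable (F t)" by (rule borel_measurable_sum) auto
    have [measurable]: "Q n k \<in> borel_measurable (F t)" unfolding Q_def
      by (rule borel_measurable_sum) (auto intro: measurable_compose[OF _ trunc_sq_measurable])
    show ?thesis unfolding \<phi>_def cis_conv_exp by measurable
  qed
  have VM[measurable]: "V n k \<in> borel_measurable M" and yM[measurable]: "y n k \<in> borel_measurable M"
    and \<phi>M[measurable]: "\<phi> n k \<in> borel_measurable M" for n k
    using FM[OF VF[of k k]] FM[OF yF[of k "Suc k"]] FM[OF \<phi>F[of k k]] by auto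
  define B where "B = exp ((v + 2) / 2)"
  have \<phi>bd: "cmod (\<phi> n k x) \<le> B" for n k x
    using Qbd[of n k x] by (simp add: \<phi>_def norm_mult B_def)
  have \<phi>int: "integrable M (\<phi> n k)" for n k
    by (rule integrable_const_bound[of _ B]) (use \<phi>bd in auto)
  define a where "a n = expectation (\<lambda>x. cub_sq (d 0 x / sqrt (real n)))" for n :: nat
  have int_cub0: "integrable M (\<lambda>x. cub_sq (d 0 x / sqrt (real n)))" for n :: nat
  proof (rule Bochner_Integration.integrable_bound)
    show "integrable M (\<lambda>x. (d 0 x)\<^sup>2 / real n)" using sq by simp
    show "AE x in M. norm (cub_sq (d 0 x / sqrt (real n))) \<le> norm ((d 0 x)\<^sup>2 / real n)"
      using cub_sq_bounds(1,2) by (auto simp: power_divide intro!: AE_I2 order_trans[OF cub_sq_bounds(2)])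
  qed simp
  have int_cub: "integrable M (\<lambda>x. cub_sq (d t x / sqrt (real n)))" for t and n :: nat
    using int_id[OF _ int_cub0, of _ t] by simp
  have cub_id: "expectation (\<lambda>x. cub_sq (d t x / sqrt (real n))) = a n" for t and n :: nat
    unfolding a_def by (rule exp_id) simp
  have step: "cmod (expectation (\<phi> n (Suc k)) - expectation (\<phi> n k)) \<le> 4 * B * a n" for n k
  proof -
    define \<rho> where "\<rho> x = cis (y n k x) * of_real (exp (trunc_sq (y n k x) / 2)) - 1 - \<i> * of_real (y n k x)" for x
    have [measurable]: "\<rho> \<in> borel_measurable M" unfolding \<rho>_def cis_conv_exp by measurable
    have split: "\<phi> n (Suc k) x - \<phi> n k x = \<i> * (\<phi> n k x * of_real (y n k x)) + \<phi> n k x * \<rho> x" for x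
    proof -
      have "\<phi> n (Suc k) x = \<phi> n k x * (cis (y n k x) * of_real (exp (trunc_sq (y n k x) / 2)))"
        by (simp add: \<phi>_def Q_def cis_mult[symmetric] add_divide_distrib exp_add)
      then show ?thesis by (simp add: \<rho>_def algebra_simps)
    qed
    \<comment> \<open>\<open>h\<close> collects everything in the linear term except
      \<open>d k\<close>. It is bounded and measurable for \<open>F k\<close>, so \<open>mds\<close>
      annihilates the term; since \<open>mds\<close> speaks of real multipliers, it is applied to
      the real and the imaginary part of \<open>h\<close>.\<close>
    define h where "h x = (if V n k x \<le> v + 1 then \<phi> n k x / of_real (sqrt (real n)) else 0)" for x
    have hF: "h \<in> borel_measurable (F k)"
      unfolding h_def using VF[of k k n] \<phi>F[of k k n] by simp
    have hM[measurable]: "h \<in> borel_measurable M" using FM[OF hF] .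
    have hb: "cmod (h x) \<le> B" for x
    proof -
      have "cmod (h x) \<le> cmod (\<phi> n k x)"
        by (cases "n = 0") (auto simp: h_def norm_divide divide_le_eq mult_le_cancel_left1 intro: order_trans)
      then show ?thesis using \<phi>bd[of n k x] by simp
    qed
    have hy: "\<phi> n k x * of_real (y n k x) = h x * of_real (d k x)" for x
      by (simp add: h_def y_def)
    have ihd: "integrable M (\<lambda>x. h x * of_real (d k x))"
    proof (rule Bochner_Integration.integrable_bound)
      show "integrable M (\<lambda>x. B * d k x)" using intd by simp
      show "AE x in M. norm (h x * of_real (d k x)) \<le> norm (B * d k x)"
        using hb by (auto simp: norm_mult abs_mult B_def intro!: mult_right_mono)
    qed simp
    have h0: "expectation (\<lambda>x. h x * of_real (d k x)) = 0"
    proof (rule complex_eqI)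
      have "(Re (h x))\<^sup>2 \<le> B\<^sup>2" for x
        by (rule abs_le_square_iff[THEN iffD1]) (use abs_Re_le_cmod[of "h x"] hb[of x] in linarith)
      then have "integrable M (\<lambda>x. (Re (h x))\<^sup>2)"
        by (intro integrable_const_bound[of _ "B\<^sup>2"]) auto
      moreover have "(\<lambda>x. Re (h x)) \<in> borel_measurable (F k)" using hF by measurable
      ultimately show "Re (expectation (\<lambda>x. h x * of_real (d k x))) = Re 0"
        using mds[of "\<lambda>x. Re (h x)" k] by (subst integral_Re[OF ihd, symmetric]) simp
      have "(Im (h x))\<^sup>2 \<le> B\<^sup>2" for x
        by (rule abs_le_square_iff[THEN iffD1]) (use abs_Im_le_cmod[of "h x"] hb[of x] in linarith)
      then have "integrable M (\<lambda>x. (Im (h x))\<^sup>2)"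
        by (intro integrable_const_bound[of _ "B\<^sup>2"]) auto
      moreover have "(\<lambda>x. Im (h x)) \<in> borel_measurable (F k)" using hF by measurable
      ultimately show "Im (expectation (\<lambda>x. h x * of_real (d k x))) = Im 0"
        using mds[of "\<lambda>x. Im (h x)" k] by (subst integral_Im[OF ihd, symmetric]) simp
    qed
    have bound: "cmod (\<phi> n k x * \<rho> x) \<le> 4 * B * cub_sq (d k x / sqrt (real n))" for x
    proof -
      have "cmod (\<rho> x) \<le> 4 * cub_sq (y n k x)" unfolding \<rho>_def by (rule exp_compensated_remainder)
      also have "\<dots> \<le> 4 * cub_sq (d k x / sqrt (real n))" by (simp add: y_def cub_sq_bounds)
      finally have "cmod (\<phi> n k x) * cmod (\<rho> x) \<le> B * (4 * cub_sq (d k x / sqrt (real n)))"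
        using \<phi>bd by (intro mult_mono) (auto simp: B_def)
      then show ?thesis by (simp add: norm_mult)
    qed
    have i\<rho>: "integrable M (\<lambda>x. \<phi> n k x * \<rho> x)"
    proof (rule Bochner_Integration.integrable_bound)
      show "integrable M (\<lambda>x. 4 * B * cub_sq (d k x / sqrt (real n)))" using int_cub by simp
      show "AE x in M. norm (\<phi> n k x * \<rho> x) \<le> norm (4 * B * cub_sq (d k x / sqrt (real n)))"
        using bound by (auto intro!: AE_I2 order_trans[OF bound])
    qed simp
    have "expectation (\<phi> n (Suc k)) - expectation (\<phi> n k) = expectation (\<lambda>x. \<phi> n (Suc k) x - \<phi> n k x)"
      by (rule Bochner_Integration.integral_diff[OF \<phi>int \<phi>int, symmetric])
    also have "\<dots> = expectation (\<lambda>x. \<i> * (h x * of_real (d k x)) + \<phi> n k x * \<rho> x)"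
      unfolding split hy ..
    also have "\<dots> = \<i> * expectation (\<lambda>x. h x * of_real (d k x)) + expectation (\<lambda>x. \<phi> n k x * \<rho> x)"
      using ihd i\<rho> by simp
    finally have "cmod (expectation (\<phi> n (Suc k)) - expectation (\<phi> n k)) = cmod (expectation (\<lambda>x. \<phi> n k x * \<rho> x))"
      using h0 by simp
    also have "\<dots> \<le> expectation (\<lambda>x. cmod (\<phi> n k x * \<rho> x))" by (rule integral_norm_bound)
    also have "\<dots> \<le> expectation (\<lambda>x. 4 * B * cub_sq (d k x / sqrt (real n)))"
      using i\<rho> int_cub bound by (intro integral_mono) auto
    also have "\<dots> = 4 * B * a n" by (simp add: cub_id)
    finally show ?thesis .
  qed
  have \<phi>1: "cmod (expectation (\<phi> n n) - 1) \<le> 4 * B * (real n * a n)" for n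
  proof -
    have "cmod (expectation (\<phi> n k) - 1) \<le> real k * (4 * B * a n)" for k
    proof (induction k)
      case 0
      then show ?case by (simp add: \<phi>_def Q_def prob_space)
    next
      case (Suc k)
      have "cmod (expectation (\<phi> n (Suc k)) - 1)
        \<le> cmod (expectation (\<phi> n (Suc k)) - expectation (\<phi> n k)) + cmod (expectation (\<phi> n k) - 1)"
        using norm_triangle_ineq[of "expectation (\<phi> n (Suc k)) - expectation (\<phi> n k)" "expectation (\<phi> n k) - 1"] by simp
      then show ?case using Suc step[of n k] by (simp add: algebra_simps)
    qed
    from this[of n] show ?thesis by (simp add: algebra_simps)
  qed
  \<comment> \<open>Dominated convergence with the square of \<open>d 0\<close> as dominating
    function: pointwise, \<open>n\<close> times the remainder is at most
    \<open>\<bar>u\<bar> ^ 3 / sqrt n\<close>. This takes the place of a Lindeberg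
    condition.\<close>
  have na: "(\<lambda>n. real n * a n) \<longlonglongrightarrow> 0"
  proof -
    have "(\<lambda>n. expectation (\<lambda>x. real n * cub_sq (d 0 x / sqrt (real n)))) \<longlonglongrightarrow> expectation (\<lambda>x. 0)"
    proof (rule integral_dominated_convergence[where w="\<lambda>x. (d 0 x)\<^sup>2"])
      have n_cub: "real n * cub_sq (u / sqrt (real n)) \<le> \<bar>u\<bar> ^ 3 / sqrt (real n)" for u n
      proof (cases "n = 0")
        case False
        have "real n * cub_sq (u / sqrt (real n)) \<le> real n * \<bar>u / sqrt (real n)\<bar> ^ 3"
          by (intro mult_left_mono) (auto simp: cub_sq_def)
        also have "\<dots> = \<bar>u\<bar> ^ 3 / sqrt (real n)"
        proof -
          have "real n = sqrt (real n) * sqrt (real n)" by simp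
          then show ?thesis using False
            by (simp add: power_divide power3_eq_cube field_simps)
        qed
        finally show ?thesis .
      qed simp
      show "AE x in M. (\<lambda>n. real n * cub_sq (d 0 x / sqrt (real n))) \<longlonglongrightarrow> 0"
      proof (rule AE_I2)
        fix x
        have "(\<lambda>n. \<bar>d 0 x\<bar> ^ 3 / sqrt (real n)) \<longlonglongrightarrow> 0"
          by (intro tendsto_divide_0[OF tendsto_const] filterlim_at_top_imp_at_infinity
              filterlim_compose[OF sqrt_at_top] filterlim_real_sequentially)
        then show "(\<lambda>n. real n * cub_sq (d 0 x / sqrt (real n))) \<longlonglongrightarrow> 0"
          by (rule tendsto_sandwich[OF _ _ tendsto_const, rotated 2])
             (auto simp: n_cub cub_sq_bounds)
      qed
      show "AE x in M. norm (real n * cub_sq (d 0 x / sqrt (real n))) \<le> (d 0 x)\<^sup>2" for n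
      proof (rule AE_I2)
        fix x
        have "real n * cub_sq (d 0 x / sqrt (real n)) \<le> real n * (d 0 x / sqrt (real n))\<^sup>2"
          by (intro mult_left_mono cub_sq_bounds) auto
        also have "\<dots> \<le> (d 0 x)\<^sup>2" by (simp add: power_divide)
        finally show "norm (real n * cub_sq (d 0 x / sqrt (real n))) \<le> (d 0 x)\<^sup>2"
          by (simp add: cub_sq_bounds abs_mult)
      qed
    qed (use sq in auto)
    then show ?thesis by (simp add: a_def)
  qed
  \<comment> \<open>\<open>b n\<close> is the mean of what the truncation at 1 removes from the
    average of the squares. It tends to 0, so Markov's inequality carries the law of large numbers
    over from that average to \<open>V n n\<close>.\<close>
  define b where "b n = expectation (\<lambda>x. max ((d 0 x)\<^sup>2 - real n) 0)" for n :: nat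
  have b: "b \<longlonglongrightarrow> 0"
  proof -
    have "(\<lambda>n. expectation (\<lambda>x. max ((d 0 x)\<^sup>2 - real n) 0)) \<longlonglongrightarrow> expectation (\<lambda>x. 0)"
    proof (rule integral_dominated_convergence[where w="\<lambda>x. (d 0 x)\<^sup>2"])
      show "AE x in M. (\<lambda>n. max ((d 0 x)\<^sup>2 - real n) 0) \<longlonglongrightarrow> 0"
      proof (rule AE_I2)
        fix x
        obtain N :: nat where "(d 0 x)\<^sup>2 \<le> real N" using real_arch_simple by blast
        then show "(\<lambda>n. max ((d 0 x)\<^sup>2 - real n) 0) \<longlonglongrightarrow> 0"
          by (intro tendsto_eventually) (auto simp: eventually_sequentially intro!: exI[of _ N])
      qed
    qed (use sq in auto)
    then show ?thesis by (simp add: b_def[abs_def])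
  qed
  have int_exc: "integrable M (\<lambda>x. max ((d t x)\<^sup>2 - real n) 0)" for t and n :: nat
    using sqt by (intro integrable_max) auto
  have V_lim: "(\<lambda>n. prob {x \<in> space M. \<bar>V n n x - v\<bar> > e}) \<longlonglongrightarrow> 0" if e: "e > 0" for e
  proof (rule tendsto_sandwich[OF _ _ tendsto_const])
    show "(\<lambda>n. prob {x \<in> space M. \<bar>(\<Sum>t<n. (d t x)\<^sup>2) / real n - v\<bar> > e/2} + b n / (e/2)) \<longlonglongrightarrow> 0"
      using tendsto_add[OF lln[of "e/2"] tendsto_divide[OF b tendsto_const[of "e/2"]]] e by simp
    show "\<forall>\<^sub>F n in sequentially. prob {x \<in> space M. \<bar>V n n x - v\<bar> > e}
      \<le> prob {x \<in> space M. \<bar>(\<Sum>t<n. (d t x)\<^sup>2) / real n - v\<bar> > e/2} + b n / (e/2)"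
      using eventually_gt_at_top[of 0]
    proof eventually_elim
      case (elim n)
      define W where "W x = (\<Sum>t<n. max ((d t x)\<^sup>2 - real n) 0) / real n" for x
      have WV: "V n n x = (\<Sum>t<n. (d t x)\<^sup>2) / real n - W x" for x
      proof -
        have "trunc_sq (d t x / sqrt (real n)) = (d t x)\<^sup>2 / real n - max ((d t x)\<^sup>2 - real n) 0 / real n" for t
          using elim by (auto simp: trunc_sq_def min_def max_def power_divide field_simps)
        then show ?thesis by (simp add: V_def W_def sum_subtractf sum_divide_distrib)
      qed
      have W0: "W x \<ge> 0" for x unfolding W_def by (intro divide_nonneg_nonneg sum_nonneg) auto
      have iW: "integrable M W" unfolding W_def using int_exc by simp
      have [measurable]: "W \<in> borel_measurable M" using iW by simp
      have EW: "expectation W = b n"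
      proof -
        have "expectation (\<lambda>x. max ((d t x)\<^sup>2 - real n) 0) = b n" for t
          unfolding b_def by (rule exp_id) simp
        then show ?thesis unfolding W_def using int_exc elim by simp
      qed
      have "prob {x \<in> space M. \<bar>V n n x - v\<bar> > e}
        \<le> prob ({x \<in> space M. \<bar>(\<Sum>t<n. (d t x)\<^sup>2) / real n - v\<bar> > e/2} \<union> {x \<in> space M. W x \<ge> e/2})"
        using W0 by (intro finite_measure_mono) (auto simp: WV not_less, smt (verit) field_sum_of_halves)
      also have "\<dots> \<le> prob {x \<in> space M. \<bar>(\<Sum>t<n. (d t x)\<^sup>2) / real n - v\<bar> > e/2} + prob {x \<in> space M. W x \<ge> e/2}"
        by (rule measure_Un_le) auto
      also have "prob {x \<in> space M. W x \<ge> e/2} \<le> b n / (e/2)"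
        using integral_Markov_inequality_measure[OF iW, of "{}" "e/2"] W0 e by (simp add: EW)
      finally show ?case by simp
    qed
  qed (auto)
  define c where "c n x = cis ((\<Sum>t<n. d t x) / sqrt (real n))" for n x
  have cM[measurable]: "c n \<in> borel_measurable M" for n unfolding c_def cis_conv_exp by measurable
  have cint: "integrable M (c n)" for n
    by (rule integrable_const_bound[of _ 1]) (auto simp: c_def)
  \<comment> \<open>Since \<open>V\<close> increases in its second index,
    \<open>V n n \<le> v + 1\<close> means that no term was stopped; then \<open>\<phi> n n\<close>
    is exactly \<open>c n\<close> times \<open>exp (V n n / 2)\<close>, and the two exponentials
    nearly cancel.\<close>
  have close: "cmod (c n x - of_real (exp (- v / 2)) * \<phi> n n x) \<le> exp (e/2) - 1"
    if "\<bar>V n n x - v\<bar> \<le> e" "0 < e" "e \<le> 1" for n x e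
  proof -
    have "V n t x \<le> v + 1" if "t < n" for t
      using Vmono[of t n n x] that \<open>\<bar>V n n x - v\<bar> \<le> e\<close> \<open>e \<le> 1\<close> by linarith
    then have y: "y n t x = d t x / sqrt (real n)" if "t < n" for t using that by (simp add: y_def)
    have eq: "\<phi> n n x = c n x * of_real (exp (V n n x / 2))"
      using y by (simp add: \<phi>_def c_def Q_def V_def sum_divide_distrib)
    have "c n x - of_real (exp (- v / 2)) * \<phi> n n x = c n x * of_real (1 - exp ((V n n x - v) / 2))"
    proof -
      have "exp ((V n n x - v) / 2) = exp (- v / 2) * exp (V n n x / 2)"
        by (simp add: mult_exp_exp diff_divide_distrib)
      then show ?thesis using eq by (simp add: right_diff_distrib mult_ac)
    qed
    then have "cmod (c n x - of_real (exp (- v / 2)) * \<phi> n n x) = \<bar>1 - exp ((V n n x - v) / 2)\<bar>"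
      by (simp add: norm_mult c_def del: of_real_diff)
    also have "\<dots> \<le> exp (e/2) - 1"
    proof -
      have "exp ((V n n x - v) / 2) \<le> exp (e/2)" "exp (- (e / 2)) \<le> exp ((V n n x - v) / 2)" using that by auto
      moreover have "1 - exp (-(e/2)) \<le> exp (e/2) - 1"
        using exp_ge_add_one_self[of "e/2"] exp_ge_add_one_self[of "-(e/2)"] by linarith
      ultimately show ?thesis by linarith
    qed
    finally show ?thesis .
  qed
  have far: "cmod (c n x - of_real (exp (- v / 2)) * \<phi> n n x) \<le> 1 + B" for n x
  proof -
    have "cmod (of_real (exp (- v / 2)) * \<phi> n n x) \<le> 1 * B"
      unfolding norm_mult using \<phi>bd v0 by (intro mult_mono) (auto simp: B_def)
    then show ?thesis
      using norm_triangle_ineq4[of "c n x" "of_real (exp (- v / 2)) * \<phi> n n x"] by (simp add: c_def)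
  qed
  have diff0: "(\<lambda>n. expectation (\<lambda>x. c n x - of_real (exp (- v / 2)) * \<phi> n n x)) \<longlonglongrightarrow> 0"
  proof (rule tendstoI)
    fix \<epsilon> :: real assume \<epsilon>: "\<epsilon> > 0"
    have "((\<lambda>e. exp (e/2) - 1 :: real) \<longlongrightarrow> exp (0/2) - 1) (at_right 0)" by (intro tendsto_intros) auto
    then have "\<forall>\<^sub>F e in at_right 0. exp (e/2) - 1 < \<epsilon> / 2"
      using \<epsilon> by (intro order_tendstoD(2)) auto
    moreover have "\<forall>\<^sub>F e in at_right (0::real). e \<in> {0<..<1}"
      by (rule eventually_at_right_real) simp
    ultimately have "\<forall>\<^sub>F e in at_right (0::real). exp (e/2) - 1 < \<epsilon> / 2 \<and> e \<in> {0<..<1}"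
      by (rule eventually_conj)
    then obtain e :: real where e: "exp (e/2) - 1 < \<epsilon> / 2" "0 < e" "e < 1"
      using eventually_happens[of _ "at_right (0::real)"] by (auto simp: trivial_limit_at_right_real)
    have "(\<lambda>n. (1 + B) * prob {x \<in> space M. \<bar>V n n x - v\<bar> > e}) \<longlonglongrightarrow> (1 + B) * 0"
      using V_lim[OF e(2)] by (rule tendsto_mult[OF tendsto_const])
    then have "\<forall>\<^sub>F n in sequentially. (1 + B) * prob {x \<in> space M. \<bar>V n n x - v\<bar> > e} < \<epsilon> / 2"
      using \<epsilon> by (intro order_tendstoD(2)) auto
    then show "\<forall>\<^sub>F n in sequentially. dist (expectation (\<lambda>x. c n x - of_real (exp (- v / 2)) * \<phi> n n x)) 0 < \<epsilon>"
    proof eventually_elim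
      case (elim n)
      have "cmod (expectation (\<lambda>x. c n x - of_real (exp (- v / 2)) * \<phi> n n x))
        \<le> exp (e/2) - 1 + (1 + B) * prob (space M - {x \<in> space M. \<bar>V n n x - v\<bar> \<le> e})"
        by (rule norm_expectation_le_off_event) (use e close far in auto)
      also have "space M - {x \<in> space M. \<bar>V n n x - v\<bar> \<le> e} = {x \<in> space M. \<bar>V n n x - v\<bar> > e}" by auto
      finally show ?case using elim e by simp
    qed
  qed
  have "(\<lambda>n. expectation (\<phi> n n) - 1) \<longlonglongrightarrow> 0"
    by (rule Lim_null_comparison[where g="\<lambda>n. 4 * B * (real n * a n)"])
       (use \<phi>1 tendsto_mult[OF tendsto_const na] in auto)
  then have "(\<lambda>n. expectation (\<lambda>x. c n x - of_real (exp (- v / 2)) * \<phi> n n x)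
      + of_real (exp (- v / 2)) * (expectation (\<phi> n n) - 1)) \<longlonglongrightarrow> 0 + of_real (exp (- v / 2)) * 0"
    by (intro tendsto_intros diff0)
  moreover have "expectation (\<lambda>x. c n x - of_real (exp (- v / 2)) * \<phi> n n x)
      + of_real (exp (- v / 2)) * (expectation (\<phi> n n) - 1) = expectation (c n) - of_real (exp (- v / 2))" for n
    using cint \<phi>int by (simp add: algebra_simps)
  ultimately have "(\<lambda>n. expectation (c n) - of_real (exp (- v / 2))) \<longlonglongrightarrow> 0" by simp
  then show ?thesis by (simp add: LIM_zero_iff c_def[abs_def])
qed


text \<open>Orthogonality of the increments. Measurability and square integrability belong to the
  conclusion because the induction uses the partial sum as a multiplier of the next
  increment.\<close>

lemma (in prob_space) martingale_second_moment:
  fixes F :: "nat \<Rightarrow> 'a measure" and d :: "nat \<Rightarrow> 'a \<Rightarrow> real"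
  assumes sub: "\<And>t. subalgebra M (F t)" and incr: "\<And>t. sets (F t) \<subseteq> sets (F (Suc t))"
    and adapted: "\<And>t. d t \<in> borel_measurable (F (Suc t))"
    and mds: "\<And>t g. g \<in> borel_measurable (F t) \<Longrightarrow> integrable M (\<lambda>x. (g x)\<^sup>2) \<Longrightarrow> expectation (\<lambda>x. g x * d t x) = 0"
    and sq: "\<And>t. integrable M (\<lambda>x. (d t x)\<^sup>2)" and v: "\<And>t. expectation (\<lambda>x. (d t x)\<^sup>2) = v"
  shows "(\<lambda>x. \<Sum>t<n. d t x) \<in> borel_measurable (F n) \<and> integrable M (\<lambda>x. (\<Sum>t<n. d t x)\<^sup>2) \<and>
    expectation (\<lambda>x. (\<Sum>t<n. d t x)\<^sup>2) = real n * v"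
proof (induction n)
  case (Suc n)
  let ?S = "\<lambda>x. \<Sum>t<n. d t x"
  have "subalgebra (F (Suc n)) (F n)" using sub incr by (auto simp: subalgebra_def)
  then have SF: "?S \<in> borel_measurable (F (Suc n))" using Suc measurable_from_subalg by blast
  have [measurable]: "?S \<in> borel_measurable M" "d n \<in> borel_measurable M"
    using measurable_from_subalg[OF sub SF] measurable_from_subalg[OF sub adapted] by auto
  have Si: "integrable M (\<lambda>x. (?S x)\<^sup>2)" using Suc by blast
  have Sd: "integrable M (\<lambda>x. ?S x * d n x)"
    by (rule integrable_mult_if_squares) (use Si sq in auto)
  have eq: "(\<Sum>t<Suc n. d t x)\<^sup>2 = (?S x)\<^sup>2 + 2 * (?S x * d n x) + (d n x)\<^sup>2" for x
    by (simp add: power2_sum)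
  have "expectation (\<lambda>x. ?S x * d n x) = 0" using mds[of ?S n] Suc Si by blast
  then have "expectation (\<lambda>x. (\<Sum>t<Suc n. d t x)\<^sup>2) = real (Suc n) * v"
    unfolding eq using Si Sd sq Suc by (simp add: v algebra_simps)
  moreover have "integrable M (\<lambda>x. (\<Sum>t<Suc n. d t x)\<^sup>2)" unfolding eq using Si Sd sq by simp
  ultimately show ?case using SF adapted by simp
qed simp

section \<open>Convergence in distribution from characteristic functions\<close>

text \<open>These are the real trigonometric polynomials. A generator carries a cosine and a sine of
  the same frequency, so that the product of two generators is a sum of two generators, with
  frequencies \<open>\<xi> - \<eta>\<close> and \<open>\<xi> + \<eta>\<close>. They form an algebra
  whose expectations are determined by characteristic functions.\<close>

inductive_set trig_poly :: "nat set \<Rightarrow> ((nat \<Rightarrow> real) \<Rightarrow> real) set" for S where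
  gen: "(\<lambda>x. a * cos (\<Sum>i\<in>S. \<xi> i * x i) + b * sin (\<Sum>i\<in>S. \<xi> i * x i)) \<in> trig_poly S"
| add: "f \<in> trig_poly S \<Longrightarrow> g \<in> trig_poly S \<Longrightarrow> (\<lambda>x. f x + g x) \<in> trig_poly S"

lemma trig_poly_const: "(\<lambda>x. c) \<in> trig_poly S"
  using trig_poly.gen[of c "\<lambda>_. 0" S 0] by simp

lemma trig_poly_mult_gen:
  assumes "g \<in> trig_poly S"
  shows "(\<lambda>x. (a * cos (\<Sum>i\<in>S. \<xi> i * x i) + b * sin (\<Sum>i\<in>S. \<xi> i * x i)) * g x) \<in> trig_poly S"
  using assms
proof induction
  case (gen c \<eta> d)
  let ?p = "\<lambda>x. (a*c + b*d)/2 * cos (\<Sum>i\<in>S. (\<xi> i - \<eta> i) * x i) + (b*c - a*d)/2 * sin (\<Sum>i\<in>S. (\<xi> i - \<eta> i) * x i)"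
  let ?q = "\<lambda>x. (a*c - b*d)/2 * cos (\<Sum>i\<in>S. (\<xi> i + \<eta> i) * x i) + (b*c + a*d)/2 * sin (\<Sum>i\<in>S. (\<xi> i + \<eta> i) * x i)"
  have "(\<lambda>x. ?p x + ?q x) \<in> trig_poly S"
    by (rule trig_poly.add[OF trig_poly.gen trig_poly.gen])
  moreover have "?p x + ?q x = (a * cos (\<Sum>i\<in>S. \<xi> i * x i) + b * sin (\<Sum>i\<in>S. \<xi> i * x i)) *
     (c * cos (\<Sum>i\<in>S. \<eta> i * x i) + d * sin (\<Sum>i\<in>S. \<eta> i * x i))" for x
    by (simp add: left_diff_distrib distrib_right sum_subtractf sum.distrib cos_add cos_diff sin_add sin_diff)
       (simp add: field_simps)
  ultimately show ?case by simp
next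
  case (add f g)
  then show ?case using trig_poly.add[OF add.IH] by (simp add: distrib_left)
qed

lemma trig_poly_mult:
  assumes "f \<in> trig_poly S" "g \<in> trig_poly S"
  shows "(\<lambda>x. f x * g x) \<in> trig_poly S"
  using assms
proof induction
  case (gen a \<xi> b)
  then show ?case by (rule trig_poly_mult_gen)
next
  case (add f1 f2)
  then show ?case using trig_poly.add[of "\<lambda>x. f1 x * g x" S "\<lambda>x. f2 x * g x"] by (simp add: distrib_right)
qed

lemma trig_poly_compose_polynomial:
  assumes "real_polynomial_function \<phi>" "f \<in> trig_poly S"
  shows "(\<lambda>x. \<phi> (f x)) \<in> trig_poly S"
  using assms(1)
proof induction
  case (linear h)
  then obtain c where "h = (\<lambda>x. x * c)" using real_bounded_linear by auto
  then show ?case using trig_poly_mult[OF assms(2) trig_poly_const] by simp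
qed (auto intro: trig_poly_const trig_poly.add trig_poly_mult)

lemma trig_poly_bounded:
  assumes "f \<in> trig_poly S" shows "\<exists>B. \<forall>x. \<bar>f x\<bar> \<le> B"
  using assms
proof induction
  case (gen a \<xi> b)
  have "\<bar>a * cos t + b * sin t\<bar> \<le> \<bar>a\<bar> + \<bar>b\<bar>" for t
    by (rule order_trans[OF abs_triangle_ineq]) (auto simp: abs_mult intro!: add_mono mult_left_le)
  then show ?case by blast
next
  case (add f g)
  then obtain B C where "\<forall>x. \<bar>f x\<bar> \<le> B" "\<forall>x. \<bar>g x\<bar> \<le> C" by blast
  then have "\<bar>f x + g x\<bar> \<le> B + C" for x by (meson abs_triangle_ineq add_mono order_trans)
  then show ?case by blast
qed

lemma trig_poly_continuous:
  assumes "f \<in> trig_poly S" shows "continuous_on UNIV f"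
  using assms
proof induction
  case (gen a \<xi> b)
  have "continuous_on UNIV (\<lambda>x::nat \<Rightarrow> real. \<Sum>i\<in>S. \<xi> i * x i)"
    by (intro continuous_on_sum continuous_on_mult continuous_on_const continuous_on_product_coordinates)
  then show ?case
    by (intro continuous_on_add continuous_on_mult continuous_on_const continuous_on_cos continuous_on_sin)
qed (rule continuous_on_add)

text \<open>Outside \<open>S\<close> an extensional function has the single value
  \<open>undefined\<close>, so the box is a product over all indices of compact factors, and
  Tychonoff's theorem applies.\<close>

lemma compact_extensional_box: "compact (PiE S (\<lambda>_. {-R..R::real}))" for S :: "nat set"
proof -
  let ?T = "\<lambda>i::nat. if i \<in> S then {-R..R} else {undefined::real}"
  have "PiE S (\<lambda>_. {-R..R}) = PiE UNIV ?T"
    by (auto simp: PiE_def extensional_def Pi_def split: if_splits)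
  moreover have "compactin (product_topology (\<lambda>_. euclidean) UNIV) (PiE UNIV ?T)"
    by (subst compactin_PiE) auto
  ultimately show ?thesis by (simp add: euclidean_product_topology)
qed

text \<open>Stone-Weierstrass only controls the approximant on the box. Composing it with a polynomial close to
  the truncation at level \<open>B\<close> keeps it a trigonometric polynomial and bounds it everywhere.\<close>
lemma trig_poly_dense:
  fixes f :: "(nat \<Rightarrow> real) \<Rightarrow> real"
  assumes f: "continuous_on (PiE S (\<lambda>_. {-R..R})) f" and R: "R \<ge> 0" and e: "e > 0"
    and bd: "\<And>x. x \<in> PiE S (\<lambda>_. {-R..R}) \<Longrightarrow> \<bar>f x\<bar> \<le> B" and fin: "finite S"
  shows "\<exists>g \<in> trig_poly S. (\<forall>x \<in> PiE S (\<lambda>_. {-R..R}). \<bar>f x - g x\<bar> \<le> e) \<and> (\<forall>x. \<bar>g x\<bar> \<le> B + e)"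
proof -
  let ?K = "PiE S (\<lambda>_. {-R..R})"
  have "restrict (\<lambda>_. 0) S \<in> ?K" using R by auto
  then have B: "B \<ge> 0" using bd abs_ge_zero order_trans by blast
  have "\<exists>g. g \<in> trig_poly S \<and> (\<forall>x\<in>?K. \<bar>f x - g x\<bar> < e/2)"
  proof (rule Stone_Weierstrass_HOL[where P="\<lambda>g. g \<in> trig_poly S"])
    show "compact ?K" by (rule compact_extensional_box)
    show "\<exists>h. h \<in> trig_poly S \<and> h x \<noteq> h y" if xy: "x \<in> ?K \<and> y \<in> ?K \<and> x \<noteq> y" for x y
    proof -
      have "\<exists>i\<in>S. x i \<noteq> y i"
      proof (rule ccontr)
        assume "\<not> ?thesis"
        then have "x = y" using xy by (intro PiE_ext[of x S "\<lambda>_. {-R..R}" y]) blast+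
        then show False using xy by simp
      qed
      then obtain i where i: "i \<in> S" "x i \<noteq> y i" by blast
      \<comment> \<open>Division by \<open>R + 1\<close> moves the coordinate into
        \<open>[-1, 1]\<close>, where the sine is injective, so differing coordinates are
        separated.\<close>
      define \<xi> where "\<xi> j = (if j = i then 1 / (R + 1) else 0)" for j
      have s: "(\<Sum>j\<in>S. \<xi> j * z j) = z i / (R + 1)" for z :: "nat \<Rightarrow> real"
        using i fin by (simp add: \<xi>_def if_distrib[of "\<lambda>u. u * _"] cong: if_cong)
      have h: "(\<lambda>x. 0 * cos (\<Sum>j\<in>S. \<xi> j * x j) + 1 * sin (\<Sum>j\<in>S. \<xi> j * x j)) \<in> trig_poly S"
        by (rule trig_poly.gen)
      have r: "- (pi / 2) \<le> z i / (R + 1) \<and> z i / (R + 1) \<le> pi / 2" if "z \<in> ?K" for z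
      proof -
        have "-R \<le> z i" "z i \<le> R" using that i by auto
        then have "-1 \<le> z i / (R + 1)" "z i / (R + 1) \<le> 1" using R by (auto simp: field_simps)
        then show ?thesis using pi_gt3 by linarith
      qed
      have "sin (x i / (R+1)) \<noteq> sin (y i / (R+1))"
      proof
        assume "sin (x i / (R+1)) = sin (y i / (R+1))"
        then have "x i / (R+1) = y i / (R+1)" using sin_inj_pi r xy by blast
        then show False using i R by simp
      qed
      then show ?thesis using h
        by (intro exI[of _ "\<lambda>x. 0 * cos (\<Sum>j\<in>S. \<xi> j * x j) + 1 * sin (\<Sum>j\<in>S. \<xi> j * x j)"] conjI) (simp_all add: s)
    qed
  qed (use f e trig_poly_const trig_poly_mult trig_poly.add in
       \<open>auto intro: continuous_on_subset[OF trig_poly_continuous]\<close>)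
  then obtain g where g: "g \<in> trig_poly S" "\<And>x. x \<in> ?K \<Longrightarrow> \<bar>f x - g x\<bar> < e/2" by blast
  obtain m where m: "\<And>x. \<bar>g x\<bar> \<le> m" using trig_poly_bounded[OF g(1)] by blast
  \<comment> \<open>\<open>clamp\<close> fixes the values that \<open>f\<close> takes on the box and
    does not increase distances, so the error bound for \<open>g\<close> survives it.\<close>
  define clamp where "clamp u = max (- B) (min u B)" for u :: real
  obtain \<phi> where \<phi>: "real_polynomial_function \<phi>" "\<And>u. u \<in> {-m..m} \<Longrightarrow> \<bar>clamp u - \<phi> u\<bar> < e/2"
    by (rule Stone_Weierstrass_real_polynomial_function[of "{-m..m}" clamp "e/2"])
       (use e in \<open>auto simp: clamp_def intro!: continuous_intros\<close>)
  show ?thesis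
  proof (intro bexI conjI ballI allI)
    show "(\<lambda>x. \<phi> (g x)) \<in> trig_poly S" by (rule trig_poly_compose_polynomial[OF \<phi>(1) g(1)])
    show "\<bar>f x - \<phi> (g x)\<bar> \<le> e" if "x \<in> ?K" for x
    proof -
      have "\<bar>clamp (g x) - \<phi> (g x)\<bar> < e/2" using \<phi>(2)[of "g x"] m[of x] by (simp add: abs_le_iff)
      moreover have "\<bar>f x - clamp (g x)\<bar> < e/2" using g(2)[OF that] bd[OF that] B unfolding clamp_def max_def min_def by (auto split: if_splits)
      ultimately show ?thesis by linarith
    qed
    show "\<bar>\<phi> (g x)\<bar> \<le> B + e" for x
    proof -
      have "\<bar>clamp (g x) - \<phi> (g x)\<bar> < e/2" using \<phi>(2)[of "g x"] m[of x] by (simp add: abs_le_iff)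
      moreover have "\<bar>clamp (g x)\<bar> \<le> B" using B by (auto simp: clamp_def)
      ultimately show ?thesis using e by linarith
    qed
  qed
qed

text \<open>A generator integrates to a combination of the real and imaginary parts of the
  characteristic function. Integrability is part of the conclusion so that integrals can be split in
  the case of a sum.\<close>

lemma trig_poly_expectation_tendsto:
  fixes Xs :: "nat \<Rightarrow> 'a \<Rightarrow> nat \<Rightarrow> real"
  assumes "prob_space M" "prob_space \<mu>"
    and X: "\<And>n i. i \<in> S \<Longrightarrow> (\<lambda>\<omega>. Xs n \<omega> i) \<in> borel_measurable M"
    and \<mu>: "\<And>i. i \<in> S \<Longrightarrow> (\<lambda>x. x i) \<in> borel_measurable \<mu>"
    and char: "\<And>\<xi>. (\<lambda>n. \<integral>\<omega>. cis (\<Sum>i\<in>S. \<xi> i * Xs n \<omega> i) \<partial>M) \<longlonglongrightarrow> (\<integral>x. cis (\<Sum>i\<in>S. \<xi> i * x i) \<partial>\<mu>)"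
    and g: "g \<in> trig_poly S"
  shows "(\<forall>n. integrable M (\<lambda>\<omega>. g (Xs n \<omega>))) \<and> integrable \<mu> g \<and>
    (\<lambda>n. \<integral>\<omega>. g (Xs n \<omega>) \<partial>M) \<longlonglongrightarrow> (\<integral>x. g x \<partial>\<mu>)"
  using g
proof induction
  case (gen a \<xi> b)
  interpret M: prob_space M by fact
  interpret \<mu>: prob_space \<mu> by fact
  let ?l = "\<lambda>x. \<Sum>i\<in>S. \<xi> i * x i"
  have X'[measurable]: "(\<lambda>\<omega>. ?l (Xs n \<omega>)) \<in> borel_measurable M" for n using X by simp
  have \<mu>'[measurable]: "?l \<in> borel_measurable \<mu>" using \<mu> by simp
  have ic: "integrable M (\<lambda>\<omega>. cos (?l (Xs n \<omega>)))" "integrable M (\<lambda>\<omega>. sin (?l (Xs n \<omega>)))"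
    "integrable M (\<lambda>\<omega>. cis (?l (Xs n \<omega>)))" for n
    by (rule M.integrable_const_bound[of _ 1]; (simp; fail | simp only: cis_conv_exp, measurable; fail))+
  have im: "integrable \<mu> (\<lambda>x. cos (?l x))" "integrable \<mu> (\<lambda>x. sin (?l x))" "integrable \<mu> (\<lambda>x. cis (?l x))"
    by (rule \<mu>.integrable_const_bound[of _ 1]; (simp; fail | simp only: cis_conv_exp, measurable; fail))+
  have "(\<lambda>n. Re (\<integral>\<omega>. cis (?l (Xs n \<omega>)) \<partial>M)) \<longlonglongrightarrow> Re (\<integral>x. cis (?l x) \<partial>\<mu>)"
    by (rule tendsto_Re[OF char])
  then have 1: "(\<lambda>n. \<integral>\<omega>. cos (?l (Xs n \<omega>)) \<partial>M) \<longlonglongrightarrow> (\<integral>x. cos (?l x) \<partial>\<mu>)"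
    using integral_Re[OF ic(3)] integral_Re[OF im(3)] by simp
  have "(\<lambda>n. Im (\<integral>\<omega>. cis (?l (Xs n \<omega>)) \<partial>M)) \<longlonglongrightarrow> Im (\<integral>x. cis (?l x) \<partial>\<mu>)"
    by (rule tendsto_Im[OF char])
  then have 2: "(\<lambda>n. \<integral>\<omega>. sin (?l (Xs n \<omega>)) \<partial>M) \<longlonglongrightarrow> (\<integral>x. sin (?l x) \<partial>\<mu>)"
    using integral_Im[OF ic(3)] integral_Im[OF im(3)] by simp
  show ?case
    using tendsto_add[OF tendsto_mult[OF tendsto_const[of a] 1] tendsto_mult[OF tendsto_const[of b] 2]] ic im by simp
next
  case (add f g)
  then show ?case using tendsto_add by auto
qed

text \<open>On a large box \<open>f\<close> is uniformly close to a trigonometric polynomial that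
  obeys nearly the same global bound; outside the box both are bounded, and tightness makes the mass
  there small. The limit measure is tight by itself, since the complements of the boxes decrease to
  the empty set.\<close>

theorem conv_dist_to_if_char_tendsto:
  fixes Xs :: "nat \<Rightarrow> 'a \<Rightarrow> nat \<Rightarrow> real"
  assumes "prob_space M" and fin: "finite S"
    and ext: "\<And>n \<omega>. Xs n \<omega> \<in> extensional S"
    and X: "\<And>n i. i \<in> S \<Longrightarrow> (\<lambda>\<omega>. Xs n \<omega> i) \<in> borel_measurable M"
    and "prob_space \<mu>" and sets_\<mu>: "sets \<mu> = sets (Pi\<^sub>M S (\<lambda>_. borel))"
    and char: "\<And>\<xi>. (\<lambda>n. \<integral>\<omega>. cis (\<Sum>i\<in>S. \<xi> i * Xs n \<omega> i) \<partial>M) \<longlonglongrightarrow> (\<integral>x. cis (\<Sum>i\<in>S. \<xi> i * x i) \<partial>\<mu>)"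
    and tight: "\<And>e. e > 0 \<Longrightarrow> \<exists>R. \<forall>\<^sub>F n in sequentially. measure M {\<omega> \<in> space M. \<exists>i\<in>S. \<bar>Xs n \<omega> i\<bar> > R} < e"
  shows "conv_dist_to M S Xs \<mu>"
  unfolding conv_dist_to_def
proof (intro allI impI)
  fix f :: "(nat \<Rightarrow> real) \<Rightarrow> real"
  let ?E = "PiE S (\<lambda>_. UNIV :: real set)"
  assume f: "continuous_on ?E f \<and> bounded (f ` ?E)"
  then obtain B where B: "\<And>x. x \<in> ?E \<Longrightarrow> \<bar>f x\<bar> \<le> B" unfolding bounded_real by auto
  have B0: "B \<ge> 0" using B[of "restrict (\<lambda>_. 0) S"] by auto
  interpret M: prob_space M by fact
  interpret \<mu>: prob_space \<mu> by fact
  have sp: "space \<mu> = ?E" using sets_eq_imp_space_eq[OF sets_\<mu>] by (simp add: space_PiM)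
  have X_E: "Xs n \<omega> \<in> ?E" for n \<omega> using ext by (simp add: PiE_def)
  \<comment> \<open>Continuity of \<open>f\<close> is given only on the extensional functions, as a
    subspace of all functions on the naturals. Measurability therefore goes through this subspace,
    and the coordinates outside \<open>S\<close> are treated as well: they are constantly
    \<open>undefined\<close>.\<close>
  have fr: "f \<in> borel_measurable (restrict_space borel ?E)"
    using f by (intro borel_measurable_continuous_on_restrict) auto
  have und: "x i = undefined" if "x \<in> ?E" "i \<notin> S" for x i using that by (auto simp: PiE_def extensional_def)
  have \<mu>i[measurable]: "(\<lambda>x. x i) \<in> borel_measurable \<mu>" for i
  proof (cases "i \<in> S")
    case True
    then show ?thesis by (simp add: measurable_cong_sets[OF sets_\<mu> refl])
  next
    case False
    then have "(\<lambda>x. x i) \<in> borel_measurable \<mu> \<longleftrightarrow> (\<lambda>x. undefined :: real) \<in> borel_measurable \<mu>"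
      by (intro measurable_cong) (use und sp in auto)
    then show ?thesis by simp
  qed
  have Xi[measurable]: "(\<lambda>\<omega>. Xs n \<omega> i) \<in> borel_measurable M" for n i
  proof (cases "i \<in> S")
    case False
    then have "(\<lambda>\<omega>. Xs n \<omega> i) = (\<lambda>\<omega>. undefined)" using und[OF X_E] by auto
    then show ?thesis by simp
  qed (use X in auto)
  have fX[measurable]: "(\<lambda>\<omega>. f (Xs n \<omega>)) \<in> borel_measurable M" for n
  proof (rule measurable_compose[OF _ fr])
    show "Xs n \<in> measurable M (restrict_space borel ?E)"
      by (intro measurable_restrict_space2 measurable_coordinatewise_then_product) (use X_E in auto)
  qed
  have f\<mu>[measurable]: "f \<in> borel_measurable \<mu>"
  proof -
    have "(\<lambda>x. x) \<in> measurable \<mu> (restrict_space borel ?E)"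
      by (intro measurable_restrict_space2 measurable_coordinatewise_then_product) (use sp in auto)
    from measurable_compose[OF this fr] show ?thesis by simp
  qed
  have fXi: "integrable M (\<lambda>\<omega>. f (Xs n \<omega>))" for n
    by (rule M.integrable_const_bound[of _ B]) (use B X_E in auto)
  have f\<mu>i: "integrable \<mu> f"
    by (rule \<mu>.integrable_const_bound[of _ B]) (use B sp in auto)
  have \<mu>_tight: "\<exists>R. measure \<mu> {x \<in> space \<mu>. \<exists>i\<in>S. \<bar>x i\<bar> > R} < e" if "e > 0" for e
  proof -
    have "(\<lambda>n::nat. measure \<mu> {x \<in> space \<mu>. \<exists>i\<in>S. \<bar>x i\<bar> > real n}) \<longlonglongrightarrow>
        measure \<mu> (\<Inter>n::nat. {x \<in> space \<mu>. \<exists>i\<in>S. \<bar>x i\<bar> > real n})"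
    proof (rule \<mu>.finite_Lim_measure_decseq)
      show "range (\<lambda>n::nat. {x \<in> space \<mu>. \<exists>i\<in>S. \<bar>x i\<bar> > real n}) \<subseteq> \<mu>.events" using fin by auto
      show "decseq (\<lambda>n::nat. {x \<in> space \<mu>. \<exists>i\<in>S. \<bar>x i\<bar> > real n})"
      proof (rule decseq_SucI, rule subsetI)
        fix n x assume "x \<in> {x \<in> space \<mu>. \<exists>i\<in>S. \<bar>x i\<bar> > real (Suc n)}"
        then obtain i where "x \<in> space \<mu>" "i \<in> S" "\<bar>x i\<bar> > real (Suc n)" by blast
        moreover from this have "\<bar>x i\<bar> > real n" by simp
        ultimately show "x \<in> {x \<in> space \<mu>. \<exists>i\<in>S. \<bar>x i\<bar> > real n}" by blast
      qed
    qed
    moreover have "(\<Inter>n::nat. {x \<in> space \<mu>. \<exists>i\<in>S. \<bar>x i\<bar> > real n}) = {}"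
    proof (rule ccontr)
      assume "\<not> ?thesis"
      then obtain x where x: "\<And>n::nat. \<exists>i\<in>S. \<bar>x i\<bar> > real n" by auto
      obtain n :: nat where n: "(\<Sum>i\<in>S. \<bar>x i\<bar>) \<le> real n" using real_arch_simple by blast
      obtain i where "i \<in> S" "\<bar>x i\<bar> > real n" using x by blast
      moreover have "\<bar>x i\<bar> \<le> (\<Sum>i\<in>S. \<bar>x i\<bar>)" using fin \<open>i \<in> S\<close> by (intro member_le_sum) auto
      ultimately show False using n by simp
    qed
    ultimately have "(\<lambda>n::nat. measure \<mu> {x \<in> space \<mu>. \<exists>i\<in>S. \<bar>x i\<bar> > real n}) \<longlonglongrightarrow> 0" by simp
    from order_tendstoD(2)[OF this that] show ?thesis
      using eventually_happens'[OF sequentially_bot] by blast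
  qed
  show "(\<lambda>n. \<integral>\<omega>. f (Xs n \<omega>) \<partial>M) \<longlonglongrightarrow> (\<integral>x. f x \<partial>\<mu>)"
  proof (rule tendstoI)
    fix \<delta> :: real assume \<delta>: "\<delta> > 0"
    \<comment> \<open>Two approximation errors \<open>e + (2 * B + e) * e\<close> and the error
      \<open>e\<close> for the polynomial add up to \<open>3 * e + 4 * B * e + 2 * e * e\<close>,
      which for \<open>e \<le> 1\<close> is below \<open>e * (4 * B + 6)\<close>.\<close>
    define e where "e = min 1 (\<delta> / (4 * B + 6))"
    have e: "0 < e" "e \<le> 1" "e * (4 * B + 6) \<le> \<delta>"
    proof -
      show "0 < e" "e \<le> 1" using \<delta> B0 by (auto simp: e_def)
      have "e * (4 * B + 6) \<le> \<delta> / (4 * B + 6) * (4 * B + 6)"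
        using B0 by (intro mult_right_mono) (auto simp: e_def)
      then show "e * (4 * B + 6) \<le> \<delta>" using B0 by simp
    qed
    obtain R1 where R1: "\<forall>\<^sub>F n in sequentially. measure M {\<omega> \<in> space M. \<exists>i\<in>S. \<bar>Xs n \<omega> i\<bar> > R1} < e"
      using tight[OF e(1)] by blast
    obtain R2 where R2: "measure \<mu> {x \<in> space \<mu>. \<exists>i\<in>S. \<bar>x i\<bar> > R2} < e" using \<mu>_tight[OF e(1)] by blast
    define R where "R = max 0 (max R1 R2)"
    let ?K = "PiE S (\<lambda>_. {-R..R})"
    have KE: "?K \<subseteq> ?E" by auto
    have K: "x \<in> ?K" if "x \<in> ?E" "\<not> (\<exists>i\<in>S. \<bar>x i\<bar> > R)" for x
      using that by (force simp: PiE_iff abs_le_iff not_less)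
    obtain g where g: "g \<in> trig_poly S" "\<And>x. x \<in> ?K \<Longrightarrow> \<bar>f x - g x\<bar> \<le> e" "\<And>x. \<bar>g x\<bar> \<le> B + e"
    proof -
      have "continuous_on ?K f" "R \<ge> 0" using f continuous_on_subset[OF _ KE] by (auto simp: R_def)
      from trig_poly_dense[OF this e(1) _ fin, of B] B KE show ?thesis using that by blast
    qed
    have far: "\<bar>f x - g x\<bar> \<le> 2 * B + e" if "x \<in> ?E" for x using g(3)[of x] B[OF that] by linarith
    note tg = trig_poly_expectation_tendsto[OF assms(1,5) X \<mu>i char g(1)]
    have [measurable]: "(\<lambda>\<omega>. g (Xs n \<omega>)) \<in> borel_measurable M" "g \<in> borel_measurable \<mu>" for n
      using tg by auto
    have "\<forall>\<^sub>F n in sequentially. dist (\<integral>\<omega>. g (Xs n \<omega>) \<partial>M) (\<integral>x. g x \<partial>\<mu>) < e"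
      using tg e(1) tendstoD by blast
    then show "\<forall>\<^sub>F n in sequentially. dist (\<integral>\<omega>. f (Xs n \<omega>) \<partial>M) (\<integral>x. f x \<partial>\<mu>) < \<delta>"
      using R1
    proof eventually_elim
      case (elim n)
      have "norm (\<integral>\<omega>. f (Xs n \<omega>) - g (Xs n \<omega>) \<partial>M)
        \<le> e + (2 * B + e) * M.prob (space M - {\<omega> \<in> space M. \<not> (\<exists>i\<in>S. \<bar>Xs n \<omega> i\<bar> > R)})"
        by (rule M.norm_expectation_le_off_event) (use e fin g(2) far K X_E in auto)
      also have "M.prob (space M - {\<omega> \<in> space M. \<not> (\<exists>i\<in>S. \<bar>Xs n \<omega> i\<bar> > R)})
        \<le> M.prob {\<omega> \<in> space M. \<exists>i\<in>S. \<bar>Xs n \<omega> i\<bar> > R1}"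
        using fin by (intro M.finite_measure_mono) (auto simp: R_def)
      finally have 1: "\<bar>(\<integral>\<omega>. f (Xs n \<omega>) - g (Xs n \<omega>) \<partial>M)\<bar> \<le> e + (2 * B + e) * e"
        using elim(2) B0 e by (smt (verit) mult_left_mono real_norm_def)
      have ev: "{x \<in> space \<mu>. \<not> (\<exists>i\<in>S. \<bar>x i\<bar> > R)} \<in> \<mu>.events" using fin by measurable
      have "norm (\<integral>x. f x - g x \<partial>\<mu>)
        \<le> e + (2 * B + e) * \<mu>.prob (space \<mu> - {x \<in> space \<mu>. \<not> (\<exists>i\<in>S. \<bar>x i\<bar> > R)})"
        by (rule \<mu>.norm_expectation_le_off_event) (use e ev g(2) far K in \<open>auto simp: sp\<close>)
      also have "\<mu>.prob (space \<mu> - {x \<in> space \<mu>. \<not> (\<exists>i\<in>S. \<bar>x i\<bar> > R)})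
        \<le> \<mu>.prob {x \<in> space \<mu>. \<exists>i\<in>S. \<bar>x i\<bar> > R2}"
        using fin by (intro \<mu>.finite_measure_mono) (auto simp: R_def)
      finally have 2: "\<bar>(\<integral>x. f x - g x \<partial>\<mu>)\<bar> \<le> e + (2 * B + e) * e"
        using R2 B0 e by (smt (verit) mult_left_mono real_norm_def)
      have "e * e \<le> e * 1" using e by (intro mult_left_mono) auto
      moreover have "2 * (e + (2 * B + e) * e) + e = 3 * e + 4 * (B * e) + 2 * (e * e)"
        "e * (4 * B + 6) = 6 * e + 4 * (B * e)" by (simp_all add: algebra_simps)
      ultimately have "2 * (e + (2 * B + e) * e) + e < \<delta>" using e by linarith
      moreover define r where "r = e + (2 * B + e) * e"
      moreover have "(\<integral>\<omega>. f (Xs n \<omega>) - g (Xs n \<omega>) \<partial>M) = (\<integral>\<omega>. f (Xs n \<omega>) \<partial>M) - (\<integral>\<omega>. g (Xs n \<omega>) \<partial>M)"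
        using fXi tg by simp
      moreover have "(\<integral>x. f x - g x \<partial>\<mu>) = (\<integral>x. f x \<partial>\<mu>) - (\<integral>x. g x \<partial>\<mu>)"
        using f\<mu>i tg by simp
      ultimately show ?case using 1 2 elim(1) unfolding dist_real_def r_def[symmetric] by linarith
    qed
  qed
qed

section \<open>Positive definite matrices and Gaussian measures\<close>

lemma posdef_on_symD: "posdef_on S A \<Longrightarrow> i \<in> S \<Longrightarrow> j \<in> S \<Longrightarrow> A i j = A j i"
  by (simp add: posdef_on_def)

lemma posdef_on_pos:
  "posdef_on S A \<Longrightarrow> i \<in> S \<Longrightarrow> v i \<noteq> 0 \<Longrightarrow> (\<Sum>i\<in>S. \<Sum>j\<in>S. v i * A i j * v j) > 0"
  unfolding posdef_on_def by blast

lemma posdef_on_subset: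
  assumes A: "posdef_on S A" and RS: "R \<subseteq> S" and fin: "finite S"
  shows "posdef_on R A"
  unfolding posdef_on_def
proof (intro conjI ballI allI impI)
  show "A i j = A j i" if "i \<in> R" "j \<in> R" for i j using posdef_on_symD[OF A] that RS by blast
  fix v :: "nat \<Rightarrow> real" assume "\<exists>i\<in>R. v i \<noteq> 0"
  then obtain i where i: "i \<in> R" "v i \<noteq> 0" by blast
  define w where "w j = (if j \<in> R then v j else 0)" for j
  have "0 < (\<Sum>i\<in>S. \<Sum>j\<in>S. w i * A i j * w j)"
    using posdef_on_pos[OF A, of i w] i RS by (auto simp: w_def)
  also have "\<dots> = (\<Sum>i\<in>R. \<Sum>j\<in>R. v i * A i j * v j)"
    using fin RS
    by (intro sum.mono_neutral_cong_right ballI sum.neutral) (auto simp: w_def intro!: sum.mono_neutral_cong_right)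
  finally show "0 < (\<Sum>i\<in>R. \<Sum>j\<in>R. v i * A i j * v j)" .
qed

text \<open>The form attains a positive minimum on the unit sphere, which is compact when vectors
  are extensional functions; homogeneity does the rest. The sphere is that of the sum of absolute
  values, the norm in which the estimator is bounded later.\<close>

lemma posdef_on_lower_bound:
  assumes A: "posdef_on S A" and fin: "finite S"
  shows "\<exists>\<kappa>>0. \<forall>v. \<kappa> * (\<Sum>i\<in>S. \<bar>v i\<bar>)\<^sup>2 \<le> (\<Sum>i\<in>S. \<Sum>j\<in>S. v i * A i j * v j)"
proof (cases "S = {}")
  case True
  then show ?thesis by (auto intro: exI[of _ 1])
next
  case False
  then obtain a where a: "a \<in> S" by blast
  define q where "q v = (\<Sum>i\<in>S. \<Sum>j\<in>S. v i * A i j * v j)" for v :: "nat \<Rightarrow> real"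
  define K where "K = PiE S (\<lambda>_. {-1..1}) \<inter> {v. (\<Sum>i\<in>S. \<bar>v i\<bar>) = (1::real)}"
  have "continuous_on UNIV q" unfolding q_def
    by (intro continuous_on_sum continuous_on_mult continuous_on_const continuous_on_product_coordinates)
  then have q: "continuous_on K q" by (rule continuous_on_subset) auto
  have "continuous_on UNIV (\<lambda>v. \<Sum>i\<in>S. \<bar>v i\<bar> :: real)"
    by (intro continuous_on_sum continuous_on_rabs continuous_on_product_coordinates)
  then have "closed {v. (\<Sum>i\<in>S. \<bar>v i\<bar>) = (1::real)}"
    by (intro closed_Collect_eq) (auto intro: continuous_on_const)
  then have K: "compact K" unfolding K_def
    by (rule compact_Int_closed[OF compact_extensional_box])
  have "restrict (\<lambda>i. if i = a then 1 else 0) S \<in> K" unfolding K_def using a fin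
    by (auto simp: if_distrib[of abs] cong: if_cong sum.cong)
  then have "K \<noteq> {}" by blast
  then obtain v0 where v0: "v0 \<in> K" "\<And>v. v \<in> K \<Longrightarrow> q v0 \<le> q v"
    using continuous_attains_inf[OF K _ q] by blast
  have "\<exists>i\<in>S. v0 i \<noteq> 0"
  proof (rule ccontr)
    assume "\<not> ?thesis"
    then have "(\<Sum>i\<in>S. \<bar>v0 i\<bar>) = 0" by simp
    then show False using v0(1) by (simp add: K_def)
  qed
  then have pos: "q v0 > 0" unfolding q_def using posdef_on_pos[OF A] by blast
  have "q v0 * (\<Sum>i\<in>S. \<bar>v i\<bar>)\<^sup>2 \<le> q v" for v
  proof (cases "(\<Sum>i\<in>S. \<bar>v i\<bar>) = 0")
    case True
    then have "v i = 0" if "i \<in> S" for i using that fin by (simp add: sum_nonneg_eq_0_iff)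
    then show ?thesis using True by (simp add: q_def)
  next
    case False
    define n where "n = (\<Sum>i\<in>S. \<bar>v i\<bar>)"
    have n: "n > 0" using False unfolding n_def by (simp add: sum_nonneg order.not_eq_order_implies_strict)
    have le: "\<bar>v i\<bar> \<le> n" if "i \<in> S" for i unfolding n_def using that fin by (intro member_le_sum) auto
    define w where "w = restrict (\<lambda>i. v i / n) S"
    have "(\<Sum>i\<in>S. \<bar>w i\<bar>) = (\<Sum>i\<in>S. \<bar>v i\<bar> / n)" using n by (intro sum.cong) (auto simp: w_def)
    also have "\<dots> = 1" using n by (simp add: n_def flip: sum_divide_distrib)
    finally have "(\<Sum>i\<in>S. \<bar>w i\<bar>) = 1" .
    moreover have "w \<in> PiE S (\<lambda>_. {-1..1})"
      using le n by (auto simp: w_def divide_le_eq le_divide_eq abs_le_iff minus_le_iff)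
    ultimately have "q v0 \<le> q w" using v0(2) by (simp add: K_def)
    also have "q w = q v / n\<^sup>2"
      unfolding q_def sum_divide_distrib using n
      by (intro sum.cong) (auto simp: w_def power2_eq_square)
    finally show ?thesis using n by (simp add: n_def[symmetric] pos_le_divide_eq)
  qed
  then show ?thesis using pos unfolding q_def by blast
qed

section \<open>Elimination of one index, linear systems and a Cholesky factor\<close>

definition schur :: "nat \<Rightarrow> (nat \<Rightarrow> nat \<Rightarrow> real) \<Rightarrow> nat \<Rightarrow> nat \<Rightarrow> real" where
  "schur a A i j = A i j - A i a * A a j / A a a"

lemma posdef_on_diag_pos: "posdef_on S A \<Longrightarrow> finite S \<Longrightarrow> a \<in> S \<Longrightarrow> A a a > 0"
proof -
  assume A: "posdef_on S A" and "finite S" "a \<in> S"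
  then have "posdef_on {a} A" by (intro posdef_on_subset[OF A]) auto
  then show ?thesis using posdef_on_pos[of "{a}" A a "\<lambda>_. 1"] by simp
qed

text \<open>The value \<open>t\<close> minimises the form of \<open>A\<close> in coordinate
  \<open>a\<close> with the other coordinates held fixed, and the minimum is the form of the Schur
  complement.\<close>

lemma posdef_on_schur:
  assumes A: "posdef_on (insert a S) A" and fin: "finite S" and a: "a \<notin> S"
  shows "posdef_on S (schur a A)"
  unfolding posdef_on_def
proof (intro conjI ballI allI impI)
  note sym = posdef_on_symD[OF A]
  have aa: "A a a > 0" using posdef_on_diag_pos[OF A] fin by simp
  show "schur a A i j = schur a A j i" if "i \<in> S" "j \<in> S" for i j
    using that sym[of i j] sym[of i a] sym[of j a] by (simp add: schur_def)
  fix v :: "nat \<Rightarrow> real" assume "\<exists>i\<in>S. v i \<noteq> 0"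
  then obtain i where i: "i \<in> S" "v i \<noteq> 0" by blast
  define r where "r = (\<Sum>j\<in>S. A a j * v j)"
  define t where "t = - r / A a a"
  define w where "w = v(a := t)"
  have r2: "(\<Sum>i\<in>S. v i * A i a) = r" unfolding r_def using sym by (intro sum.cong) auto
  have wS: "w i = v i" if "i \<in> S" for i using that a by (auto simp: w_def)
  have "0 < (\<Sum>i\<in>insert a S. \<Sum>j\<in>insert a S. w i * A i j * w j)"
    by (rule posdef_on_pos[OF A, of i]) (use i wS in auto)
  also have "\<dots> = t * A a a * t + t * r + (t * r + (\<Sum>i\<in>S. \<Sum>j\<in>S. v i * A i j * v j))"
  proof -
    have "(\<Sum>j\<in>insert a S. w i * A i j * w j) = w i * A i a * t + (\<Sum>j\<in>S. w i * A i j * v j)" for i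
      using fin a wS by (simp add: w_def)
    then have "(\<Sum>i\<in>insert a S. \<Sum>j\<in>insert a S. w i * A i j * w j)
      = (t * A a a * t + (\<Sum>j\<in>S. t * A a j * v j)) + (\<Sum>i\<in>S. v i * A i a * t + (\<Sum>j\<in>S. v i * A i j * v j))"
      using fin a wS by (simp add: w_def)
    also have "(\<Sum>j\<in>S. t * A a j * v j) = t * r" by (simp add: r_def sum_distrib_left mult.assoc)
    also have "(\<Sum>i\<in>S. v i * A i a * t + (\<Sum>j\<in>S. v i * A i j * v j)) = t * r + (\<Sum>i\<in>S. \<Sum>j\<in>S. v i * A i j * v j)"
      by (simp add: sum.distrib flip: r2 sum_distrib_right)
    finally show ?thesis by simp
  qed
  also have "\<dots> = (\<Sum>i\<in>S. \<Sum>j\<in>S. v i * A i j * v j) - r * r / A a a"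
    using aa by (simp add: t_def field_simps)
  also have "r * r / A a a = (\<Sum>i\<in>S. \<Sum>j\<in>S. v i * (A i a * A a j / A a a) * v j)"
  proof -
    have "r * r = (\<Sum>i\<in>S. v i * A i a) * (\<Sum>j\<in>S. A a j * v j)" by (simp add: r2 flip: r_def)
    then show ?thesis by (simp add: sum_product sum_divide_distrib mult_ac)
  qed
  finally show "0 < (\<Sum>i\<in>S. \<Sum>j\<in>S. v i * schur a A i j * v j)"
    by (simp add: schur_def algebra_simps sum_subtractf)
qed

text \<open>Gaussian elimination: the system for the Schur complement determines the other unknowns,
  and the row of \<open>a\<close> then yields \<open>v a\<close>; the pivot \<open>A a a\<close> is
  positive.\<close>

lemma posdef_on_solve:
  assumes "finite S" "posdef_on S A"
  shows "\<exists>v. \<forall>i\<in>S. (\<Sum>j\<in>S. A i j * v j) = b i"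
  using assms
proof (induction S arbitrary: A b rule: finite_induct)
  case (insert a S)
  note sch = posdef_on_schur[OF insert.prems insert.hyps]
  have aa: "A a a > 0" using posdef_on_diag_pos[OF insert.prems] insert.hyps by simp
  obtain w where w: "\<And>i. i \<in> S \<Longrightarrow> (\<Sum>j\<in>S. schur a A i j * w j) = b i - A i a * b a / A a a"
    using insert.IH[OF sch, of "\<lambda>i. b i - A i a * b a / A a a"] by blast
  define r where "r = (\<Sum>j\<in>S. A a j * w j)"
  define v where "v = w(a := (b a - r) / A a a)"
  have sum: "(\<Sum>j\<in>insert a S. A i j * v j) = A i a * ((b a - r) / A a a) + (\<Sum>j\<in>S. A i j * w j)" for i
  proof -
    have "(\<Sum>j\<in>S. A i j * v j) = (\<Sum>j\<in>S. A i j * w j)"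
      using insert.hyps by (intro sum.cong) (auto simp: v_def)
    then show ?thesis using insert.hyps by (simp add: v_def)
  qed
  have "(\<Sum>j\<in>insert a S. A i j * v j) = b i" if "i \<in> insert a S" for i
  proof (cases "i = a")
    case True
    then show ?thesis using aa unfolding sum by (simp add: r_def)
  next
    case False
    then have "i \<in> S" using that by simp
    have "(\<Sum>j\<in>S. schur a A i j * w j) = (\<Sum>j\<in>S. A i j * w j) - A i a * r / A a a"
      unfolding r_def sum_distrib_left sum_divide_distrib sum_subtractf[symmetric]
      by (intro sum.cong) (auto simp: schur_def algebra_simps)
    then have "(\<Sum>j\<in>S. A i j * w j) = b i - A i a * b a / A a a + A i a * r / A a a" using w[OF \<open>i \<in> S\<close>] by simp
    then show ?thesis unfolding sum by (simp add: diff_divide_distrib right_diff_distrib)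
  qed
  then show ?case by blast
qed simp

text \<open>Column \<open>a\<close> of the factor is column \<open>a\<close> of \<open>A\<close>
  divided by \<open>sqrt (A a a)\<close>. What is left of \<open>A\<close> is the Schur complement,
  whose factor fills the other columns and is extended by 0 in row \<open>a\<close>.\<close>

lemma posdef_on_cholesky:
  assumes "finite S" "posdef_on S A"
  shows "\<exists>L. \<forall>i\<in>S. \<forall>j\<in>S. A i j = (\<Sum>k\<in>S. L i k * L j k)"
  using assms
proof (induction S arbitrary: A rule: finite_induct)
  case (insert a S)
  note sch = posdef_on_schur[OF insert.prems insert.hyps]
  have aa: "A a a > 0" using posdef_on_diag_pos[OF insert.prems] insert.hyps by simp
  obtain L where L: "\<And>i j. i \<in> S \<Longrightarrow> j \<in> S \<Longrightarrow> schur a A i j = (\<Sum>k\<in>S. L i k * L j k)"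
    using insert.IH[OF sch] by blast
  define L' where "L' i k = (if k = a then A i a / sqrt (A a a) else if i = a then 0 else L i k)" for i k
  have "A i j = (\<Sum>k\<in>insert a S. L' i k * L' j k)" if ij: "i \<in> insert a S" "j \<in> insert a S" for i j
  proof -
    have "(\<Sum>k\<in>insert a S. L' i k * L' j k) = A i a * A j a / A a a + (\<Sum>k\<in>S. L' i k * L' j k)"
      using insert.hyps aa by (simp add: L'_def)
    also have "(\<Sum>k\<in>S. L' i k * L' j k) = (if i = a \<or> j = a then 0 else schur a A i j)"
    proof (cases "i = a \<or> j = a")
      case True
      then show ?thesis using insert.hyps by (auto simp: L'_def intro!: sum.neutral)
    next
      case False
      then have "(\<Sum>k\<in>S. L' i k * L' j k) = (\<Sum>k\<in>S. L i k * L j k)"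
        using insert.hyps by (intro sum.cong) (auto simp: L'_def)
      then show ?thesis using False L[of i j] ij by simp
    qed
    finally show ?thesis
      using aa posdef_on_symD[OF insert.prems, of j a] posdef_on_symD[OF insert.prems, of i a] ij
      by (auto simp: schur_def split: if_splits)
  qed
  then show ?case by blast
qed simp

lemma posdef_on_kernel_trivial:
  assumes "posdef_on S A" "\<And>i. i \<in> S \<Longrightarrow> (\<Sum>j\<in>S. A i j * v j) = 0" "i \<in> S"
  shows "v i = 0"
proof (rule ccontr)
  assume "v i \<noteq> 0"
  then have "0 < (\<Sum>i\<in>S. \<Sum>j\<in>S. v i * A i j * v j)" using posdef_on_pos[OF assms(1,3)] by blast
  also have "\<dots> = (\<Sum>i\<in>S. v i * (\<Sum>j\<in>S. A i j * v j))" by (simp add: sum_distrib_left mult.assoc)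
  also have "\<dots> = 0" using assms(2) by simp
  finally show False by simp
qed

text \<open>\<open>inv_on\<close> is a definite description and says something only once existence
  and uniqueness are known. Columns exist by solving linear systems; they are unique because the
  kernel is trivial and the entries outside \<open>S\<close> are fixed to 0.\<close>

lemma inv_on_right_inverse:
  assumes fin: "finite S" and A: "posdef_on S A" and "i \<in> S" "j \<in> S"
  shows "(\<Sum>k\<in>S. A i k * inv_on S A k j) = (if i = j then 1 else 0)"
proof -
  let ?P = "\<lambda>B. (\<forall>i\<in>S. \<forall>j\<in>S. (\<Sum>k\<in>S. A i k * B k j) = (if i = j then 1 else 0)) \<and>
    (\<forall>i j. i \<notin> S \<or> j \<notin> S \<longrightarrow> B i j = (0::real))"
  have "\<exists>!B. ?P B"
  proof (rule ex_ex1I)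
    have "\<forall>j. \<exists>v. \<forall>i\<in>S. (\<Sum>k\<in>S. A i k * v k) = (if i = j then 1 else 0)"
      by (intro allI posdef_on_solve[OF fin A])
    then obtain V where V: "\<And>j i. i \<in> S \<Longrightarrow> (\<Sum>k\<in>S. A i k * V j k) = (if i = j then 1 else 0)" by metis
    show "\<exists>B. ?P B"
      by (rule exI[of _ "\<lambda>i j. if i \<in> S \<and> j \<in> S then V j i else 0"]) (auto simp: V cong: sum.cong)
  next
    fix B C assume B: "?P B" and C: "?P C"
    show "B = C"
    proof (intro ext)
      fix i j
      show "B i j = C i j"
      proof (cases "i \<in> S \<and> j \<in> S")
        case True
        have "B i j - C i j = 0"
          by (rule posdef_on_kernel_trivial[OF A, of "\<lambda>k. B k j - C k j"])
             (use B C True in \<open>auto simp: right_diff_distrib sum_subtractf\<close>)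
        then show ?thesis by simp
      qed (use B C in auto)
    qed
  qed
  then have "?P (inv_on S A)" unfolding inv_on_def by (rule theI')
  then show ?thesis using assms(3,4) by blast
qed

text \<open>For the inverse B, the product of transposed B, \<open>A\<close> and B has entry
  \<open>B j i\<close> at \<open>(i, j)\<close> because \<open>A\<close> times B is the identity;
  the same product is symmetric since \<open>A\<close> is.\<close>

lemma inv_on_sym:
  assumes fin: "finite S" and A: "posdef_on S A" and ij: "i \<in> S" "j \<in> S"
  shows "inv_on S A i j = inv_on S A j i"
proof -
  let ?B = "inv_on S A"
  have *: "(\<Sum>k\<in>S. \<Sum>l\<in>S. ?B k i * A k l * ?B l j) = ?B j i" if ij: "i \<in> S" "j \<in> S" for i j
  proof -
    have "(\<Sum>k\<in>S. \<Sum>l\<in>S. ?B k i * A k l * ?B l j) = (\<Sum>k\<in>S. ?B k i * (\<Sum>l\<in>S. A k l * ?B l j))"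
      by (simp add: sum_distrib_left mult.assoc)
    also have "\<dots> = (\<Sum>k\<in>S. ?B k i * (if k = j then 1 else 0))"
      using inv_on_right_inverse[OF fin A _ ij(2)] by (intro sum.cong) auto
    also have "\<dots> = ?B j i" using fin ij by (simp add: if_distrib cong: if_cong)
    finally show ?thesis .
  qed
  have "?B j i = (\<Sum>k\<in>S. \<Sum>l\<in>S. ?B k i * A k l * ?B l j)" using *[OF ij] by simp
  also have "\<dots> = (\<Sum>l\<in>S. \<Sum>k\<in>S. ?B k i * A k l * ?B l j)" by (rule sum.swap)
  also have "\<dots> = (\<Sum>l\<in>S. \<Sum>k\<in>S. ?B l j * A l k * ?B k i)"
    using posdef_on_symD[OF A] by (intro sum.cong) (auto simp: mult_ac)
  also have "\<dots> = ?B i j" by (rule *[OF ij(2,1)])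
  finally show ?thesis by simp
qed

section \<open>Construction of Gaussian measures\<close>

lemma cis_sum: "cis (\<Sum>i\<in>S. f i) = (\<Prod>i\<in>S. cis (f i))"
  by (induction S rule: infinite_finite_induct) (auto simp: cis_mult[symmetric])

text \<open>The measure is the image of independent standard normal variables under the linear map
  \<open>L\<close>; by independence its characteristic function is a product of one-dimensional
  ones.\<close>

lemma gaussian_on_exists:
  assumes fin: "finite S" and V: "\<And>i j. i \<in> S \<Longrightarrow> j \<in> S \<Longrightarrow> V i j = (\<Sum>k\<in>S. L i k * L j k)"
  shows "\<exists>\<mu>. gaussian_on S V \<mu>"
proof -
  let ?N = "std_normal_distribution"
  have N: "prob_space ?N" by (rule prob_space_normal_density) simp
  interpret N: product_prob_space "\<lambda>_. ?N" S
    by (intro product_prob_space.intro product_prob_space_axioms.intro product_sigma_finite.intro)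
       (use N in \<open>auto intro: prob_space_imp_sigma_finite\<close>)
  define P where "P = Pi\<^sub>M S (\<lambda>_::nat. ?N)"
  have P: "prob_space P" unfolding P_def using N by (intro prob_space_PiM)
  have sP: "sets P = sets (Pi\<^sub>M S (\<lambda>_. borel))" unfolding P_def by (intro sets_PiM_cong) auto
  define h where "h z = (\<lambda>i\<in>S. \<Sum>k\<in>S. L i k * z k)" for z :: "nat \<Rightarrow> real"
  have h[measurable]: "h \<in> measurable P (Pi\<^sub>M S (\<lambda>_. borel))"
    unfolding h_def measurable_cong_sets[OF sP refl] by measurable
  define \<mu> where "\<mu> = distr P (Pi\<^sub>M S (\<lambda>_. borel)) h"
  have "(\<integral>x. cis (\<Sum>i\<in>S. \<xi> i * x i) \<partial>\<mu>) =
         complex_of_real (exp (- (\<Sum>i\<in>S. \<Sum>j\<in>S. \<xi> i * V i j * \<xi> j) / 2))" for \<xi>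
  proof -
    define c where "c k = (\<Sum>i\<in>S. \<xi> i * L i k)" for k
    have "(\<lambda>x. cis (\<Sum>i\<in>S. \<xi> i * x i)) \<in> borel_measurable (Pi\<^sub>M S (\<lambda>_. borel :: real measure))"
      unfolding cis_conv_exp by measurable
    then have "(\<integral>x. cis (\<Sum>i\<in>S. \<xi> i * x i) \<partial>\<mu>) = (\<integral>z. cis (\<Sum>i\<in>S. \<xi> i * h z i) \<partial>P)"
      unfolding \<mu>_def by (intro integral_distr) auto
    also have "\<dots> = (\<integral>z. (\<Prod>k\<in>S. cis (c k * z k)) \<partial>P)"
    proof (rule Bochner_Integration.integral_cong[OF refl])
      fix z :: "nat \<Rightarrow> real"
      have "(\<Sum>i\<in>S. \<xi> i * h z i) = (\<Sum>i\<in>S. \<Sum>k\<in>S. \<xi> i * L i k * z k)"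
        by (simp add: h_def sum_distrib_left mult.assoc)
      also have "\<dots> = (\<Sum>k\<in>S. c k * z k)"
        by (subst sum.swap) (simp add: c_def sum_distrib_right)
      finally show "cis (\<Sum>i\<in>S. \<xi> i * h z i) = (\<Prod>k\<in>S. cis (c k * z k))" by (simp add: cis_sum)
    qed
    also have "\<dots> = (\<Prod>k\<in>S. \<integral>u. cis (c k * u) \<partial>?N)"
      unfolding P_def
    proof (rule N.product_integral_prod[OF fin])
      show "integrable ?N (\<lambda>u. cis (c k * u))" for k
        by (rule finite_measure.integrable_const_bound[OF prob_space.finite_measure[OF N], of _ 1]) (auto simp: cis_conv_exp)
    qed
    also have "\<dots> = (\<Prod>k\<in>S. of_real (exp (- (c k)\<^sup>2 / 2)))"
    proof (rule prod.cong[OF refl])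
      fix k
      have "(\<integral>u. cis (c k * u) \<partial>?N) = char ?N (c k)"
        unfolding char_def cis_conv_exp by simp
      then show "(\<integral>u. cis (c k * u) \<partial>?N) = of_real (exp (- (c k)\<^sup>2 / 2))"
        by (simp only: char_std_normal_distribution)
    qed
    also have "\<dots> = of_real (exp (- (\<Sum>k\<in>S. (c k)\<^sup>2) / 2))"
      using fin by (simp add: exp_sum[symmetric] sum_negf sum_divide_distrib flip: of_real_prod)
    also have "(\<Sum>k\<in>S. (c k)\<^sup>2) = (\<Sum>k\<in>S. \<Sum>i\<in>S. \<Sum>j\<in>S. \<xi> i * L i k * (\<xi> j * L j k))"
      by (simp add: c_def power2_eq_square sum_product)
    also have "\<dots> = (\<Sum>i\<in>S. \<Sum>j\<in>S. \<Sum>k\<in>S. \<xi> i * L i k * (\<xi> j * L j k))"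
      by (subst sum.swap) (intro sum.cong refl sum.swap)
    also have "\<dots> = (\<Sum>i\<in>S. \<Sum>j\<in>S. \<xi> i * V i j * \<xi> j)"
      using V by (intro sum.cong refl) (simp add: sum_distrib_left sum_distrib_right mult_ac)
    finally show ?thesis .
  qed
  moreover have "prob_space \<mu>" unfolding \<mu>_def by (rule prob_space.prob_space_distr[OF P h])
  ultimately show ?thesis unfolding gaussian_on_def by (intro exI[of _ \<mu>]) (auto simp: \<mu>_def)
qed

section \<open>Asymptotics of the adaptive lasso\<close>

lemma quad_form_coord_update:
  fixes A :: "nat \<Rightarrow> nat \<Rightarrow> real"
  assumes sym: "\<And>i k. i < p \<Longrightarrow> k < p \<Longrightarrow> A i k = A k i" and j: "j < p"
  shows "(\<Sum>i<p. \<Sum>k<p. (h(j := h j + e)) i * A i k * (h(j := h j + e)) k)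
    = (\<Sum>i<p. \<Sum>k<p. h i * A i k * h k) + 2 * e * (\<Sum>i<p. A j i * h i) + e\<^sup>2 * A j j"
proof -
  define d where "d i = (if i = j then e else 0)" for i
  have h: "(h(j := h j + e)) i = h i + d i" for i by (simp add: d_def)
  have "(\<Sum>i<p. \<Sum>k<p. (h i + d i) * A i k * (h k + d k)) = (\<Sum>i<p. \<Sum>k<p. h i * A i k * h k)
     + (\<Sum>i<p. \<Sum>k<p. h i * A i k * d k) + (\<Sum>i<p. \<Sum>k<p. d i * A i k * h k) + (\<Sum>i<p. \<Sum>k<p. d i * A i k * d k)"
    by (simp add: sum.distrib algebra_simps)
  also have "(\<Sum>i<p. \<Sum>k<p. h i * A i k * d k) = (\<Sum>i<p. h i * A i j * e)"
    using j by (intro sum.cong) (auto simp: d_def if_distrib cong: if_cong)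
  also have "\<dots> = e * (\<Sum>i<p. A j i * h i)"
    using sym[OF j] by (auto simp: sum_distrib_left intro!: sum.cong)
  also have "(\<Sum>i<p. \<Sum>k<p. d i * A i k * h k) = (\<Sum>i<p. d i * (\<Sum>k<p. A i k * h k))"
    by (simp add: sum_distrib_left mult.assoc)
  also have "\<dots> = e * (\<Sum>i<p. A j i * h i)"
    using j by (simp add: d_def if_distrib[of "\<lambda>u. u * _"] cong: if_cong)
  also have "(\<Sum>i<p. \<Sum>k<p. d i * A i k * d k) = (\<Sum>i<p. d i * (\<Sum>k<p. A i k * d k))"
    by (simp add: sum_distrib_left mult.assoc)
  also have "\<dots> = e * (e * A j j)"
  proof -
    have "(\<Sum>k<p. A i k * d k) = A i j * e" for i
      using j by (simp add: d_def if_distrib cong: if_cong)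
    then show ?thesis using j by (simp add: d_def if_distrib[of "\<lambda>u. u * _"] cong: if_cong)
  qed
  finally show ?thesis unfolding h by (simp add: power2_eq_square)
qed

text \<open>This replaces a subdifferential: if the slope \<open>2 * \<bar>D\<bar>\<close> exceeded
  the penalty slope \<open>b\<close>, a short step against the sign of \<open>D\<close> would make
  the right-hand side negative.\<close>

lemma abs_le_if_linear_dominates:
  fixes D b c \<epsilon> :: real
  assumes "\<epsilon> > 0" "c \<ge> 0" and *: "\<And>e. \<bar>e\<bar> < \<epsilon> \<Longrightarrow> 0 \<le> 2 * e * D + e\<^sup>2 * c + b * \<bar>e\<bar>"
  shows "\<bar>D\<bar> \<le> b / 2"
proof (rule ccontr)
  assume "\<not> ?thesis"
  then have g: "2 * \<bar>D\<bar> - b > 0" by simp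
  \<comment> \<open>Short enough to be admissible and to give
    \<open>t * c < 2 * \<bar>D\<bar> - b\<close>; the summand 1 avoids division by 0 when
    \<open>c = 0\<close>.\<close>
  define t where "t = min (\<epsilon> / 2) ((2 * \<bar>D\<bar> - b) / (2 * (c + 1)))"
  have t: "t > 0" "t < \<epsilon>" using g assms by (auto simp: t_def)
  have "t * (c + 1) \<le> (2 * \<bar>D\<bar> - b) / (2 * (c + 1)) * (c + 1)"
    using assms by (intro mult_right_mono) (auto simp: t_def)
  also have "\<dots> = (2 * \<bar>D\<bar> - b) / 2" using assms(2) by (simp add: divide_simps)
  finally have "t * c + t \<le> (2 * \<bar>D\<bar> - b) / 2" by (simp add: distrib_left)
  moreover have "(2 * \<bar>D\<bar> - b) / 2 < 2 * \<bar>D\<bar> - b" using g by simp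
  ultimately have tc: "t * c < 2 * \<bar>D\<bar> - b" using t(1) by linarith
  have "0 \<le> 2 * (- sgn D * t) * D + (- sgn D * t)\<^sup>2 * c + b * \<bar>- sgn D * t\<bar>"
    by (rule *) (use t in \<open>auto simp: abs_mult sgn_if\<close>)
  \<comment> \<open>For \<open>D = 0\<close> the step \<open>- sgn D * t\<close> is 0 and carries no
    information, so the assumption is used at \<open>t\<close> itself.\<close>
  also have "\<dots> \<le> - (2 * \<bar>D\<bar>) * t + t\<^sup>2 * c + b * t"
  proof (cases "D = 0")
    case True
    then have "b < 0" using g by simp
    then show ?thesis using True * [of "t"] t by (simp add: power2_eq_square)
  qed (use t in \<open>auto simp: sgn_if abs_if power2_eq_square\<close>)
  also have "\<dots> = t * (t * c - (2 * \<bar>D\<bar> - b))" by (simp add: algebra_simps power2_eq_square)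
  also have "\<dots> < 0" using t tc by (simp add: mult_pos_neg)
  finally show False by simp
qed

text \<open>With \<open>n\<close> the sum of the absolute values, coercivity gives at least
  \<open>c * n * n\<close> on the left and the linear terms at most \<open>(2 * g + l) * n\<close>
  on the right. Here \<open>l\<close> is the penalty slope: 0 for the unpenalised estimator and
  \<open>lam * w\<close> for the adaptive lasso.\<close>

lemma quad_objective_bound:
  fixes A :: "nat \<Rightarrow> nat \<Rightarrow> real"
  assumes coer: "c * (\<Sum>i<p. \<bar>h i\<bar>)\<^sup>2 \<le> (\<Sum>i<p. \<Sum>k<p. h i * A i k * h k)"
    and le: "(\<Sum>i<p. \<Sum>k<p. h i * A i k * h k) \<le> 2 * (\<Sum>i<p. h i * G i) + l * (\<Sum>i<p. \<bar>h i\<bar>)"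
    and G: "\<And>i. i < p \<Longrightarrow> \<bar>G i\<bar> \<le> g" and "0 \<le> 2 * g + l"
  shows "c * (\<Sum>i<p. \<bar>h i\<bar>) \<le> 2 * g + l"
proof -
  define n where "n = (\<Sum>i<p. \<bar>h i\<bar>)"
  have n0: "n \<ge> 0" unfolding n_def by (rule sum_nonneg) simp
  have "h i * G i \<le> \<bar>h i\<bar> * g" if "i < p" for i
    using mult_left_mono[OF G[OF that], of "\<bar>h i\<bar>"] abs_ge_self[of "h i * G i"] by (simp add: abs_mult)
  then have "(\<Sum>i<p. h i * G i) \<le> n * g" unfolding n_def sum_distrib_right by (intro sum_mono) auto
  then have "c * n * n \<le> (2 * g + l) * n"
    using coer le unfolding n_def[symmetric] by (simp add: power2_eq_square algebra_simps)
  then show ?thesis using n0 assms(4) unfolding n_def[symmetric] by (cases "n = 0") auto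
qed

text \<open>\<open>\<tau>\<close> is the sample size. By \<open>c1\<close> the unpenalised estimator
  stays at least \<open>m / 2\<close> away from 0 on active coordinates, which bounds their weights;
  by \<open>c2\<close> the resulting slope is at most \<open>sqrt \<tau>\<close>, whence the 1 in
  \<open>2 * R + 1\<close>; by \<open>c3\<close> the estimator stays inside the box; by
  \<open>c4\<close> the penalty prevails on inactive coordinates. A quotient by 0 is 0, so
  \<open>adapt_pen\<close> itself puts no weight on coordinates with \<open>\<theta>t j = 0\<close>;
  forcing these to 0 represents an infinite weight.\<close>

lemma adaptive_lasso_deterministic:
  fixes A :: "nat \<Rightarrow> nat \<Rightarrow> real" and G \<theta>0 \<theta>t \<theta>h :: "nat \<Rightarrow> real" and obj :: "(nat \<Rightarrow> real) \<Rightarrow> real"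
  assumes sym: "\<And>i k. i < p \<Longrightarrow> k < p \<Longrightarrow> A i k = A k i"
    and quad: "\<And>\<theta>. obj \<theta> = c0 - 2 * (\<Sum>i<p. (\<theta> i - \<theta>0 i) * G i)
                 + (\<Sum>i<p. \<Sum>k<p. (\<theta> i - \<theta>0 i) * A i k * (\<theta> k - \<theta>0 k))"
    and coer: "\<And>h. \<kappa> * \<tau> * (\<Sum>i<p. \<bar>h i\<bar>)\<^sup>2 \<le> (\<Sum>i<p. \<Sum>k<p. h i * A i k * h k)"
    and Abd: "\<And>i k. i < p \<Longrightarrow> k < p \<Longrightarrow> \<bar>A i k\<bar> \<le> a * \<tau>"
    and Gbd: "\<And>i. i < p \<Longrightarrow> \<bar>G i\<bar> \<le> R * sqrt \<tau>"
    and pos: "\<kappa> > 0" "\<tau> > 0" "a \<ge> 0" "R > 0" "m > 0" "lam > 0" "\<gamma> > 0" "r > 0"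
    and \<theta>0: "\<theta>0 \<in> Rp p" and sub: "\<Theta> \<subseteq> Rp p"
    and box: "\<And>\<theta>. \<theta> \<in> Rp p \<Longrightarrow> (\<And>i. i < p \<Longrightarrow> \<bar>\<theta> i - \<theta>0 i\<bar> < r) \<Longrightarrow> \<theta> \<in> \<Theta>"
    and m: "\<And>j. j < p \<Longrightarrow> \<theta>0 j \<noteq> 0 \<Longrightarrow> m \<le> \<bar>\<theta>0 j\<bar>"
    and tilde: "\<And>\<theta>. \<theta> \<in> \<Theta> \<Longrightarrow> obj \<theta>t \<le> obj \<theta>"
    and hat1: "\<theta>h \<in> \<Theta>" "\<And>j. j < p \<Longrightarrow> \<theta>t j = 0 \<Longrightarrow> \<theta>h j = 0"
    and hat2: "\<And>\<theta>. \<theta> \<in> \<Theta> \<Longrightarrow> (\<And>j. j < p \<Longrightarrow> \<theta>t j = 0 \<Longrightarrow> \<theta> j = 0) \<Longrightarrow>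
        obj \<theta>h + lam * adapt_pen p \<gamma> \<theta>t \<theta>h \<le> obj \<theta> + lam * adapt_pen p \<gamma> \<theta>t \<theta>"
    and c1: "2 * R / (\<kappa> * sqrt \<tau>) \<le> m / 2"
    and c2: "lam * (m / 2) powr (- \<gamma>) \<le> sqrt \<tau>"
    and c3: "(2 * R + 1) / (\<kappa> * sqrt \<tau>) < r"
    and c4: "(2 * R / \<kappa>) powr \<gamma> * (2 * R + 3 * a * ((2 * R + 1) / \<kappa>)) < lam * \<tau> powr ((\<gamma> - 1) / 2)"
  shows "(\<forall>j<p. \<theta>0 j = 0 \<longrightarrow> \<theta>h j = 0) \<and> (\<Sum>i<p. \<bar>\<theta>h i - \<theta>0 i\<bar>) \<le> (2 * R + 1) / (\<kappa> * sqrt \<tau>) \<and>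
    (\<forall>j<p. \<theta>0 j \<noteq> 0 \<longrightarrow> \<bar>(\<Sum>i<p. A j i * (\<theta>h i - \<theta>0 i)) - G j\<bar> \<le> lam * (m / 2) powr (- \<gamma>) / 2)"
proof -
  define w where "w = (m / 2) powr (- \<gamma>)"
  have w: "w > 0" using pos by (simp add: w_def)
  have sq: "sqrt \<tau> > 0" "sqrt \<tau> * sqrt \<tau> = \<tau>" using pos by auto
  have \<theta>0\<Theta>: "\<theta>0 \<in> \<Theta>" by (rule box[OF \<theta>0]) (use pos in auto)
  have obj0: "obj \<theta>0 = c0" by (simp add: quad)
  have scale: "x \<le> y / (\<kappa> * sqrt \<tau>)" if "\<kappa> * \<tau> * x \<le> y * sqrt \<tau>" for x y
  proof -
    have "(\<kappa> * sqrt \<tau> * x) * sqrt \<tau> = \<kappa> * (sqrt \<tau> * sqrt \<tau>) * x" by (simp only: mult_ac)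
    also have "\<dots> = \<kappa> * \<tau> * x" by (simp only: sq(2))
    finally have "(\<kappa> * sqrt \<tau> * x) * sqrt \<tau> \<le> y * sqrt \<tau>" using that by linarith
    then have "\<kappa> * sqrt \<tau> * x \<le> y" by (rule mult_right_le_imp_le[OF _ sq(1)])
    then show ?thesis using pos sq by (simp add: pos_le_divide_eq mult.commute)
  qed
  define n where "n = (\<Sum>i<p. \<bar>\<theta>h i - \<theta>0 i\<bar>)"
  have t1: "(\<Sum>i<p. \<bar>\<theta>t i - \<theta>0 i\<bar>) \<le> 2 * R / (\<kappa> * sqrt \<tau>)"
  proof (rule scale)
    have "\<kappa> * \<tau> * (\<Sum>i<p. \<bar>\<theta>t i - \<theta>0 i\<bar>) \<le> 2 * (R * sqrt \<tau>) + 0"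
      by (rule quad_objective_bound[OF coer _ Gbd])
         (use tilde[OF \<theta>0\<Theta>] pos in \<open>auto simp: obj0 quad[of \<theta>t]\<close>)
    then show "\<kappa> * \<tau> * (\<Sum>i<p. \<bar>\<theta>t i - \<theta>0 i\<bar>) \<le> 2 * R * sqrt \<tau>" by simp
  qed
  have tj: "\<bar>\<theta>t j - \<theta>0 j\<bar> \<le> 2 * R / (\<kappa> * sqrt \<tau>)" if "j < p" for j
    using member_le_sum[of j "{..<p}" "\<lambda>i. \<bar>\<theta>t i - \<theta>0 i\<bar>"] that t1 by simp
  have tS: "m / 2 \<le> \<bar>\<theta>t j\<bar>" if "j < p" "\<theta>0 j \<noteq> 0" for j
    using tj[OF that(1)] m[OF that] c1 by linarith
  have wS: "1 / \<bar>\<theta>t j\<bar> powr \<gamma> \<le> w" if "j < p" "\<theta>0 j \<noteq> 0" for j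
  proof -
    have "1 / \<bar>\<theta>t j\<bar> powr \<gamma> \<le> 1 / (m / 2) powr \<gamma>"
      using tS[OF that] pos by (intro divide_left_mono powr_mono2) auto
    then show ?thesis by (simp add: w_def powr_minus inverse_eq_divide)
  qed
  have pen_diff: "\<bar>x\<bar> / \<bar>\<theta>t j\<bar> powr \<gamma> - \<bar>y\<bar> / \<bar>\<theta>t j\<bar> powr \<gamma> \<le> w * \<bar>x - y\<bar>" if "j < p" "\<theta>0 j \<noteq> 0" for x y j
  proof -
    have "\<bar>x\<bar> / \<bar>\<theta>t j\<bar> powr \<gamma> - \<bar>y\<bar> / \<bar>\<theta>t j\<bar> powr \<gamma> = (\<bar>x\<bar> - \<bar>y\<bar>) * (1 / \<bar>\<theta>t j\<bar> powr \<gamma>)"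
      by (simp add: diff_divide_distrib)
    also have "\<dots> \<le> \<bar>x - y\<bar> * (1 / \<bar>\<theta>t j\<bar> powr \<gamma>)" by (intro mult_right_mono) auto
    also have "\<dots> \<le> \<bar>x - y\<bar> * w" using wS[OF that] by (intro mult_left_mono) auto
    finally show ?thesis by (simp add: mult.commute)
  qed
  \<comment> \<open>The competitor is \<open>\<theta>0\<close>, feasible because
    \<open>\<theta>t\<close> vanishes on no active coordinate. An inactive coordinate of
    \<open>\<theta>0\<close> costs no penalty, so only active coordinates count in the difference,
    each with slope at most \<open>w\<close>.\<close>
  have n_bd: "\<kappa> * \<tau> * n \<le> (2 * R + 1) * sqrt \<tau>"
  proof -
    have "obj \<theta>h + lam * adapt_pen p \<gamma> \<theta>t \<theta>h \<le> obj \<theta>0 + lam * adapt_pen p \<gamma> \<theta>t \<theta>0"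
    proof (rule hat2[OF \<theta>0\<Theta>])
      show "\<theta>0 j = 0" if "j < p" "\<theta>t j = 0" for j
        using tS[OF that(1)] that(2) pos by fastforce
    qed
    moreover have "adapt_pen p \<gamma> \<theta>t \<theta>0 - adapt_pen p \<gamma> \<theta>t \<theta>h \<le> w * n"
      unfolding adapt_pen_def n_def sum_subtractf[symmetric] sum_distrib_left
    proof (rule sum_mono)
      fix j assume "j \<in> {..<p}"
      then show "\<bar>\<theta>0 j\<bar> / \<bar>\<theta>t j\<bar> powr \<gamma> - \<bar>\<theta>h j\<bar> / \<bar>\<theta>t j\<bar> powr \<gamma> \<le> w * \<bar>\<theta>h j - \<theta>0 j\<bar>"
        using pen_diff[of j "\<theta>0 j" "\<theta>h j"] w
        by (cases "\<theta>0 j = 0") (auto simp: abs_minus_commute intro: order_trans[of _ 0])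
    qed
    then have "lam * (adapt_pen p \<gamma> \<theta>t \<theta>0 - adapt_pen p \<gamma> \<theta>t \<theta>h) \<le> lam * (w * n)"
      using pos by (intro mult_left_mono) auto
    ultimately have le: "obj \<theta>h \<le> obj \<theta>0 + lam * w * n" by (simp add: algebra_simps)
    have "\<kappa> * \<tau> * n \<le> 2 * (R * sqrt \<tau>) + lam * w" unfolding n_def
      by (rule quad_objective_bound[OF coer _ Gbd])
         (use le pos w in \<open>auto simp: obj0 quad[of \<theta>h] n_def\<close>)
    then show ?thesis using c2 by (simp add: w_def algebra_simps)
  qed
  have n1: "n \<le> (2 * R + 1) / (\<kappa> * sqrt \<tau>)" by (rule scale[OF n_bd])
  have nr: "n < r" using n1 c3 by simp
  have hj: "\<bar>\<theta>h j - \<theta>0 j\<bar> \<le> n" if "j < p" for j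
    unfolding n_def using that by (intro member_le_sum[of j "{..<p}" "\<lambda>i. \<bar>\<theta>h i - \<theta>0 i\<bar>"]) auto
  have Ahj: "\<bar>\<Sum>i<p. A j i * (\<theta>h i - \<theta>0 i)\<bar> \<le> a * \<tau> * n" if "j < p" for j
  proof -
    have "\<bar>\<Sum>i<p. A j i * (\<theta>h i - \<theta>0 i)\<bar> \<le> (\<Sum>i<p. \<bar>A j i * (\<theta>h i - \<theta>0 i)\<bar>)" by (rule sum_abs)
    also have "\<dots> \<le> (\<Sum>i<p. a * \<tau> * \<bar>\<theta>h i - \<theta>0 i\<bar>)"
      using Abd[OF that] by (intro sum_mono) (auto simp: abs_mult intro!: mult_right_mono)
    finally show ?thesis by (simp add: n_def sum_distrib_left)
  qed
  have upd: "obj (\<theta>h(j := \<theta>h j + e)) = obj \<theta>h + (2 * e * ((\<Sum>i<p. A j i * (\<theta>h i - \<theta>0 i)) - G j) + e\<^sup>2 * A j j)"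
    if "j < p" for j e
  proof -
    define h where "h i = \<theta>h i - \<theta>0 i" for i
    have h: "(\<theta>h(j := \<theta>h j + e)) i - \<theta>0 i = (h(j := h j + e)) i" for i by (simp add: h_def)
    have "(\<Sum>i<p. (h(j := h j + e)) i * G i) = (\<Sum>i<p. h i * G i + (if i = j then e * G j else 0))"
      by (intro sum.cong) (auto simp: algebra_simps)
    also have "\<dots> = (\<Sum>i<p. h i * G i) + e * G j" using that by (simp add: sum.distrib)
    finally have 1: "(\<Sum>i<p. (h(j := h j + e)) i * G i) = (\<Sum>i<p. h i * G i) + e * G j" .
    have 2: "(\<Sum>i<p. \<Sum>k<p. (h(j := h j + e)) i * A i k * (h(j := h j + e)) k)
      = (\<Sum>i<p. \<Sum>k<p. h i * A i k * h k) + 2 * e * (\<Sum>i<p. A j i * h i) + e\<^sup>2 * A j j"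
      by (rule quad_form_coord_update[OF _ that]) (rule sym)
    show ?thesis
      unfolding quad[of "\<theta>h(j := \<theta>h j + e)"] quad[of \<theta>h] h 1 2
      by (simp only: h_def[symmetric]) (simp add: algebra_simps)
  qed
  have pen_upd: "adapt_pen p \<gamma> \<theta>t (\<theta>h(j := y)) = adapt_pen p \<gamma> \<theta>t \<theta>h + (\<bar>y\<bar> / \<bar>\<theta>t j\<bar> powr \<gamma> - \<bar>\<theta>h j\<bar> / \<bar>\<theta>t j\<bar> powr \<gamma>)"
    if "j < p" for j y
  proof -
    have "adapt_pen p \<gamma> \<theta>t (\<theta>h(j := y)) = (\<Sum>i<p. \<bar>\<theta>h i\<bar> / \<bar>\<theta>t i\<bar> powr \<gamma> +
        (if i = j then \<bar>y\<bar> / \<bar>\<theta>t j\<bar> powr \<gamma> - \<bar>\<theta>h j\<bar> / \<bar>\<theta>t j\<bar> powr \<gamma> else 0))"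
      unfolding adapt_pen_def by (intro sum.cong) auto
    then show ?thesis using that by (simp add: sum.distrib adapt_pen_def)
  qed
  have updR: "\<theta>h(j := y) \<in> Rp p" if "j < p" for j y
    using hat1(1) sub that by (auto simp: Rp_def)
  have sparse: "\<theta>h j = 0" if j: "j < p" "\<theta>0 j = 0" for j
  proof (rule ccontr)
    assume nz: "\<theta>h j \<noteq> 0"
    then have tnz: "\<theta>t j \<noteq> 0" using hat1(2)[OF j(1)] by blast
    let ?A = "\<Sum>i<p. A j i * (\<theta>h i - \<theta>0 i)"
    have in\<Theta>: "\<theta>h(j := \<theta>h j + - \<theta>h j) \<in> \<Theta>"
    proof (rule box[OF updR[OF j(1)]])
      show "\<bar>(\<theta>h(j := \<theta>h j + - \<theta>h j)) i - \<theta>0 i\<bar> < r" if "i < p" for i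
        using hj[OF that] nr j pos by auto
    qed
    have "obj \<theta>h + lam * adapt_pen p \<gamma> \<theta>t \<theta>h
      \<le> obj (\<theta>h(j := \<theta>h j + - \<theta>h j)) + lam * adapt_pen p \<gamma> \<theta>t (\<theta>h(j := \<theta>h j + - \<theta>h j))"
      by (rule hat2[OF in\<Theta>]) (use hat1(2) in auto)
    then have "lam * (\<bar>\<theta>h j\<bar> / \<bar>\<theta>t j\<bar> powr \<gamma>) \<le> 2 * \<theta>h j * (G j - ?A) + (\<theta>h j)\<^sup>2 * A j j"
      unfolding upd[OF j(1)] pen_upd[OF j(1)] by (simp add: algebra_simps)
    \<comment> \<open>The gradient gives \<open>2 * a * \<tau> * n\<close> and the quadratic term
      another \<open>a * \<tau> * n\<close>, as one of its factors
      \<open>\<bar>\<theta>h j\<bar>\<close> is at most \<open>n\<close>. This is the 3 in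
      \<open>c4\<close>.\<close>
    also have "\<dots> \<le> \<bar>\<theta>h j\<bar> * (2 * (R * sqrt \<tau> + a * \<tau> * n)) + \<bar>\<theta>h j\<bar> * (n * (a * \<tau>))"
    proof (rule add_mono)
      have "2 * \<theta>h j * (G j - ?A) \<le> \<bar>2 * \<theta>h j * (G j - ?A)\<bar>" by (rule abs_ge_self)
      also have "\<dots> = \<bar>\<theta>h j\<bar> * (2 * \<bar>G j - ?A\<bar>)" by (simp add: abs_mult)
      also have "\<dots> \<le> \<bar>\<theta>h j\<bar> * (2 * (R * sqrt \<tau> + a * \<tau> * n))"
        using Gbd[OF j(1)] Ahj[OF j(1)] by (intro mult_left_mono) auto
      finally show "2 * \<theta>h j * (G j - ?A) \<le> \<bar>\<theta>h j\<bar> * (2 * (R * sqrt \<tau> + a * \<tau> * n))" .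
      have "(\<theta>h j)\<^sup>2 * A j j \<le> \<bar>(\<theta>h j)\<^sup>2 * A j j\<bar>" by (rule abs_ge_self)
      also have "\<dots> = \<bar>\<theta>h j\<bar> * (\<bar>\<theta>h j\<bar> * \<bar>A j j\<bar>)" by (simp add: abs_mult power2_eq_square)
      also have "\<dots> \<le> \<bar>\<theta>h j\<bar> * (n * (a * \<tau>))"
        using hj[OF j(1)] Abd[OF j(1) j(1)] j pos by (intro mult_left_mono mult_mono) auto
      finally show "(\<theta>h j)\<^sup>2 * A j j \<le> \<bar>\<theta>h j\<bar> * (n * (a * \<tau>))" .
    qed
    also have "\<dots> = \<bar>\<theta>h j\<bar> * (2 * R * sqrt \<tau> + 3 * a * (\<tau> * n))" by (simp add: algebra_simps)
    finally have "\<bar>\<theta>h j\<bar> * (lam / \<bar>\<theta>t j\<bar> powr \<gamma>) \<le> \<bar>\<theta>h j\<bar> * (2 * R * sqrt \<tau> + 3 * a * (\<tau> * n))"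
      by (simp add: mult_ac)
    then have "lam / \<bar>\<theta>t j\<bar> powr \<gamma> \<le> 2 * R * sqrt \<tau> + 3 * a * (\<tau> * n)"
      by (rule mult_left_le_imp_le) (use nz in simp)
    also have "\<dots> \<le> 2 * R * sqrt \<tau> + 3 * a * ((2 * R + 1) / \<kappa> * sqrt \<tau>)"
    proof -
      have "\<tau> * n \<le> (2 * R + 1) / \<kappa> * sqrt \<tau>" using n_bd pos by (simp add: pos_le_divide_eq mult_ac)
      then have "3 * a * (\<tau> * n) \<le> 3 * a * ((2 * R + 1) / \<kappa> * sqrt \<tau>)" using pos by (intro mult_left_mono) auto
      then show ?thesis by simp
    qed
    also have "\<dots> = (2 * R + 3 * a * ((2 * R + 1) / \<kappa>)) * sqrt \<tau>" by (simp add: algebra_simps)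
    finally have "lam / \<bar>\<theta>t j\<bar> powr \<gamma> \<le> (2 * R + 3 * a * ((2 * R + 1) / \<kappa>)) * sqrt \<tau>" (is "_ \<le> ?c * _") .
    then have "lam \<le> \<bar>\<theta>t j\<bar> powr \<gamma> * (?c * sqrt \<tau>)"
      using tnz by (simp add: pos_divide_le_eq mult.commute)
    also have "\<dots> \<le> (2 * R / (\<kappa> * sqrt \<tau>)) powr \<gamma> * (?c * sqrt \<tau>)"
      using tj[OF j(1)] j(2) pos by (intro mult_right_mono powr_mono2) auto
    also have "(2 * R / (\<kappa> * sqrt \<tau>)) powr \<gamma> = (2 * R / \<kappa>) powr \<gamma> * \<tau> powr (- \<gamma> / 2)"
    proof -
      have "2 * R / (\<kappa> * sqrt \<tau>) = (2 * R / \<kappa>) * \<tau> powr (- (1/2))"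
        using pos by (simp add: powr_minus powr_half_sqrt field_simps)
      also have "\<dots> powr \<gamma> = (2 * R / \<kappa>) powr \<gamma> * \<tau> powr (- (1/2) * \<gamma>)"
        using pos by (subst powr_mult) (simp_all add: powr_powr)
      finally show ?thesis by simp
    qed
    finally have "lam \<le> (2 * R / \<kappa>) powr \<gamma> * \<tau> powr (- \<gamma> / 2) * (?c * sqrt \<tau>)" .
    \<comment> \<open>The powers of \<open>\<tau>\<close> have exponents
      \<open>- \<gamma> / 2\<close> from the weight, \<open>1 / 2\<close> from the gradient and
      \<open>(\<gamma> - 1) / 2\<close> from this factor. They add up to 0, which leaves the bound
      excluded by \<open>c4\<close>.\<close>
    then have "lam * \<tau> powr ((\<gamma> - 1) / 2)
        \<le> (2 * R / \<kappa>) powr \<gamma> * \<tau> powr (- \<gamma> / 2) * (?c * sqrt \<tau>) * \<tau> powr ((\<gamma> - 1) / 2)"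
      by (intro mult_right_mono) auto
    also have "\<dots> = (2 * R / \<kappa>) powr \<gamma> * ?c * (\<tau> powr (- \<gamma> / 2) * \<tau> powr (1/2) * \<tau> powr ((\<gamma> - 1) / 2))"
      using pos by (simp add: powr_half_sqrt mult_ac)
    also have "\<tau> powr (- \<gamma> / 2) * \<tau> powr (1/2) * \<tau> powr ((\<gamma> - 1) / 2) = 1"
      using pos by (simp add: powr_add[symmetric] field_simps)
    finally show False using c4 by simp
  qed
  \<comment> \<open>Each coordinate of the estimator is within \<open>n\<close> of its target, so
    moves shorter than \<open>r - n\<close> stay in \<open>\<Theta>\<close>. Such a move changes the
    penalty by at most \<open>lam * w * \<bar>e\<bar>\<close>, and it is feasible because
    \<open>\<theta>t j\<close> is nonzero.\<close>
  have foc: "\<bar>(\<Sum>i<p. A j i * (\<theta>h i - \<theta>0 i)) - G j\<bar> \<le> lam * w / 2" if j: "j < p" "\<theta>0 j \<noteq> 0" for j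
  proof (rule abs_le_if_linear_dominates)
    show "r - n > 0" using nr by simp
    show "0 \<le> \<bar>A j j\<bar>" by simp
    fix e :: real assume e: "\<bar>e\<bar> < r - n"
    have in\<Theta>: "\<theta>h(j := \<theta>h j + e) \<in> \<Theta>"
    proof (rule box[OF updR[OF j(1)]])
      show "\<bar>(\<theta>h(j := \<theta>h j + e)) i - \<theta>0 i\<bar> < r" if "i < p" for i
        using hj[OF that] e nr by auto
    qed
    have "obj \<theta>h + lam * adapt_pen p \<gamma> \<theta>t \<theta>h
      \<le> obj (\<theta>h(j := \<theta>h j + e)) + lam * adapt_pen p \<gamma> \<theta>t (\<theta>h(j := \<theta>h j + e))"
      by (rule hat2[OF in\<Theta>]) (use hat1(2) tS[OF j] pos in auto)
    moreover have "lam * (\<bar>\<theta>h j + e\<bar> / \<bar>\<theta>t j\<bar> powr \<gamma> - \<bar>\<theta>h j\<bar> / \<bar>\<theta>t j\<bar> powr \<gamma>) \<le> lam * (w * \<bar>e\<bar>)"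
      using pen_diff[OF j, of "\<theta>h j + e" "\<theta>h j"] pos by (intro mult_left_mono) auto
    moreover have "e\<^sup>2 * A j j \<le> e\<^sup>2 * \<bar>A j j\<bar>" by (intro mult_left_mono) auto
    ultimately show "0 \<le> 2 * e * ((\<Sum>i<p. A j i * (\<theta>h i - \<theta>0 i)) - G j) + e\<^sup>2 * \<bar>A j j\<bar> + lam * w * \<bar>e\<bar>"
      unfolding upd[OF j(1)] pen_upd[OF j(1)] by (simp add: distrib_left)
  qed
  show ?thesis using sparse n1 foc unfolding n_def w_def by blast
qed

section \<open>Passage from the deterministic bounds to limits in probability and in
  distribution\<close>

text \<open>Used with \<open>\<delta> = \<kappa> / 2\<close>, so that the random form keeps half of
  the coercivity of \<open>C\<close>.\<close>

lemma quad_form_perturb: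
  fixes A C :: "nat \<Rightarrow> nat \<Rightarrow> real"
  assumes "\<And>i k. i < p \<Longrightarrow> k < p \<Longrightarrow> \<bar>A i k - C i k\<bar> \<le> \<delta>"
  shows "(\<Sum>i<p. \<Sum>k<p. h i * C i k * h k) - \<delta> * (\<Sum>i<p. \<bar>h i\<bar>)\<^sup>2 \<le> (\<Sum>i<p. \<Sum>k<p. h i * A i k * h k)"
proof -
  have "h i * C i k * h k - \<delta> * (\<bar>h i\<bar> * \<bar>h k\<bar>) \<le> h i * A i k * h k" if "i < p" "k < p" for i k
  proof -
    have "\<bar>h i * (A i k - C i k) * h k\<bar> \<le> \<delta> * (\<bar>h i\<bar> * \<bar>h k\<bar>)"
      using mult_right_mono[OF assms[OF that], of "\<bar>h i\<bar> * \<bar>h k\<bar>"] by (simp add: abs_mult mult_ac)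
    then show ?thesis by (simp add: algebra_simps abs_le_iff)
  qed
  then have "(\<Sum>i<p. \<Sum>k<p. h i * C i k * h k - \<delta> * (\<bar>h i\<bar> * \<bar>h k\<bar>)) \<le> (\<Sum>i<p. \<Sum>k<p. h i * A i k * h k)"
    by (intro sum_mono) auto
  moreover have "\<delta> * (\<Sum>i<p. \<bar>h i\<bar>)\<^sup>2 = (\<Sum>i<p. \<Sum>k<p. \<delta> * (\<bar>h i\<bar> * \<bar>h k\<bar>))"
    unfolding power2_eq_square sum_product by (simp only: sum_distrib_left)
  ultimately show ?thesis by (simp add: sum_subtractf)
qed

lemma cis_lipschitz: "cmod (cis a - cis b) \<le> \<bar>a - b\<bar>"
proof -
  have "cis a - cis b = cis b * (cis (a - b) - 1)"
    by (simp add: right_diff_distrib cis_mult)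
  then have "cmod (cis a - cis b) = cmod (cis (a - b) - 1)" by (simp add: norm_mult)
  also have "\<dots> \<le> \<bar>a - b\<bar>"
    using iexp_approx1[of "a - b" 0] by (simp add: cis_conv_exp)
  finally show ?thesis .
qed

text \<open>The data appear only through a quadratic objective, a law of large numbers for its
  matrix, and tightness and a central limit theorem for its gradient; the regression model enters
  afterwards. The set \<open>S\<close> of active coordinates takes the place of a
  reordering.\<close>

lemma adaptive_lasso_asymptotics:
  fixes p :: nat and M :: "'a measure" and A :: "nat \<Rightarrow> 'a \<Rightarrow> nat \<Rightarrow> nat \<Rightarrow> real" and G \<theta>t \<theta>h :: "nat \<Rightarrow> 'a \<Rightarrow> nat \<Rightarrow> real"
    and obj :: "nat \<Rightarrow> 'a \<Rightarrow> (nat \<Rightarrow> real) \<Rightarrow> real" and \<theta>0 :: "nat \<Rightarrow> real"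
  defines "S \<equiv> {i. i < p \<and> \<theta>0 i \<noteq> 0}"
  assumes "prob_space M"
    and Ameas: "\<And>T i k. i < p \<Longrightarrow> k < p \<Longrightarrow> (\<lambda>\<omega>. A T \<omega> i k) \<in> borel_measurable M"
    and Gmeas: "\<And>T i. i < p \<Longrightarrow> (\<lambda>\<omega>. G T \<omega> i) \<in> borel_measurable M"
    and hmeas: "\<And>T i. (\<lambda>\<omega>. \<theta>h T \<omega> i) \<in> borel_measurable M"
    and sym: "\<And>T \<omega> i k. i < p \<Longrightarrow> k < p \<Longrightarrow> A T \<omega> i k = A T \<omega> k i"
    and quad: "\<And>T \<omega> \<theta>. \<omega> \<in> space M \<Longrightarrow> obj T \<omega> \<theta> = obj T \<omega> \<theta>0 - 2 * (\<Sum>i<p. (\<theta> i - \<theta>0 i) * G T \<omega> i)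
                 + (\<Sum>i<p. \<Sum>k<p. (\<theta> i - \<theta>0 i) * A T \<omega> i k * (\<theta> k - \<theta>0 k))"
    and C: "posdef_on {..<p} C" and B: "posdef_on {..<p} B"
    and lln: "\<And>i k e. i < p \<Longrightarrow> k < p \<Longrightarrow> e > 0 \<Longrightarrow>
        (\<lambda>T. measure M {\<omega> \<in> space M. \<bar>A T \<omega> i k / real T - C i k\<bar> > e}) \<longlonglongrightarrow> 0"
    and Gtight: "\<And>i e. i < p \<Longrightarrow> e > 0 \<Longrightarrow>
        \<exists>R>0. \<forall>T>0. measure M {\<omega> \<in> space M. \<bar>G T \<omega> i\<bar> > R * sqrt (real T)} \<le> e"
    and clt: "\<And>\<eta>. (\<lambda>T. \<integral>\<omega>. cis ((\<Sum>k\<in>S. \<eta> k * G T \<omega> k) / sqrt (real T)) \<partial>M)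
        \<longlonglongrightarrow> of_real (exp (- (\<Sum>k\<in>S. \<Sum>l\<in>S. \<eta> k * B k l * \<eta> l) / 2))"
    and \<gamma>: "\<gamma> > 0" and lam_pos: "\<And>T. lam T > 0"
    and lam1: "(\<lambda>T. lam T / sqrt (real T)) \<longlonglongrightarrow> 0"
    and lam2: "filterlim (\<lambda>T. lam T * real T powr ((\<gamma> - 1) / 2)) at_top sequentially"
    and \<theta>0: "\<theta>0 \<in> Rp p" and sub: "\<Theta> \<subseteq> Rp p" and r: "r > 0"
    and box: "\<And>\<theta>. \<theta> \<in> Rp p \<Longrightarrow> (\<And>i. i < p \<Longrightarrow> \<bar>\<theta> i - \<theta>0 i\<bar> < r) \<Longrightarrow> \<theta> \<in> \<Theta>"
    and tilde: "\<And>T \<omega> \<theta>. \<omega> \<in> space M \<Longrightarrow> \<theta> \<in> \<Theta> \<Longrightarrow> obj T \<omega> (\<theta>t T \<omega>) \<le> obj T \<omega> \<theta>"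
    and hat1: "\<And>T \<omega>. \<omega> \<in> space M \<Longrightarrow> \<theta>h T \<omega> \<in> \<Theta>"
    and hat2: "\<And>T \<omega> j. \<omega> \<in> space M \<Longrightarrow> j < p \<Longrightarrow> \<theta>t T \<omega> j = 0 \<Longrightarrow> \<theta>h T \<omega> j = 0"
    and hat3: "\<And>T \<omega> \<theta>. \<omega> \<in> space M \<Longrightarrow> \<theta> \<in> \<Theta> \<Longrightarrow> (\<And>j. j < p \<Longrightarrow> \<theta>t T \<omega> j = 0 \<Longrightarrow> \<theta> j = 0) \<Longrightarrow>
        obj T \<omega> (\<theta>h T \<omega>) + lam T * adapt_pen p \<gamma> (\<theta>t T \<omega>) (\<theta>h T \<omega>)
        \<le> obj T \<omega> \<theta> + lam T * adapt_pen p \<gamma> (\<theta>t T \<omega>) \<theta>"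
  shows "(\<lambda>T. measure M {\<omega> \<in> space M. \<forall>i<p. i \<notin> S \<longrightarrow> \<theta>h T \<omega> i = 0}) \<longlonglongrightarrow> 1" (is ?sparse)
    and "\<exists>\<mu>. gaussian_on S (sandwich S C B) \<mu> \<and>
           conv_dist_to M S (\<lambda>T \<omega>. \<lambda>i\<in>S. sqrt (real T) * (\<theta>h T \<omega> i - \<theta>0 i)) \<mu>" (is ?normal)
proof -
  interpret prob_space M by fact
  have finS: "finite S" and Sp: "S \<subseteq> {..<p}" unfolding S_def by auto
  have CS: "posdef_on S C" and BS: "posdef_on S B"
    using posdef_on_subset[OF C Sp] posdef_on_subset[OF B Sp] by auto
  obtain \<kappa> where \<kappa>: "\<kappa> > 0" "\<And>v. \<kappa> * (\<Sum>i<p. \<bar>v i\<bar>)\<^sup>2 \<le> (\<Sum>i<p. \<Sum>j<p. v i * C i j * v j)"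
    using posdef_on_lower_bound[OF C] by auto
  obtain m where m: "m > 0" "\<And>j. j < p \<Longrightarrow> \<theta>0 j \<noteq> 0 \<Longrightarrow> m \<le> \<bar>\<theta>0 j\<bar>"
  proof
    \<comment> \<open>The inserted 1 is a default for the case that no coordinate is active.\<close>
    show "0 < Min (insert 1 ((\<lambda>j. \<bar>\<theta>0 j\<bar>) ` S))" using finS by (auto simp: S_def)
    show "Min (insert 1 ((\<lambda>j. \<bar>\<theta>0 j\<bar>) ` S)) \<le> \<bar>\<theta>0 j\<bar>" if "j < p" "\<theta>0 j \<noteq> 0" for j
      using finS that by (intro Min_le) (auto simp: S_def)
  qed
  define a where "a = (\<Sum>i<p. \<Sum>k<p. \<bar>C i k\<bar>) + \<kappa> / 2"
  have a0: "a \<ge> 0" unfolding a_def using \<kappa>(1) by (intro add_nonneg_nonneg sum_nonneg) auto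
  have Ca: "\<bar>C i k\<bar> + \<kappa> / 2 \<le> a" if "i < p" "k < p" for i k
  proof -
    have "\<bar>C i k\<bar> \<le> (\<Sum>k<p. \<bar>C i k\<bar>)" using that by (intro member_le_sum) auto
    also have "\<dots> \<le> (\<Sum>i<p. \<Sum>k<p. \<bar>C i k\<bar>)"
      using that by (intro member_le_sum[of i "{..<p}" "\<lambda>i. \<Sum>k<p. \<bar>C i k\<bar>"] sum_nonneg) auto
    finally show ?thesis by (simp add: a_def)
  qed
  define w where "w = (m / 2) powr (- \<gamma>)"
  have w0: "w > 0" using m by (simp add: w_def)
  \<comment> \<open>The rate constant of the deterministic bound, with the halved coercivity
    \<open>\<kappa> / 2\<close>.\<close>
  define R' where "R' R = (2 * R + 1) / (\<kappa> / 2)" for R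
  have R'0: "R' R > 0" if "R > 0" for R using that \<kappa>(1) by (simp add: R'_def)
  define E where "E T \<delta> R = {\<omega> \<in> space M. (\<forall>i<p. \<forall>k<p. \<bar>A T \<omega> i k / real T - C i k\<bar> \<le> \<delta>) \<and>
     (\<forall>i<p. \<bar>G T \<omega> i\<bar> \<le> R * sqrt (real T))}" for T \<delta> R
  have E[measurable]: "E T \<delta> R \<in> events" for T \<delta> R
  proof -
    have "E T \<delta> R = {\<omega> \<in> space M. (\<forall>i\<in>{..<p}. \<forall>k\<in>{..<p}. \<bar>A T \<omega> i k / real T - C i k\<bar> \<le> \<delta>) \<and>
       (\<forall>i\<in>{..<p}. \<bar>G T \<omega> i\<bar> \<le> R * sqrt (real T))}" unfolding E_def by auto
    also have "\<dots> \<in> events"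
      using Ameas Gmeas
      by (intro sets.sets_Collect_conj sets.sets_Collect_finite_All' sets.sets_Collect_finite_All) auto
    finally show ?thesis .
  qed
  \<comment> \<open>\<open>R\<close> depends on the tightness of the gradient alone and is fixed
    before \<open>\<delta>\<close>; the error term \<open>\<delta> * R' R\<close> can therefore be
    made small later without moving \<open>R\<close>.\<close>
  have E_prob: "\<exists>R>0. \<forall>\<delta>>0. \<forall>\<^sub>F T in sequentially. prob (space M - E T \<delta> R) < \<epsilon>" if \<epsilon>: "\<epsilon> > 0" for \<epsilon>
  proof -
    \<comment> \<open>The \<open>p\<close> gradient events together receive at most
      \<open>\<epsilon> / 2\<close>, the other half going to the matrix entries;
      \<open>p + 1\<close> keeps the denominator positive.\<close>
    define e where "e = \<epsilon> / (2 * (real p + 1))"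
    have e: "e > 0" using \<epsilon> by (simp add: e_def)
    have "\<forall>i\<in>{..<p}. \<exists>R>0. \<forall>T>0. measure M {\<omega> \<in> space M. \<bar>G T \<omega> i\<bar> > R * sqrt (real T)} \<le> e"
      using Gtight e by auto
    then obtain Rf where Rf: "\<And>i. i < p \<Longrightarrow> Rf i > 0"
       "\<And>i T. i < p \<Longrightarrow> T > 0 \<Longrightarrow> prob {\<omega> \<in> space M. \<bar>G T \<omega> i\<bar> > Rf i * sqrt (real T)} \<le> e"
      by (metis lessThan_iff)
    define R where "R = 1 + (\<Sum>i<p. Rf i)"
    have RfR: "Rf i \<le> R" if "i < p" for i
      using member_le_sum[of i "{..<p}" Rf] Rf(1) that by (simp add: R_def less_imp_le)
    have R: "R > 0" unfolding R_def using Rf(1) by (intro add_pos_nonneg sum_nonneg) (auto intro: less_imp_le)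
    have "\<forall>\<^sub>F T in sequentially. prob (space M - E T \<delta> R) < \<epsilon>" if \<delta>: "\<delta> > 0" for \<delta>
    proof -
      let ?a = "\<lambda>T i k. {\<omega> \<in> space M. \<bar>A T \<omega> i k / real T - C i k\<bar> > \<delta>}"
      let ?g = "\<lambda>T i. {\<omega> \<in> space M. \<bar>G T \<omega> i\<bar> > Rf i * sqrt (real T)}"
      have "(\<lambda>T. \<Sum>i<p. \<Sum>k<p. prob (?a T i k)) \<longlonglongrightarrow> (\<Sum>i<p. \<Sum>k<p. 0)"
        by (intro tendsto_sum lln) (use \<delta> in auto)
      then have "\<forall>\<^sub>F T in sequentially. (\<Sum>i<p. \<Sum>k<p. prob (?a T i k)) < \<epsilon> / 2"
        using \<epsilon> by (intro order_tendstoD(2)) auto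
      then show ?thesis using eventually_gt_at_top[of 0]
      proof eventually_elim
        case (elim T)
        have [measurable]: "?a T i k \<in> events" "?g T i \<in> events" if "i < p" "k < p" for i k
          using Ameas[OF that] Gmeas[OF that(1)] by auto
        have "space M - E T \<delta> R \<subseteq> (\<Union>i<p. \<Union>k<p. ?a T i k) \<union> (\<Union>i<p. ?g T i)"
        proof
          fix \<omega> assume \<omega>: "\<omega> \<in> space M - E T \<delta> R"
          show "\<omega> \<in> (\<Union>i<p. \<Union>k<p. ?a T i k) \<union> (\<Union>i<p. ?g T i)"
          proof (cases "\<exists>i<p. \<exists>k<p. \<not> \<bar>A T \<omega> i k / real T - C i k\<bar> \<le> \<delta>")
            case True
            then show ?thesis using \<omega> by (auto simp: not_le)
          next
            case False
            then obtain i where i: "i < p" "\<not> \<bar>G T \<omega> i\<bar> \<le> R * sqrt (real T)" using \<omega> by (auto simp: E_def)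
            have "Rf i * sqrt (real T) \<le> R * sqrt (real T)" using RfR[OF i(1)] by (intro mult_right_mono) auto
            then show ?thesis using i \<omega> by force
          qed
        qed
        then have "prob (space M - E T \<delta> R) \<le> prob ((\<Union>i<p. \<Union>k<p. ?a T i k) \<union> (\<Union>i<p. ?g T i))"
          by (intro finite_measure_mono) auto
        also have "\<dots> \<le> prob (\<Union>i<p. \<Union>k<p. ?a T i k) + prob (\<Union>i<p. ?g T i)"
          by (intro measure_Un_le) auto
        also have "\<dots> \<le> (\<Sum>i<p. prob (\<Union>k<p. ?a T i k)) + (\<Sum>i<p. prob (?g T i))"
          by (intro add_mono measure_UNION_le) auto
        also have "\<dots> \<le> (\<Sum>i<p. \<Sum>k<p. prob (?a T i k)) + (\<Sum>i<p. e)"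
          using Rf(2) elim(2) by (intro add_mono sum_mono measure_UNION_le) auto
        also have "(\<Sum>i<p. e) \<le> \<epsilon> / 2" using \<epsilon> by (simp add: e_def field_simps)
        finally show ?case using elim(1) by linarith
      qed
    qed
    then show ?thesis using R by blast
  qed
  have sqrt_lim: "(\<lambda>T. c / sqrt (real T)) \<longlonglongrightarrow> 0" for c :: real
    by (intro tendsto_divide_0[OF tendsto_const] filterlim_at_top_imp_at_infinity
        filterlim_compose[OF sqrt_at_top] filterlim_real_sequentially)
  \<comment> \<open>The four limits below supply \<open>c1\<close> to \<open>c4\<close> for all
    large \<open>T\<close>. The first and third hold because \<open>1 / sqrt T\<close> vanishes, the
    others by the two growth conditions on \<open>lam\<close>.\<close>
  have good: "\<forall>\<^sub>F T in sequentially. \<forall>\<omega>\<in>E T (\<kappa>/2) R. (\<forall>j<p. \<theta>0 j = 0 \<longrightarrow> \<theta>h T \<omega> j = 0) \<and>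
      (\<Sum>i<p. \<bar>\<theta>h T \<omega> i - \<theta>0 i\<bar>) \<le> R' R / sqrt (real T) \<and>
      (\<forall>j<p. \<theta>0 j \<noteq> 0 \<longrightarrow> \<bar>(\<Sum>i<p. A T \<omega> j i * (\<theta>h T \<omega> i - \<theta>0 i)) - G T \<omega> j\<bar> \<le> lam T * w / 2)"
    if R: "R > 0" for R
  proof -
    have "\<forall>\<^sub>F T in sequentially. 2 * R / (\<kappa> / 2) / sqrt (real T) < m / 2"
      using m(1) by (intro order_tendstoD(2)[OF sqrt_lim]) auto
    moreover have "\<forall>\<^sub>F T in sequentially. lam T / sqrt (real T) < 1 / w"
      using w0 by (intro order_tendstoD(2)[OF lam1]) auto
    moreover have "\<forall>\<^sub>F T in sequentially. R' R / sqrt (real T) < r"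
      using r by (intro order_tendstoD(2)[OF sqrt_lim]) auto
    moreover have "\<forall>\<^sub>F T in sequentially. (2 * R / (\<kappa> / 2)) powr \<gamma> * (2 * R + 3 * a * R' R) < lam T * real T powr ((\<gamma> - 1) / 2)"
      using lam2 unfolding filterlim_at_top_dense by blast
    ultimately show ?thesis using eventually_gt_at_top[of 0]
    proof eventually_elim
      case (elim T)
      have T: "real T > 0" "sqrt (real T) > 0" using elim(5) by auto
      have R'T: "R' R / sqrt (real T) = (2 * R + 1) / ((\<kappa> / 2) * sqrt (real T))" by (simp add: R'_def)
      show ?case
      proof
        fix \<omega> assume \<omega>: "\<omega> \<in> E T (\<kappa>/2) R"
        then have sp: "\<omega> \<in> space M" by (simp add: E_def)
        have AC: "\<bar>A T \<omega> i k / real T - C i k\<bar> \<le> \<kappa>/2" if "i < p" "k < p" for i k using \<omega> that by (simp add: E_def)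
        show "(\<forall>j<p. \<theta>0 j = 0 \<longrightarrow> \<theta>h T \<omega> j = 0) \<and>
          (\<Sum>i<p. \<bar>\<theta>h T \<omega> i - \<theta>0 i\<bar>) \<le> R' R / sqrt (real T) \<and>
          (\<forall>j<p. \<theta>0 j \<noteq> 0 \<longrightarrow> \<bar>(\<Sum>i<p. A T \<omega> j i * (\<theta>h T \<omega> i - \<theta>0 i)) - G T \<omega> j\<bar> \<le> lam T * w / 2)"
          unfolding R'T w_def
        proof (rule adaptive_lasso_deterministic[where A="A T \<omega>" and G="G T \<omega>" and obj="obj T \<omega>" and \<theta>t="\<theta>t T \<omega>"
              and \<Theta>=\<Theta> and r=r and a=a and R=R and m=m and lam="lam T" and \<tau>="real T" and \<kappa>="\<kappa>/2" and ?c0.0="obj T \<omega> \<theta>0"])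
          show "\<kappa> / 2 * real T * (\<Sum>i<p. \<bar>h i\<bar>)\<^sup>2 \<le> (\<Sum>i<p. \<Sum>k<p. h i * A T \<omega> i k * h k)" for h
          proof -
            have "(\<Sum>i<p. \<Sum>k<p. h i * C i k * h k) - \<kappa>/2 * (\<Sum>i<p. \<bar>h i\<bar>)\<^sup>2
              \<le> (\<Sum>i<p. \<Sum>k<p. h i * (A T \<omega> i k / real T) * h k)"
              by (rule quad_form_perturb) (rule AC)
            also have "\<dots> = (\<Sum>i<p. \<Sum>k<p. h i * A T \<omega> i k * h k) / real T"
              by (simp add: sum_divide_distrib)
            finally have "\<kappa>/2 * (\<Sum>i<p. \<bar>h i\<bar>)\<^sup>2 \<le> (\<Sum>i<p. \<Sum>k<p. h i * A T \<omega> i k * h k) / real T"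
              using \<kappa>(2)[of h] by linarith
            then show ?thesis using T by (simp add: pos_le_divide_eq mult_ac)
          qed
          show "\<bar>A T \<omega> i k\<bar> \<le> a * real T" if "i < p" "k < p" for i k
          proof -
            have "\<bar>A T \<omega> i k / real T\<bar> \<le> a" using AC[OF that] Ca[OF that] by linarith
            then show ?thesis using T by (simp add: abs_divide pos_divide_le_eq)
          qed
          show "\<bar>G T \<omega> i\<bar> \<le> R * sqrt (real T)" if "i < p" for i using \<omega> that by (simp add: E_def)
          show "2 * R / (\<kappa> / 2 * sqrt (real T)) \<le> m / 2" using elim(1) by simp
          show "lam T * (m / 2) powr - \<gamma> \<le> sqrt (real T)"
            using elim(2) T w0 unfolding w_def[symmetric] by (simp add: field_simps)
          show "(2 * R + 1) / (\<kappa> / 2 * sqrt (real T)) < r" using elim(3) R'T by simp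
          show "(2 * R / (\<kappa> / 2)) powr \<gamma> * (2 * R + 3 * a * ((2 * R + 1) / (\<kappa> / 2))) < lam T * real T powr ((\<gamma> - 1) / 2)"
            using elim(4) by (simp add: R'_def)
          show "A T \<omega> i k = A T \<omega> k i" if "i < p" "k < p" for i k by (rule sym[OF that])
          show "obj T \<omega> \<theta> = obj T \<omega> \<theta>0 - 2 * (\<Sum>i<p. (\<theta> i - \<theta>0 i) * G T \<omega> i)
                 + (\<Sum>i<p. \<Sum>k<p. (\<theta> i - \<theta>0 i) * A T \<omega> i k * (\<theta> k - \<theta>0 k))" for \<theta> by (rule quad[OF sp])
          show "0 < \<kappa> / 2" using \<kappa>(1) by simp
          show "\<theta> \<in> \<Theta>" if "\<theta> \<in> Rp p" "\<And>i. i < p \<Longrightarrow> \<bar>\<theta> i - \<theta>0 i\<bar> < r" for \<theta> by (rule box[OF that])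
          show "m \<le> \<bar>\<theta>0 j\<bar>" if "j < p" "\<theta>0 j \<noteq> 0" for j by (rule m(2)[OF that])
          show "obj T \<omega> (\<theta>t T \<omega>) \<le> obj T \<omega> \<theta>" if "\<theta> \<in> \<Theta>" for \<theta> by (rule tilde[OF sp that])
          show "\<theta>h T \<omega> \<in> \<Theta>" by (rule hat1[OF sp])
          show "\<theta>h T \<omega> j = 0" if "j < p" "\<theta>t T \<omega> j = 0" for j by (rule hat2[OF sp that])
          show "obj T \<omega> (\<theta>h T \<omega>) + lam T * adapt_pen p \<gamma> (\<theta>t T \<omega>) (\<theta>h T \<omega>)
            \<le> obj T \<omega> \<theta> + lam T * adapt_pen p \<gamma> (\<theta>t T \<omega>) \<theta>"
            if "\<theta> \<in> \<Theta>" "\<And>j. j < p \<Longrightarrow> \<theta>t T \<omega> j = 0 \<Longrightarrow> \<theta> j = 0" for \<theta> by (rule hat3[OF sp that])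
        qed (fact T(1) a0 R m(1) lam_pos \<gamma> r \<theta>0 sub)+
      qed
    qed
  qed
  show ?sparse
  proof (rule tendstoI)
    fix \<epsilon> :: real assume \<epsilon>: "\<epsilon> > 0"
    obtain R where R: "R > 0" "\<And>\<delta>. \<delta> > 0 \<Longrightarrow> \<forall>\<^sub>F T in sequentially. prob (space M - E T \<delta> R) < \<epsilon>"
      using E_prob[OF \<epsilon>] by blast
    have "\<kappa> / 2 > 0" using \<kappa>(1) by simp
    from good[OF R(1)] R(2)[OF this]
    show "\<forall>\<^sub>F T in sequentially. dist (prob {\<omega> \<in> space M. \<forall>i<p. i \<notin> S \<longrightarrow> \<theta>h T \<omega> i = 0}) 1 < \<epsilon>"
    proof eventually_elim
      case (elim T)
      let ?Z = "{\<omega> \<in> space M. \<forall>i<p. i \<notin> S \<longrightarrow> \<theta>h T \<omega> i = 0}"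
      have "?Z = {\<omega> \<in> space M. \<forall>i\<in>{..<p} - S. \<theta>h T \<omega> i = 0}" by auto
      also have "\<dots> \<in> events" using hmeas by measurable
      finally have Z: "?Z \<in> events" .
      have "E T (\<kappa>/2) R \<subseteq> ?Z" using elim(1) by (auto simp: S_def E_def)
      then have "prob (E T (\<kappa>/2) R) \<le> prob ?Z" using Z by (rule finite_measure_mono)
      moreover have "prob (space M - E T (\<kappa>/2) R) = 1 - prob (E T (\<kappa>/2) R)" by (rule prob_compl[OF E])
      ultimately show ?case using elim(2) prob_le_1[of ?Z] by (simp add: dist_real_def)
    qed
  qed
  let ?I = "inv_on S C"
  let ?W = "\<lambda>T \<omega>. \<lambda>i\<in>S. sqrt (real T) * (\<theta>h T \<omega> i - \<theta>0 i)"
  have Wmeas: "(\<lambda>\<omega>. ?W T \<omega> i) \<in> borel_measurable M" if "i \<in> S" for T i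
    using hmeas that by simp
  have left_inv: "(\<Sum>k\<in>S. ?I i k * C k l) = (if i = l then 1 else 0)" if "i \<in> S" "l \<in> S" for i l
  proof -
    have "(\<Sum>k\<in>S. ?I i k * C k l) = (\<Sum>k\<in>S. C l k * ?I k i)"
      using that inv_on_sym[OF finS CS] posdef_on_symD[OF CS] by (intro sum.cong) (auto simp: mult.commute)
    then show ?thesis using inv_on_right_inverse[OF finS CS that(2,1)] by auto
  qed
  obtain L where L: "\<And>i j. i \<in> S \<Longrightarrow> j \<in> S \<Longrightarrow> B i j = (\<Sum>k\<in>S. L i k * L j k)"
    using posdef_on_cholesky[OF finS BS] by blast
  \<comment> \<open>Since the inverse is symmetric, a factor \<open>L\<close> of \<open>B\<close>
    yields the factor \<open>?I L\<close> of the sandwich matrix, so the Gaussian law exists without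
    a separate proof of definiteness.\<close>
  have sw: "sandwich S C B i j = (\<Sum>n\<in>S. (\<Sum>k\<in>S. ?I i k * L k n) * (\<Sum>l\<in>S. ?I j l * L l n))"
    if "i \<in> S" "j \<in> S" for i j
  proof -
    have "sandwich S C B i j = (\<Sum>k\<in>S. \<Sum>l\<in>S. \<Sum>n\<in>S. (?I i k * L k n) * (?I j l * L l n))"
      unfolding sandwich_def using L inv_on_sym[OF finS CS _ that(2)]
      by (intro sum.cong refl) (simp add: sum_distrib_left sum_distrib_right mult_ac)
    also have "\<dots> = (\<Sum>k\<in>S. \<Sum>n\<in>S. \<Sum>l\<in>S. (?I i k * L k n) * (?I j l * L l n))"
      by (intro sum.cong refl sum.swap)
    also have "\<dots> = (\<Sum>n\<in>S. \<Sum>k\<in>S. \<Sum>l\<in>S. (?I i k * L k n) * (?I j l * L l n))"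
      by (rule sum.swap)
    finally show ?thesis by (simp add: sum_product)
  qed
  have "\<exists>\<mu>. gaussian_on S (sandwich S C B) \<mu>"
    by (rule gaussian_on_exists[OF finS, where L="\<lambda>i n. \<Sum>k\<in>S. ?I i k * L k n"]) (rule sw)
  then obtain \<mu> where \<mu>: "gaussian_on S (sandwich S C B) \<mu>" by blast
  have "conv_dist_to M S ?W \<mu>"
  proof (rule conv_dist_to_if_char_tendsto[OF assms(2) finS _ Wmeas])
    show "prob_space \<mu>" "sets \<mu> = sets (Pi\<^sub>M S (\<lambda>_. borel))" using \<mu> by (auto simp: gaussian_on_def)
    show "\<exists>Q. \<forall>\<^sub>F T in sequentially. prob {\<omega> \<in> space M. \<exists>i\<in>S. \<bar>?W T \<omega> i\<bar> > Q} < \<epsilon>" if \<epsilon>: "\<epsilon> > 0" for \<epsilon>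
    proof -
      obtain R where R: "R > 0" "\<And>\<delta>. \<delta> > 0 \<Longrightarrow> \<forall>\<^sub>F T in sequentially. prob (space M - E T \<delta> R) < \<epsilon>"
        using E_prob[OF \<epsilon>] by blast
      have "\<kappa> / 2 > 0" using \<kappa>(1) by simp
      from good[OF R(1)] R(2)[OF this] eventually_gt_at_top[of 0]
      have "\<forall>\<^sub>F T in sequentially. prob {\<omega> \<in> space M. \<exists>i\<in>S. \<bar>?W T \<omega> i\<bar> > R' R} < \<epsilon>"
      proof eventually_elim
        case (elim T)
        have T: "sqrt (real T) > 0" using elim(3) by simp
        have "\<bar>?W T \<omega> i\<bar> \<le> R' R" if "\<omega> \<in> E T (\<kappa>/2) R" "i \<in> S" for \<omega> i
        proof -
          have "\<bar>\<theta>h T \<omega> i - \<theta>0 i\<bar> \<le> (\<Sum>i<p. \<bar>\<theta>h T \<omega> i - \<theta>0 i\<bar>)"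
            using that Sp by (intro member_le_sum[of i "{..<p}" "\<lambda>i. \<bar>\<theta>h T \<omega> i - \<theta>0 i\<bar>"]) auto
          also have "\<dots> \<le> R' R / sqrt (real T)" using elim(1) that by blast
          finally show ?thesis using T that by (simp add: abs_mult pos_le_divide_eq mult.commute)
        qed
        then have "{\<omega> \<in> space M. \<exists>i\<in>S. \<bar>?W T \<omega> i\<bar> > R' R} \<subseteq> space M - E T (\<kappa>/2) R" by force
        then have "prob {\<omega> \<in> space M. \<exists>i\<in>S. \<bar>?W T \<omega> i\<bar> > R' R} \<le> prob (space M - E T (\<kappa>/2) R)"
          by (intro finite_measure_mono) auto
        then show ?case using elim(2) by simp
      qed
      then show ?thesis by blast
    qed
    fix \<xi> :: "nat \<Rightarrow> real"
    \<comment> \<open>The limit variable is the inverse of \<open>C\<close> applied to the gradient;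
      moving the symmetric inverse to the other side turns direction \<open>\<xi>\<close> into
      direction \<open>\<eta>\<close> for the gradient, to which \<open>clt\<close> applies.\<close>
    define \<eta> where "\<eta> k = (\<Sum>i\<in>S. \<xi> i * ?I i k)" for k
    have var: "(\<Sum>k\<in>S. \<Sum>l\<in>S. \<eta> k * B k l * \<eta> l) = (\<Sum>i\<in>S. \<Sum>j\<in>S. \<xi> i * sandwich S C B i j * \<xi> j)"
    proof -
      have "(\<Sum>i\<in>S. \<Sum>j\<in>S. \<xi> i * sandwich S C B i j * \<xi> j)
        = (\<Sum>i\<in>S. \<Sum>j\<in>S. \<Sum>k\<in>S. \<Sum>l\<in>S. \<xi> i * ?I i k * B k l * (\<xi> j * ?I j l))"
        unfolding sandwich_def using inv_on_sym[OF finS CS]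
        by (intro sum.cong refl) (simp add: sum_distrib_left sum_distrib_right mult_ac)
      also have "\<dots> = (\<Sum>i\<in>S. \<Sum>k\<in>S. \<Sum>j\<in>S. \<Sum>l\<in>S. \<xi> i * ?I i k * B k l * (\<xi> j * ?I j l))"
        by (intro sum.cong refl sum.swap)
      also have "\<dots> = (\<Sum>i\<in>S. \<Sum>k\<in>S. \<Sum>l\<in>S. \<Sum>j\<in>S. \<xi> i * ?I i k * B k l * (\<xi> j * ?I j l))"
        by (intro sum.cong refl sum.swap)
      also have "\<dots> = (\<Sum>k\<in>S. \<Sum>i\<in>S. \<Sum>l\<in>S. \<Sum>j\<in>S. \<xi> i * ?I i k * B k l * (\<xi> j * ?I j l))"
        by (rule sum.swap)
      also have "\<dots> = (\<Sum>k\<in>S. \<Sum>l\<in>S. \<Sum>i\<in>S. \<Sum>j\<in>S. \<xi> i * ?I i k * B k l * (\<xi> j * ?I j l))"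
        by (intro sum.cong refl sum.swap)
      also have "\<dots> = (\<Sum>k\<in>S. \<Sum>l\<in>S. \<eta> k * B k l * \<eta> l)"
        unfolding \<eta>_def by (intro sum.cong refl) (simp add: sum_distrib_left sum_distrib_right mult_ac)
      finally show ?thesis by simp
    qed
    let ?H = "\<lambda>T \<omega>. (\<Sum>k\<in>S. \<eta> k * G T \<omega> k) / sqrt (real T)"
    let ?X = "\<lambda>T \<omega>. \<Sum>i\<in>S. \<xi> i * ?W T \<omega> i"
    define s where "s = (\<Sum>k\<in>S. \<bar>\<eta> k\<bar>)"
    have s0: "s \<ge> 0" by (simp add: s_def sum_nonneg)
    \<comment> \<open>Inserting the inverse times \<open>C\<close> writes \<open>?X\<close> with
      weights \<open>\<eta>\<close> on the rows of \<open>C\<close> applied to the scaled error. By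
      sparsity sums over \<open>S\<close> and over all \<open>p\<close> indices agree, so
      \<open>C\<close> may be exchanged for \<open>A/T\<close> at cost
      \<open>\<delta> * R' R\<close>; the first order condition costs the rest.\<close>
    have close: "\<bar>?X T \<omega> - ?H T \<omega>\<bar> \<le> s * (\<delta> * R' R + lam T * w / 2 / sqrt (real T))"
      if T: "T > 0" and \<omega>: "\<omega> \<in> E T \<delta> R" and \<delta>: "\<delta> \<ge> 0"
        and g: "\<forall>j<p. \<theta>0 j = 0 \<longrightarrow> \<theta>h T \<omega> j = 0" "(\<Sum>i<p. \<bar>\<theta>h T \<omega> i - \<theta>0 i\<bar>) \<le> R' R / sqrt (real T)"
          "\<forall>j<p. \<theta>0 j \<noteq> 0 \<longrightarrow> \<bar>(\<Sum>i<p. A T \<omega> j i * (\<theta>h T \<omega> i - \<theta>0 i)) - G T \<omega> j\<bar> \<le> lam T * w / 2"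
      for T \<omega> \<delta> R
    proof -
      define t where "t = sqrt (real T)"
      have t: "t > 0" "real T = t * t" using T by (auto simp: t_def)
      define h where "h i = \<theta>h T \<omega> i - \<theta>0 i" for i
      have hz: "h i = 0" if "i < p" "i \<notin> S" for i using g(1) that by (auto simp: h_def S_def)
      have X: "?X T \<omega> = (\<Sum>k\<in>S. \<eta> k * (\<Sum>l\<in>S. C k l * (t * h l)))"
      proof -
        have "(\<Sum>k\<in>S. \<eta> k * (\<Sum>l\<in>S. C k l * (t * h l))) = (\<Sum>k\<in>S. \<Sum>i\<in>S. \<Sum>l\<in>S. \<xi> i * (t * h l) * (?I i k * C k l))"
          unfolding \<eta>_def by (intro sum.cong refl) (simp add: sum_distrib_left sum_distrib_right mult_ac)
        also have "\<dots> = (\<Sum>i\<in>S. \<Sum>k\<in>S. \<Sum>l\<in>S. \<xi> i * (t * h l) * (?I i k * C k l))"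
          by (rule sum.swap)
        also have "\<dots> = (\<Sum>i\<in>S. \<Sum>l\<in>S. \<Sum>k\<in>S. \<xi> i * (t * h l) * (?I i k * C k l))"
          by (intro sum.cong refl sum.swap)
        also have "\<dots> = (\<Sum>i\<in>S. \<Sum>l\<in>S. \<xi> i * (t * h l) * (if i = l then 1 else 0))"
          using left_inv by (intro sum.cong refl) (simp flip: sum_distrib_left)
        also have "\<dots> = (\<Sum>i\<in>S. \<xi> i * (t * h i))"
          using finS by (intro sum.cong refl) (simp add: if_distrib cong: if_cong)
        also have "\<dots> = ?X T \<omega>" by (intro sum.cong refl) (simp add: h_def t_def)
        finally show ?thesis by simp
      qed
      have row: "\<bar>(\<Sum>l\<in>S. C k l * (t * h l)) - G T \<omega> k / t\<bar> \<le> \<delta> * R' R + lam T * w / 2 / t" if k: "k \<in> S" for k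
      proof -
        have kp: "k < p" "\<theta>0 k \<noteq> 0" using k by (auto simp: S_def)
        have ext: "(\<Sum>l\<in>S. f l * h l) = (\<Sum>l<p. f l * h l)" for f
          using Sp hz by (intro sum.mono_neutral_left) auto
        have "(\<Sum>l\<in>S. C k l * (t * h l)) = (\<Sum>l<p. C k l * t * h l)"
          using ext[of "\<lambda>l. C k l * t"] by (simp add: mult.assoc)
        moreover have "(\<Sum>l<p. A T \<omega> k l * h l) / t = (\<Sum>l<p. A T \<omega> k l / real T * t * h l)"
          using t by (simp add: sum_divide_distrib)
        ultimately have "(\<Sum>l\<in>S. C k l * (t * h l)) - G T \<omega> k / t
          = (\<Sum>l<p. (C k l - A T \<omega> k l / real T) * t * h l) + ((\<Sum>l<p. A T \<omega> k l * h l) - G T \<omega> k) / t"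
          by (simp add: diff_divide_distrib left_diff_distrib sum_subtractf)
        also have "\<bar>\<dots>\<bar> \<le> \<delta> * R' R + lam T * w / 2 / t"
        proof (rule order_trans[OF abs_triangle_ineq add_mono])
          have "\<bar>\<Sum>l<p. (C k l - A T \<omega> k l / real T) * t * h l\<bar> \<le> (\<Sum>l<p. \<bar>(C k l - A T \<omega> k l / real T) * t * h l\<bar>)"
            by (rule sum_abs)
          also have "\<dots> \<le> (\<Sum>l<p. \<delta> * t * \<bar>h l\<bar>)"
            using \<omega> kp t(1) by (intro sum_mono) (auto simp: abs_mult E_def abs_minus_commute intro!: mult_right_mono)
          also have "\<dots> = \<delta> * (t * (\<Sum>l<p. \<bar>h l\<bar>))" by (simp add: sum_distrib_left mult.assoc)
          also have "\<dots> \<le> \<delta> * R' R"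
            using g(2) t(1) \<delta> unfolding h_def t_def[symmetric]
            by (intro mult_left_mono) (auto simp: pos_le_divide_eq mult.commute)
          finally show "\<bar>\<Sum>l<p. (C k l - A T \<omega> k l / real T) * t * h l\<bar> \<le> \<delta> * R' R" .
          have "\<bar>((\<Sum>l<p. A T \<omega> k l * h l) - G T \<omega> k)\<bar> \<le> lam T * w / 2"
            using g(3) kp by (simp add: h_def)
          then show "\<bar>((\<Sum>l<p. A T \<omega> k l * h l) - G T \<omega> k) / t\<bar> \<le> lam T * w / 2 / t"
            using t(1) by (simp add: abs_divide divide_right_mono del: divide_divide_eq_left)
        qed
        finally show ?thesis .
      qed
      have "?X T \<omega> - ?H T \<omega> = (\<Sum>k\<in>S. \<eta> k * ((\<Sum>l\<in>S. C k l * (t * h l)) - G T \<omega> k / t))"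
        unfolding X unfolding t_def[symmetric] by (simp add: right_diff_distrib sum_subtractf sum_divide_distrib)
      also have "\<bar>\<dots>\<bar> \<le> (\<Sum>k\<in>S. \<bar>\<eta> k * ((\<Sum>l\<in>S. C k l * (t * h l)) - G T \<omega> k / t)\<bar>)" by (rule sum_abs)
      also have "\<dots> \<le> (\<Sum>k\<in>S. \<bar>\<eta> k\<bar> * (\<delta> * R' R + lam T * w / 2 / t))"
        using row by (intro sum_mono) (auto simp: abs_mult intro!: mult_left_mono)
      finally show ?thesis by (simp add: s_def t_def sum_distrib_right)
    qed
    have cm[measurable]: "(\<lambda>\<omega>. cis (?X T \<omega>)) \<in> borel_measurable M" "(\<lambda>\<omega>. cis (?H T \<omega>)) \<in> borel_measurable M" for T
    proof -
      have [measurable]: "?X T \<in> borel_measurable M" using Wmeas by (intro borel_measurable_sum borel_measurable_times) auto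
      have [measurable]: "(\<lambda>\<omega>. ?H T \<omega>) \<in> borel_measurable M"
        using Gmeas Sp by (intro borel_measurable_divide borel_measurable_sum borel_measurable_times) auto
      show "(\<lambda>\<omega>. cis (?X T \<omega>)) \<in> borel_measurable M" "(\<lambda>\<omega>. cis (?H T \<omega>)) \<in> borel_measurable M"
        unfolding cis_conv_exp by measurable
    qed
    have int: "integrable M (\<lambda>\<omega>. cis (?X T \<omega>))" "integrable M (\<lambda>\<omega>. cis (?H T \<omega>))" for T
      by (rule integrable_const_bound[where B=1, OF _ cm(1)], simp) (rule integrable_const_bound[where B=1, OF _ cm(2)], simp)
    have diff: "(\<lambda>T. expectation (\<lambda>\<omega>. cis (?X T \<omega>) - cis (?H T \<omega>))) \<longlonglongrightarrow> 0"
    proof (rule tendstoI)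
      fix \<epsilon> :: real assume \<epsilon>: "\<epsilon> > 0"
      then have "\<epsilon> / 4 > 0" by simp
      then obtain R where R: "R > 0" "\<And>\<delta>. \<delta> > 0 \<Longrightarrow> \<forall>\<^sub>F T in sequentially. prob (space M - E T \<delta> R) < \<epsilon> / 4"
        using E_prob by blast
      \<comment> \<open>The first bound keeps the event inside the one where \<open>good\<close>
        applies; the second makes the matrix error at most \<open>\<epsilon> / 8\<close>. With
        \<open>\<epsilon> / 8\<close> from the penalty and \<open>2 * (\<epsilon> / 4)\<close> off
        the event the total stays below \<open>\<epsilon>\<close>.\<close>
      define \<delta> where "\<delta> = min (\<kappa> / 2) (\<epsilon> / (8 * (s + 1) * R' R))"
      have \<delta>: "\<delta> > 0" "\<delta> \<le> \<kappa> / 2"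
      proof -
        show "\<delta> > 0" using \<kappa>(1) \<epsilon> R'0[OF R(1)] s0 by (auto simp: \<delta>_def)
        show "\<delta> \<le> \<kappa> / 2" unfolding \<delta>_def by (rule min.cobounded1)
      qed
      have \<delta>2: "s * (\<delta> * R' R) \<le> \<epsilon> / 8"
      proof -
        have "\<delta> * R' R \<le> \<epsilon> / (8 * (s + 1) * R' R) * R' R"
          using R'0[OF R(1)] by (intro mult_right_mono) (auto simp: \<delta>_def)
        also have "\<dots> = \<epsilon> / 8 / (s + 1)" using R'0[OF R(1)] by simp
        finally have "s * (\<delta> * R' R) \<le> s * (\<epsilon> / 8 / (s + 1))" using s0 by (intro mult_left_mono) auto
        also have "\<dots> = \<epsilon> / 8 * (s / (s + 1))" by simp
        also have "\<dots> \<le> \<epsilon> / 8 * 1" using s0 \<epsilon> by (intro mult_left_mono) auto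
        finally show ?thesis by simp
      qed
      have "(\<lambda>T. s * (w / 2) * (lam T / sqrt (real T))) \<longlonglongrightarrow> s * (w / 2) * 0"
        by (intro tendsto_mult tendsto_const lam1)
      then have "\<forall>\<^sub>F T in sequentially. s * (w / 2) * (lam T / sqrt (real T)) < \<epsilon> / 8"
        using \<epsilon> by (intro order_tendstoD(2)) auto
      from good[OF R(1)] R(2)[OF \<delta>(1)] this eventually_gt_at_top[of 0]
      show "\<forall>\<^sub>F T in sequentially. dist (expectation (\<lambda>\<omega>. cis (?X T \<omega>) - cis (?H T \<omega>))) 0 < \<epsilon>"
      proof eventually_elim
        case (elim T)
        have "cmod (expectation (\<lambda>\<omega>. cis (?X T \<omega>) - cis (?H T \<omega>))) \<le> \<epsilon> / 4 + 2 * prob (space M - E T \<delta> R)"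
        proof (rule norm_expectation_le_off_event)
          show "(\<lambda>\<omega>. cis (?X T \<omega>) - cis (?H T \<omega>)) \<in> borel_measurable M"
            by (intro borel_measurable_diff cm)
          show "cmod (cis (?X T \<omega>) - cis (?H T \<omega>)) \<le> 2" for \<omega>
            using norm_triangle_ineq4[of "cis (?X T \<omega>)" "cis (?H T \<omega>)"] by simp
          fix \<omega> assume \<omega>: "\<omega> \<in> E T \<delta> R"
          then have "\<omega> \<in> E T (\<kappa> / 2) R" using \<delta>(2) unfolding E_def by force
          from bspec[OF elim(1) this]
          have "\<bar>?X T \<omega> - ?H T \<omega>\<bar> \<le> s * (\<delta> * R' R + lam T * w / 2 / sqrt (real T))"
            using close[OF elim(4) \<omega>] \<delta>(1) by simp
          also have "\<dots> = s * (\<delta> * R' R) + s * (w / 2) * (lam T / sqrt (real T))" by (simp add: algebra_simps)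
          also have "\<dots> \<le> \<epsilon> / 4" using \<delta>2 elim(3) by linarith
          finally show "cmod (cis (?X T \<omega>) - cis (?H T \<omega>)) \<le> \<epsilon> / 4" using cis_lipschitz order_trans by blast
        qed (use \<epsilon> in auto)
        then show ?case using elim(2) \<epsilon> unfolding dist_norm diff_zero by linarith
      qed
    qed
    have "(\<lambda>T. expectation (\<lambda>\<omega>. cis (?X T \<omega>) - cis (?H T \<omega>)) + expectation (\<lambda>\<omega>. cis (?H T \<omega>)))
      \<longlonglongrightarrow> 0 + of_real (exp (- (\<Sum>k\<in>S. \<Sum>l\<in>S. \<eta> k * B k l * \<eta> l) / 2))"
      by (intro tendsto_add diff clt)
    moreover have "expectation (\<lambda>\<omega>. cis (?X T \<omega>) - cis (?H T \<omega>)) + expectation (\<lambda>\<omega>. cis (?H T \<omega>))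
      = expectation (\<lambda>\<omega>. cis (?X T \<omega>))" for T
      by (subst Bochner_Integration.integral_diff[OF int]) simp
    ultimately have "(\<lambda>T. expectation (\<lambda>\<omega>. cis (?X T \<omega>)))
      \<longlonglongrightarrow> of_real (exp (- (\<Sum>i\<in>S. \<Sum>j\<in>S. \<xi> i * sandwich S C B i j * \<xi> j) / 2))"
      unfolding var by simp
    then show "(\<lambda>T. expectation (\<lambda>\<omega>. cis (?X T \<omega>))) \<longlonglongrightarrow> (\<integral>x. cis (\<Sum>i\<in>S. \<xi> i * x i) \<partial>\<mu>)"
      using \<mu> by (simp add: gaussian_on_def)
  qed (rule restrict_extensional)
  then show ?normal using \<mu> by blast
qed

section \<open>The interval-valued regression model\<close>

lemma innerK_expand:
  "innerK K A B = K (-1) (-1) * fst A * fst B - K (-1) 1 * fst A * snd B - K 1 (-1) * snd A * fst B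
    + K 1 1 * snd A * snd B"
  by (simp add: innerK_def supp_def)

lemma innerK_sym: "kernel_pd K \<Longrightarrow> innerK K A B = innerK K B A"
  by (simp add: innerK_expand kernel_pd_def)

text \<open>The constant is determinant over trace of the two-dimensional form, which lies below its
  smaller eigenvalue. It converts moments of the norm into moments of the endpoints.\<close>

lemma normK2_lower_bound:
  assumes "kernel_pd K"
  shows "\<exists>c>0. \<forall>A. c * ((fst A)\<^sup>2 + (snd A)\<^sup>2) \<le> normK2 K A"
proof -
  define a b d where "a = K (-1) (-1)" and "b = K 1 (-1)" and "d = K 1 1"
  have b: "K (-1) 1 = b" and d: "d > 0" and det: "a * d > b\<^sup>2"
    using assms by (auto simp: kernel_pd_def a_def b_def d_def mult.commute)
  have a: "a > 0" using det d zero_le_power2[of b] by (metis less_le_trans not_less order.strict_trans2 zero_less_mult_pos2)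
  define c where "c = (a * d - b\<^sup>2) / (a + d)"
  have c: "c > 0" using det a d by (simp add: c_def)
  have cad: "c * (a + d) = a * d - b\<^sup>2" using a d by (simp add: c_def)
  have ac: "a - c > 0"
  proof -
    have "(a - c) * (a + d) = a\<^sup>2 + b\<^sup>2" using cad by (simp add: algebra_simps power2_eq_square)
    then have "(a - c) * (a + d) > 0" using a by (simp add: add_pos_nonneg)
    then show ?thesis using a d by (simp add: zero_less_mult_iff)
  qed
  have "c * (x\<^sup>2 + y\<^sup>2) \<le> a * x\<^sup>2 - 2 * b * x * y + d * y\<^sup>2" for x y :: real
  proof -
    have "(a - c) * (a * x\<^sup>2 - 2 * b * x * y + d * y\<^sup>2 - c * (x\<^sup>2 + y\<^sup>2))
      = ((a - c) * x - b * y)\<^sup>2 + (a * d - b\<^sup>2 - c * (a + d) + c\<^sup>2) * y\<^sup>2"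
      by (simp add: power2_eq_square algebra_simps)
    also have "\<dots> = ((a - c) * x - b * y)\<^sup>2 + c\<^sup>2 * y\<^sup>2" using cad by simp
    finally have "0 \<le> (a - c) * (a * x\<^sup>2 - 2 * b * x * y + d * y\<^sup>2 - c * (x\<^sup>2 + y\<^sup>2))" by simp
    then show ?thesis using ac by (simp add: zero_le_mult_iff)
  qed
  then show ?thesis using c
    by (intro exI[of _ c]) (simp add: normK2_def innerK_expand b power2_eq_square algebra_simps flip: a_def b_def d_def)
qed

text \<open>A basic open set of the product topology allows some radius in each coordinate. Points
  of \<open>Rp p\<close> agree beyond \<open>p\<close>, so only \<open>p\<close> radii matter and
  they have a positive minimum.\<close>

lemma box_in_relative_neighbourhood:
  assumes U: "openin (top_of_set (Rp p)) U" and \<theta>: "\<theta> \<in> U"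
  shows "\<exists>r>0. \<forall>\<theta>'\<in>Rp p. (\<forall>i<p. \<bar>\<theta>' i - \<theta> i\<bar> < r) \<longrightarrow> \<theta>' \<in> U"
proof -
  obtain V where V: "open V" "U = Rp p \<inter> V" using U by (auto simp: openin_open)
  then have \<theta>R: "\<theta> \<in> Rp p" "\<theta> \<in> V" using \<theta> by auto
  have "openin (product_topology (\<lambda>_. euclidean) UNIV) V" using V(1) by (simp add: euclidean_product_topology)
  from product_topology_open_contains_basis[OF this \<theta>R(2)]
  obtain X where X: "\<theta> \<in> PiE UNIV X" "\<And>i. open (X i)" "PiE UNIV X \<subseteq> V" by auto
  have "\<forall>i. \<exists>r>0. \<forall>y. \<bar>y - \<theta> i\<bar> < r \<longrightarrow> y \<in> X i"
  proof
    fix i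
    have "\<theta> i \<in> X i" using X(1) by auto
    then show "\<exists>r>0. \<forall>y. \<bar>y - \<theta> i\<bar> < r \<longrightarrow> y \<in> X i"
      using X(2)[of i] unfolding open_dist by (auto simp: dist_real_def)
  qed
  then obtain r where r: "\<And>i. r i > 0" "\<And>i y. \<bar>y - \<theta> i\<bar> < r i \<Longrightarrow> y \<in> X i" by metis
  define r0 where "r0 = Min (insert 1 (r ` {..<p}))"
  have "r0 > 0" using r(1) by (auto simp: r0_def)
  moreover have "\<theta>' \<in> U" if "\<theta>' \<in> Rp p" "\<forall>i<p. \<bar>\<theta>' i - \<theta> i\<bar> < r0" for \<theta>'
  proof -
    have "\<theta>' i \<in> X i" for i
    proof (cases "i < p")
      case True
      then have "r0 \<le> r i" unfolding r0_def by (intro Min_le) auto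
      then show ?thesis using r(2)[of "\<theta>' i" i] that True by fastforce
    next
      case False
      then have "\<theta>' i = \<theta> i" using that \<theta>R by (auto simp: Rp_def)
      then show ?thesis using r(1)[of i] r(2)[of "\<theta> i" i] by simp
    qed
    then have "\<theta>' \<in> V" using X(3) by auto
    then show ?thesis using V that by simp
  qed
  ultimately show ?thesis by blast
qed

text \<open>Extended intervals are scaled endpoint by endpoint for either sign of the coefficient,
  so the residual is affine in \<open>\<theta>\<close> and the inner product expands bilinearly
  around \<open>\<theta>0\<close>.\<close>

lemma DKobj_quadratic:
  fixes q s J :: nat
  assumes "kernel_pd K"
  defines "p \<equiv> dimZ q s J"
  shows "DKobj K q s J Y X T \<omega> \<theta> = DKobj K q s J Y X T \<omega> \<theta>0
    - 2 * (\<Sum>i<p. (\<theta> i - \<theta>0 i) * (\<Sum>t=1..T. innerK K (Zvec q s J Y X (int t) \<omega> i) (resid q s J Y X \<theta>0 (int t) \<omega>)))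
    + (\<Sum>i<p. \<Sum>k<p. (\<theta> i - \<theta>0 i) * (\<Sum>t=1..T. innerK K (Zvec q s J Y X (int t) \<omega> i) (Zvec q s J Y X (int t) \<omega> k)) * (\<theta> k - \<theta>0 k))"
proof -
  let ?Z = "\<lambda>t. Zvec q s J Y X t \<omega>" and ?u = "\<lambda>t. resid q s J Y X \<theta>0 t \<omega>"
  define h where "h i = \<theta> i - \<theta>0 i" for i
  have one: "normK2 K (resid q s J Y X \<theta> t \<omega>) = normK2 K (?u t) - 2 * (\<Sum>i<p. h i * innerK K (?Z t i) (?u t))
    + (\<Sum>i<p. \<Sum>k<p. h i * innerK K (?Z t i) (?Z t k) * h k)" for t
  proof -
    define x y where "x = (\<Sum>i<p. h i * fst (?Z t i))" and "y = (\<Sum>i<p. h i * snd (?Z t i))"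
    have res: "resid q s J Y X \<theta> t \<omega> = (fst (?u t) - x, snd (?u t) - y)"
      by (simp add: resid_def isub_def ilin_def x_def y_def h_def p_def left_diff_distrib sum_subtractf)
    have 1: "(\<Sum>i<p. h i * innerK K (?Z t i) B) = innerK K (x, y) B" for B
    proof -
      have "h i * innerK K (?Z t i) B = (K (-1) (-1) * fst B - K (-1) 1 * snd B) * (h i * fst (?Z t i))
        + (K 1 1 * snd B - K 1 (-1) * fst B) * (h i * snd (?Z t i))" for i
        unfolding innerK_expand by (simp add: algebra_simps)
      then have "(\<Sum>i<p. h i * innerK K (?Z t i) B) = (K (-1) (-1) * fst B - K (-1) 1 * snd B) * x
        + (K 1 1 * snd B - K 1 (-1) * fst B) * y"
        by (simp only: sum.distrib x_def y_def sum_distrib_left)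
      then show ?thesis unfolding innerK_expand by (simp add: algebra_simps)
    qed
    have "(\<Sum>k<p. h i * innerK K (?Z t i) (?Z t k) * h k) = h i * innerK K (?Z t i) (x, y)" for i
    proof -
      have "(\<Sum>k<p. h i * innerK K (?Z t i) (?Z t k) * h k) = (\<Sum>k<p. h i * (h k * innerK K (?Z t k) (?Z t i)))"
      proof (rule sum.cong[OF refl])
        show "h i * innerK K (?Z t i) (?Z t k) * h k = h i * (h k * innerK K (?Z t k) (?Z t i))" for k
          using innerK_sym[OF assms(1), of "?Z t i" "?Z t k"] by simp
      qed
      also have "\<dots> = h i * innerK K (x, y) (?Z t i)" by (simp only: 1 flip: sum_distrib_left)
      finally show ?thesis using innerK_sym[OF assms(1), of "(x, y)" "?Z t i"] by simp
    qed
    then have 2: "(\<Sum>i<p. \<Sum>k<p. h i * innerK K (?Z t i) (?Z t k) * h k) = innerK K (x, y) (x, y)"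
      by (simp only: 1)
    show ?thesis unfolding res 1 2 unfolding normK2_def innerK_expand using assms(1)
      by (simp add: kernel_pd_def algebra_simps)
  qed
  have "(\<Sum>t=1..T. \<Sum>i<p. h i * innerK K (?Z (int t) i) (?u (int t)))
    = (\<Sum>i<p. h i * (\<Sum>t=1..T. innerK K (?Z (int t) i) (?u (int t))))"
    by (subst sum.swap) (simp add: sum_distrib_left)
  moreover have "(\<Sum>t=1..T. \<Sum>i<p. \<Sum>k<p. h i * innerK K (?Z (int t) i) (?Z (int t) k) * h k)
    = (\<Sum>i<p. \<Sum>k<p. h i * (\<Sum>t=1..T. innerK K (?Z (int t) i) (?Z (int t) k)) * h k)"
  proof -
    have "(\<Sum>t=1..T. \<Sum>i<p. \<Sum>k<p. h i * innerK K (?Z (int t) i) (?Z (int t) k) * h k)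
      = (\<Sum>i<p. \<Sum>t=1..T. \<Sum>k<p. h i * innerK K (?Z (int t) i) (?Z (int t) k) * h k)" by (rule sum.swap)
    also have "\<dots> = (\<Sum>i<p. \<Sum>k<p. \<Sum>t=1..T. h i * innerK K (?Z (int t) i) (?Z (int t) k) * h k)"
      by (intro sum.cong refl sum.swap)
    finally show ?thesis by (simp add: sum_distrib_left sum_distrib_right)
  qed
  ultimately show ?thesis
    unfolding DKobj_def one by (simp add: sum.distrib sum_subtractf h_def flip: sum_distrib_left)
qed

section \<open>The model as a functional of a shifted path\<close>

text \<open>The processes on path space: every quantity of the model at time \<open>t + k\<close> is the quantity at time \<open>t\<close>
  of the path shifted \<open>k\<close> times.\<close>
definition canY :: "int \<Rightarrow> (int \<times> nat \<Rightarrow> real) \<Rightarrow> interval" where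
  "canY t x = (x (t, 0), x (t, 1))"

definition canX :: "nat \<Rightarrow> int \<Rightarrow> (int \<times> nat \<Rightarrow> real) \<Rightarrow> interval" where
  "canX j t x = (x (t, 2 + 2 * j), x (t, 3 + 2 * j))"

lemma canY_path: "canY t (path Y X J \<omega>) = Y t \<omega>"
  by (simp add: canY_def path_def coord_def)

lemma canX_path: "j < J \<Longrightarrow> canX j t (path Y X J \<omega>) = X j t \<omega>"
  by (simp add: canX_def path_def coord_def)

text \<open>An index in the exogenous block exists only if \<open>J\<close> is positive, as the
  block has \<open>J * (s + 1)\<close> entries.\<close>

lemma Zvec_X_index: "i < dimZ q s J \<Longrightarrow> \<not> i < 2 + q \<Longrightarrow> (i - (2 + q)) mod J < J"
  by (cases J) (auto simp: dimZ_def)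

lemma Zvec_path:
  "i < dimZ q s J \<Longrightarrow> Zvec q s J canY canX t (path Y X J \<omega>) i = Zvec q s J Y X t \<omega> i"
  using Zvec_X_index[of i q s J] by (simp add: Zvec_def canY_path canX_path)

lemma resid_path: "resid q s J canY canX \<theta> t (path Y X J \<omega>) = resid q s J Y X \<theta> t \<omega>"
  by (simp add: resid_def ilin_def canY_path Zvec_path)

lemma canY_shift: "canY t (shift1 x) = canY (t + 1) x"
  by (simp add: canY_def shift1_def)

lemma canX_shift: "canX j t (shift1 x) = canX j (t + 1) x"
  by (simp add: canX_def shift1_def)

lemma Zvec_shift: "Zvec q s J canY canX t (shift1 x) i = Zvec q s J canY canX (t + 1) x i"
  by (simp add: Zvec_def canY_shift canX_shift algebra_simps)

lemma resid_shift: "resid q s J canY canX \<theta> t (shift1 x) = resid q s J canY canX \<theta> (t + 1) x"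
  by (simp add: resid_def ilin_def canY_shift Zvec_shift)

lemma shift_pow:
  "Zvec q s J canY canX t ((shift1 ^^ k) x) i = Zvec q s J canY canX (t + int k) x i"
  "resid q s J canY canX \<theta> t ((shift1 ^^ k) x) = resid q s J canY canX \<theta> (t + int k) x"
  by (induction k arbitrary: t) (simp_all add: Zvec_shift resid_shift algebra_simps)

lemma coordinate_measurable_PS[measurable]: "(\<lambda>x. x (t, c)) \<in> borel_measurable PS"
  unfolding PS_def by measurable

lemma shift1_measurable[measurable]: "shift1 \<in> measurable PS PS"
proof -
  have "(\<lambda>x. shift1 x (t, c)) \<in> borel_measurable PS" for t c by (simp add: shift1_def)
  then have "(\<lambda>x. \<lambda>i\<in>UNIV. shift1 x i) \<in> measurable PS (Pi\<^sub>M UNIV (\<lambda>_. borel))"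
    by (intro measurable_restrict) auto
  then show ?thesis by (simp add: PS_def restrict_UNIV)
qed

lemma canY_measurable[measurable]: "(\<lambda>x. fst (canY t x)) \<in> borel_measurable PS" "(\<lambda>x. snd (canY t x)) \<in> borel_measurable PS"
  by (simp_all add: canY_def)

lemma canX_measurable[measurable]: "(\<lambda>x. fst (canX j t x)) \<in> borel_measurable PS" "(\<lambda>x. snd (canX j t x)) \<in> borel_measurable PS"
  by (simp_all add: canX_def)

lemma Zvec_can_measurable[measurable]:
  "(\<lambda>x. fst (Zvec q s J canY canX t x i)) \<in> borel_measurable PS"
  "(\<lambda>x. snd (Zvec q s J canY canX t x i)) \<in> borel_measurable PS"
  by (cases "i = 0"; cases "i = 1"; cases "i < 2 + q"; simp add: Zvec_def)+

lemma resid_can_measurable[measurable]: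
  "(\<lambda>x. fst (resid q s J canY canX \<theta> t x)) \<in> borel_measurable PS"
  "(\<lambda>x. snd (resid q s J canY canX \<theta> t x)) \<in> borel_measurable PS"
  unfolding resid_def isub_def ilin_def by simp_all

lemma path_measurable:
  assumes "process_measurable M Y X J"
  shows "path Y X J \<in> measurable M PS"
proof -
  have "(\<lambda>\<omega>. path Y X J \<omega> (t, c)) \<in> borel_measurable M" for t c
    using assms by (cases "c < 2 + 2 * J") (auto simp: path_def process_measurable_def)
  then have "(\<lambda>\<omega>. \<lambda>i\<in>UNIV. path Y X J \<omega> i) \<in> measurable M (Pi\<^sub>M UNIV (\<lambda>_. borel))"
    by (intro measurable_restrict) auto
  then show ?thesis by (simp add: PS_def restrict_UNIV)
qed

lemma (in prob_space) AE_tendsto_imp_in_prob: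
  fixes f :: "nat \<Rightarrow> 'a \<Rightarrow> real"
  assumes [measurable]: "\<And>n. f n \<in> borel_measurable M" and lim: "AE x in M. (\<lambda>n. f n x) \<longlonglongrightarrow> c" and e: "e > 0"
  shows "(\<lambda>n. prob {x \<in> space M. \<bar>f n x - c\<bar> > e}) \<longlonglongrightarrow> 0"
proof -
  let ?E = "\<lambda>n. {x \<in> space M. \<bar>f n x - c\<bar> > e}"
  have "(\<lambda>n. expectation (indicator (?E n))) \<longlonglongrightarrow> expectation (\<lambda>x. 0 :: real)"
  proof (rule integral_dominated_convergence[where w="\<lambda>x. 1"])
    show "AE x in M. (\<lambda>n. indicator (?E n) x :: real) \<longlonglongrightarrow> 0"
      using lim
    proof eventually_elim
      case (elim x)
      have "\<forall>\<^sub>F n in sequentially. indicator (?E n) x = (0::real)"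
        using tendstoD[OF elim e] by eventually_elim (auto simp: dist_real_def indicator_def)
      then show ?case by (rule tendsto_eventually)
    qed
  qed (auto simp: indicator_def)
  then show ?thesis by simp
qed

section \<open>Stationarity and a law of large numbers for functionals of the path\<close>

locale stationary_ergodic_process = prob_space M for M :: "'a measure" +
  fixes Y :: "int \<Rightarrow> 'a \<Rightarrow> interval" and X :: "nat \<Rightarrow> int \<Rightarrow> 'a \<Rightarrow> interval" and J :: nat
  assumes meas: "process_measurable M Y X J"
    and stat: "strictly_stationary M Y X J"
    and erg: "ergodic M Y X J"
begin

lemma path_meas[measurable]: "path Y X J \<in> measurable M PS"
  by (rule path_measurable[OF meas])

lemma sets_law: "sets (law M Y X J) = sets PS"
  by (simp add: law_def)

lemma law_shift_pow: "distr (law M Y X J) PS (shift1 ^^ k) = law M Y X J"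
proof (induction k)
  case 0
  then show ?case by (simp add: id_def distr_id2 sets_law)
next
  case (Suc k)
  have pow: "shift1 ^^ k \<in> measurable PS PS" by (induction k) (auto intro: measurable_comp)
  have "distr (law M Y X J) PS (shift1 \<circ> (shift1 ^^ k)) = distr (distr (law M Y X J) PS (shift1 ^^ k)) PS shift1"
    by (rule distr_distr[symmetric]) (auto simp: measurable_cong_sets[OF sets_law refl] pow)
  also have "\<dots> = law M Y X J" using Suc stat by (simp add: strictly_stationary_def)
  finally show ?case by (simp add: comp_def)
qed

lemma shift_pow_measurable[measurable]: "shift1 ^^ k \<in> measurable PS PS"
  by (induction k) (auto intro: measurable_comp)

lemma stationary_distr:
  assumes \<Phi>: "\<Phi> \<in> borel_measurable PS"
  shows "distr M borel (\<lambda>\<omega>. \<Phi> ((shift1 ^^ k) (path Y X J \<omega>))) = distr M borel (\<lambda>\<omega>. \<Phi> (path Y X J \<omega>))"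
proof -
  have "distr M borel (\<lambda>\<omega>. \<Phi> ((shift1 ^^ k) (path Y X J \<omega>))) = distr (law M Y X J) borel (\<Phi> \<circ> (shift1 ^^ k))"
    unfolding law_def using \<Phi> by (subst distr_distr) (auto simp: comp_def)
  also have "\<dots> = distr (distr (law M Y X J) PS (shift1 ^^ k)) borel \<Phi>"
    using \<Phi> by (subst distr_distr) (auto simp: measurable_cong_sets[OF sets_law refl])
  also have "\<dots> = distr (law M Y X J) borel \<Phi>" by (simp add: law_shift_pow)
  also have "\<dots> = distr M borel (\<lambda>\<omega>. \<Phi> (path Y X J \<omega>))"
    unfolding law_def using \<Phi> by (subst distr_distr) (auto simp: comp_def)
  finally show ?thesis .
qed

text \<open>\<open>M\<close> carries no transformation, so the ergodic theorem is applied to the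
  shift on path space under the law of the process, and the almost sure limit is pulled back along
  \<open>path\<close>.\<close>

lemma process_lln:
  assumes \<Phi>[measurable]: "\<Phi> \<in> borel_measurable PS" and int: "integrable M (\<lambda>\<omega>. \<Phi> (path Y X J \<omega>))" and e: "e > 0"
  shows "(\<lambda>n. prob {\<omega> \<in> space M. \<bar>(\<Sum>k<n. \<Phi> ((shift1 ^^ k) (path Y X J \<omega>))) / real n
      - expectation (\<lambda>\<omega>. \<Phi> (path Y X J \<omega>))\<bar> > e}) \<longlonglongrightarrow> 0"
proof (rule AE_tendsto_imp_in_prob[OF _ _ e])
  let ?L = "law M Y X J"
  have "AE x in ?L. (\<lambda>n. (\<Sum>k<n. \<Phi> ((shift1 ^^ k) x)) / real n) \<longlonglongrightarrow> (\<integral>x. \<Phi> x \<partial>?L)"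
  proof (rule ergodic_theorem)
    show "prob_space ?L" unfolding law_def by (rule prob_space_distr[OF path_meas])
    show "shift1 \<in> measurable ?L ?L" using measurable_cong_sets[OF sets_law sets_law] shift1_measurable by blast
    have "distr ?L ?L shift1 = distr ?L PS shift1" by (rule distr_cong) (auto simp: sets_law)
    then show "distr ?L ?L shift1 = ?L" using stat by (simp add: strictly_stationary_def)
    show "\<forall>A\<in>sets ?L. shift1 -` A \<inter> space ?L = A \<longrightarrow> measure ?L A = 0 \<or> measure ?L A = 1"
      using erg unfolding ergodic_def sets_law by (simp add: law_def)
    show "integrable ?L \<Phi>" unfolding law_def using int by (subst integrable_distr_eq) auto
  qed
  then have "AE \<omega> in M. (\<lambda>n. (\<Sum>k<n. \<Phi> ((shift1 ^^ k) (path Y X J \<omega>))) / real n) \<longlonglongrightarrow> (\<integral>x. \<Phi> x \<partial>?L)"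
    unfolding law_def by (rule AE_distrD[OF path_meas])
  moreover have "(\<integral>x. \<Phi> x \<partial>?L) = expectation (\<lambda>\<omega>. \<Phi> (path Y X J \<omega>))"
    unfolding law_def by (rule integral_distr) auto
  ultimately show "AE \<omega> in M. (\<lambda>n. (\<Sum>k<n. \<Phi> ((shift1 ^^ k) (path Y X J \<omega>))) / real n)
      \<longlonglongrightarrow> expectation (\<lambda>\<omega>. \<Phi> (path Y X J \<omega>))" by simp
qed measurable

end

section \<open>Information sets and measurability with respect to them\<close>

lemma subset_info_generator:
  "{coord Y X c r -` B \<inter> space M | c r B. B \<in> sets borel \<and>
        ((c < 2 \<and> r \<le> t - 1) \<or> (2 \<le> c \<and> c < 2 + 2 * J \<and> r \<le> t))} \<subseteq> Pow (space M)"
  by auto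

lemma space_info: "space (info M Y X J t) = space M"
  unfolding info_def by (rule space_measure_of[OF subset_info_generator])

lemma sets_info: "sets (info M Y X J t) = sigma_sets (space M) {coord Y X c r -` B \<inter> space M | c r B.
    B \<in> sets borel \<and> ((c < 2 \<and> r \<le> t - 1) \<or> (2 \<le> c \<and> c < 2 + 2 * J \<and> r \<le> t))}"
  unfolding info_def by (rule sets_measure_of[OF subset_info_generator])

lemma coord_info_measurable:
  assumes "(c < 2 \<and> r \<le> t - 1) \<or> (2 \<le> c \<and> c < 2 + 2 * J \<and> r \<le> t)"
  shows "coord Y X c r \<in> borel_measurable (info M Y X J t)"
proof (rule measurableI)
  show "coord Y X c r -` B \<inter> space (info M Y X J t) \<in> sets (info M Y X J t)" if "B \<in> sets borel" for B
    unfolding sets_info space_info by (rule sigma_sets.Basic) (use assms that in blast)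
qed simp

lemma Y_info_measurable:
  assumes "r < t"
  shows "(\<lambda>\<omega>. fst (Y r \<omega>)) \<in> borel_measurable (info M Y X J t)" "(\<lambda>\<omega>. snd (Y r \<omega>)) \<in> borel_measurable (info M Y X J t)"
  using coord_info_measurable[of 0 r t J Y X M] coord_info_measurable[of 1 r t J Y X M] assms
  by (simp_all add: coord_def[abs_def])

lemma X_info_measurable:
  assumes "j < J" "r \<le> t"
  shows "(\<lambda>\<omega>. fst (X j r \<omega>)) \<in> borel_measurable (info M Y X J t)" "(\<lambda>\<omega>. snd (X j r \<omega>)) \<in> borel_measurable (info M Y X J t)"
  using coord_info_measurable[of "2 + 2 * j" r t J Y X M] coord_info_measurable[of "3 + 2 * j" r t J Y X M] assms
  by (simp_all add: coord_def[abs_def])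

text \<open>For \<open>1 < i < 2 + q\<close> the component is the lag \<open>i - 1\<close> of
  \<open>Y\<close>, hence strictly before \<open>t\<close>; the lags of the exogenous series start
  at 0, and \<open>info\<close> at \<open>t\<close> contains these series up to
  \<open>t\<close>.\<close>

lemma Zvec_info_measurable:
  assumes "i < dimZ q s J"
  shows "(\<lambda>\<omega>. fst (Zvec q s J Y X t \<omega> i)) \<in> borel_measurable (info M Y X J t)"
    "(\<lambda>\<omega>. snd (Zvec q s J Y X t \<omega> i)) \<in> borel_measurable (info M Y X J t)"
proof -
  consider "i = 0" | "i = 1" | "i \<noteq> 0" "i \<noteq> 1" "i < 2 + q" | "i \<noteq> 0" "i \<noteq> 1" "\<not> i < 2 + q" by blast
  then have "(\<lambda>\<omega>. fst (Zvec q s J Y X t \<omega> i)) \<in> borel_measurable (info M Y X J t) \<and>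
    (\<lambda>\<omega>. snd (Zvec q s J Y X t \<omega> i)) \<in> borel_measurable (info M Y X J t)"
  proof cases
    case 3
    then show ?thesis using Y_info_measurable[of "t - int (i - 1)" t Y M X J] by (simp add: Zvec_def)
  next
    case 4
    then show ?thesis using X_info_measurable[OF Zvec_X_index[OF assms 4(3)], of "t - int ((i - (2 + q)) div J)" t X M Y]
      by (simp add: Zvec_def)
  qed (simp_all add: Zvec_def)
  then show "(\<lambda>\<omega>. fst (Zvec q s J Y X t \<omega> i)) \<in> borel_measurable (info M Y X J t)"
    "(\<lambda>\<omega>. snd (Zvec q s J Y X t \<omega> i)) \<in> borel_measurable (info M Y X J t)" by auto
qed

lemma info_mono:
  assumes "t \<le> t'"
  shows "sets (info M Y X J t) \<subseteq> sets (info M Y X J t')"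
  unfolding sets_info by (rule sigma_sets_mono') (use assms in force)

lemma info_subalgebra:
  assumes "process_measurable M Y X J"
  shows "subalgebra M (info M Y X J t)"
  unfolding subalgebra_def space_info sets_info
proof (intro conjI refl sets.sigma_sets_subset subsetI)
  fix A assume "A \<in> {coord Y X c r -` B \<inter> space M | c r B. B \<in> sets borel \<and>
        ((c < 2 \<and> r \<le> t - 1) \<or> (2 \<le> c \<and> c < 2 + 2 * J \<and> r \<le> t))}"
  then obtain c r B where "A = coord Y X c r -` B \<inter> space M" "B \<in> sets borel" "c < 2 + 2 * J" by auto
  then show "A \<in> sets M" using assms by (auto simp: process_measurable_def intro: measurable_sets)
qed

text \<open>The inequality is strict because \<open>Y t\<close> belongs to the information sets of
  later times only.\<close>

lemma resid_info_measurable: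
  assumes "t < t'"
  shows "(\<lambda>\<omega>. fst (resid q s J Y X \<theta> t \<omega>)) \<in> borel_measurable (info M Y X J t')"
    "(\<lambda>\<omega>. snd (resid q s J Y X \<theta> t \<omega>)) \<in> borel_measurable (info M Y X J t')"
proof -
  have "subalgebra (info M Y X J t') (info M Y X J t)"
    using info_mono[of t t' M Y X J] assms by (auto simp: subalgebra_def space_info)
  note up = measurable_from_subalg[OF this]
  show "(\<lambda>\<omega>. fst (resid q s J Y X \<theta> t \<omega>)) \<in> borel_measurable (info M Y X J t')"
    "(\<lambda>\<omega>. snd (resid q s J Y X \<theta> t \<omega>)) \<in> borel_measurable (info M Y X J t')"
    unfolding resid_def isub_def ilin_def fst_conv snd_conv
    using Y_info_measurable[OF assms] up[OF Zvec_info_measurable(1)] up[OF Zvec_info_measurable(2)]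
    by (auto intro!: borel_measurable_diff borel_measurable_sum borel_measurable_times)
qed

section \<open>Fourth moments of the endpoints\<close>

definition L4 :: "'a measure \<Rightarrow> ('a \<Rightarrow> real) \<Rightarrow> bool" where
  "L4 M f \<longleftrightarrow> f \<in> borel_measurable M \<and> integrable M (\<lambda>x. (f x) ^ 4)"

lemma L4_measurable: "L4 M f \<Longrightarrow> f \<in> borel_measurable M"
  by (simp add: L4_def)

text \<open>The reason for tracking fourth moments: products such as regressor times innovation have
  finite second moments.\<close>

lemma L4_mult_square:
  assumes "L4 M f" "L4 M g"
  shows "integrable M (\<lambda>x. (f x * g x)\<^sup>2)"
proof -
  have [measurable]: "f \<in> borel_measurable M" "g \<in> borel_measurable M" using assms by (auto simp: L4_def)
  have "integrable M (\<lambda>x. (f x)\<^sup>2 * (g x)\<^sup>2)"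
    using assms by (intro integrable_mult_if_squares) (auto simp: L4_def simp flip: power_mult)
  then show ?thesis by (simp add: power_mult_distrib)
qed

lemma L4_bound:
  assumes "g \<in> borel_measurable M" "integrable M h" "\<And>x. (g x) ^ 4 \<le> h x"
  shows "L4 M g"
  unfolding L4_def
proof (intro conjI assms(1) Bochner_Integration.integrable_bound[OF assms(2)])
  show "AE x in M. norm ((g x) ^ 4) \<le> norm (h x)" using assms(3) by (auto intro: order_trans[OF _ abs_ge_self])
qed (use assms(1) in measurable)

lemma L4_add:
  assumes "L4 M f" "L4 M g"
  shows "L4 M (\<lambda>x. f x + g x)"
proof (rule L4_bound)
  show "integrable M (\<lambda>x. 8 * ((f x) ^ 4 + (g x) ^ 4))" using assms by (simp add: L4_def)
  show "(f x + g x) ^ 4 \<le> 8 * ((f x) ^ 4 + (g x) ^ 4)" for x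
  proof -
    have sq: "(a + b)\<^sup>2 \<le> 2 * (a\<^sup>2 + b\<^sup>2)" for a b :: real
      using zero_le_power2[of "a - b"] by (simp add: power2_eq_square algebra_simps)
    have "((f x + g x)\<^sup>2)\<^sup>2 \<le> (2 * ((f x)\<^sup>2 + (g x)\<^sup>2))\<^sup>2" by (intro power_mono sq) auto
    also have "\<dots> = 4 * ((f x)\<^sup>2 + (g x)\<^sup>2)\<^sup>2" by (subst power_mult_distrib) simp
    also have "\<dots> \<le> 4 * (2 * (((f x)\<^sup>2)\<^sup>2 + ((g x)\<^sup>2)\<^sup>2))" by (intro mult_left_mono sq) auto
    finally show ?thesis by (simp flip: power_mult)
  qed
qed (use assms in \<open>auto simp: L4_def\<close>)

lemma L4_cmult: "L4 M f \<Longrightarrow> L4 M (\<lambda>x. c * f x)"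
  by (auto simp: L4_def power_mult_distrib)

lemma L4_diff: "L4 M f \<Longrightarrow> L4 M g \<Longrightarrow> L4 M (\<lambda>x. f x - g x)"
  using L4_add[of M f "\<lambda>x. -1 * g x"] L4_cmult[of M g "-1"] by simp

lemma L4_sum: "(\<And>i. i \<in> I \<Longrightarrow> L4 M (f i)) \<Longrightarrow> L4 M (\<lambda>x. \<Sum>i\<in>I. f i x)"
proof (induction I rule: infinite_finite_induct)
  case (insert i I)
  then show ?case using L4_add[of M "f i" "\<lambda>x. \<Sum>i\<in>I. f i x"] by simp
qed (simp_all add: L4_def)

lemma (in finite_measure) L4_const: "L4 M (\<lambda>x. c)"
  by (simp add: L4_def)

text \<open>The square of \<open>normK2\<close> is the fourth power of the norm, and the norm
  dominates each endpoint up to a constant.\<close>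

lemma L4_if_normK2:
  assumes K: "kernel_pd K" and [measurable]: "(\<lambda>\<omega>. fst (A \<omega>)) \<in> borel_measurable M" "(\<lambda>\<omega>. snd (A \<omega>)) \<in> borel_measurable M"
    and int: "integrable M (\<lambda>\<omega>. (normK2 K (A \<omega>))\<^sup>2)"
  shows "L4 M (\<lambda>\<omega>. fst (A \<omega>))" "L4 M (\<lambda>\<omega>. snd (A \<omega>))"
proof -
  obtain c where c: "c > 0" "\<And>A. c * ((fst A)\<^sup>2 + (snd A)\<^sup>2) \<le> normK2 K A" using normK2_lower_bound[OF K] by blast
  have int': "integrable M (\<lambda>\<omega>. (normK2 K (A \<omega>))\<^sup>2 / c\<^sup>2)" using int by simp
  have "z ^ 4 \<le> (normK2 K (A \<omega>))\<^sup>2 / c\<^sup>2" if "z = fst (A \<omega>) \<or> z = snd (A \<omega>)" for z \<omega>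
  proof -
    have "c * z\<^sup>2 \<le> c * ((fst (A \<omega>))\<^sup>2 + (snd (A \<omega>))\<^sup>2)" using that c(1) by (intro mult_left_mono) auto
    also have "\<dots> \<le> normK2 K (A \<omega>)" by (rule c(2))
    finally have "(c * z\<^sup>2)\<^sup>2 \<le> (normK2 K (A \<omega>))\<^sup>2" using c(1) by (intro power_mono) auto
    then show ?thesis using c(1) by (simp add: pos_le_divide_eq power_mult_distrib mult.commute flip: power_mult)
  qed
  then show "L4 M (\<lambda>\<omega>. fst (A \<omega>))" "L4 M (\<lambda>\<omega>. snd (A \<omega>))"
    by (auto intro!: L4_bound[OF _ int'])
qed

section \<open>Scores of the regression as martingale differences\<close>

locale interval_regression = stationary_ergodic_process M Y X J
  for M :: "'a measure" and Y :: "int \<Rightarrow> 'a \<Rightarrow> interval" and X :: "nat \<Rightarrow> int \<Rightarrow> 'a \<Rightarrow> interval" and J :: nat +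
  fixes K :: "int \<Rightarrow> int \<Rightarrow> real" and q s :: nat and \<theta>0 :: "nat \<Rightarrow> real"
  assumes kern: "kernel_pd K"
    and momY: "\<And>t. integrable M (\<lambda>\<omega>. (normK2 K (Y t \<omega>))\<^sup>2)"
    and momX: "\<And>j t. j < J \<Longrightarrow> integrable M (\<lambda>\<omega>. (normK2 K (X j t \<omega>))\<^sup>2)"
    and mds_L: "\<And>t. AE \<omega> in M. real_cond_exp M (info M Y X J t) (\<lambda>\<omega>. fst (resid q s J Y X \<theta>0 t \<omega>)) \<omega> = 0"
    and mds_R: "\<And>t. AE \<omega> in M. real_cond_exp M (info M Y X J t) (\<lambda>\<omega>. snd (resid q s J Y X \<theta>0 t \<omega>)) \<omega> = 0"
begin

abbreviation "p \<equiv> dimZ q s J"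
abbreviation "Z t \<omega> i \<equiv> Zvec q s J Y X t \<omega> i"
abbreviation "u t \<omega> \<equiv> resid q s J Y X \<theta>0 t \<omega>"

lemma info_measurable_M: "f \<in> borel_measurable (info M Y X J t) \<Longrightarrow> f \<in> borel_measurable M"
  by (rule measurable_from_subalg[OF info_subalgebra[OF meas]])

lemma L4_Y: "L4 M (\<lambda>\<omega>. fst (Y t \<omega>))" "L4 M (\<lambda>\<omega>. snd (Y t \<omega>))"
  using L4_if_normK2[OF kern _ _ momY] Y_info_measurable[THEN info_measurable_M, of t "t + 1"] by auto

lemma L4_X: "j < J \<Longrightarrow> L4 M (\<lambda>\<omega>. fst (X j t \<omega>))" "j < J \<Longrightarrow> L4 M (\<lambda>\<omega>. snd (X j t \<omega>))"
  using L4_if_normK2[OF kern _ _ momX] X_info_measurable[THEN info_measurable_M, of j t t] by auto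

lemma L4_Z:
  assumes "i < p"
  shows "L4 M (\<lambda>\<omega>. fst (Z t \<omega> i))" "L4 M (\<lambda>\<omega>. snd (Z t \<omega> i))"
proof -
  consider "i = 0" | "i = 1" | "i \<noteq> 0" "i \<noteq> 1" "i < 2 + q" | "i \<noteq> 0" "i \<noteq> 1" "\<not> i < 2 + q" by blast
  then have "L4 M (\<lambda>\<omega>. fst (Z t \<omega> i)) \<and> L4 M (\<lambda>\<omega>. snd (Z t \<omega> i))"
  proof cases
    case 3
    then show ?thesis by (simp add: Zvec_def L4_Y)
  next
    case 4
    then show ?thesis using Zvec_X_index[OF assms 4(3)] by (simp add: Zvec_def L4_X)
  qed (simp_all add: Zvec_def L4_const)
  then show "L4 M (\<lambda>\<omega>. fst (Z t \<omega> i))" "L4 M (\<lambda>\<omega>. snd (Z t \<omega> i))" by auto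
qed

lemma L4_u: "L4 M (\<lambda>\<omega>. fst (u t \<omega>))" "L4 M (\<lambda>\<omega>. snd (u t \<omega>))"
  unfolding resid_def isub_def ilin_def fst_conv snd_conv
  by (intro L4_diff L4_Y L4_sum L4_cmult L4_Z; simp)+

lemma innerK_integrable_square:
  assumes "L4 M (\<lambda>\<omega>. fst (A \<omega>))" "L4 M (\<lambda>\<omega>. snd (A \<omega>))" "L4 M (\<lambda>\<omega>. fst (B \<omega>))" "L4 M (\<lambda>\<omega>. snd (B \<omega>))"
  shows "(\<lambda>\<omega>. innerK K (A \<omega>) (B \<omega>)) \<in> borel_measurable M" "integrable M (\<lambda>\<omega>. (innerK K (A \<omega>) (B \<omega>))\<^sup>2)"
    "integrable M (\<lambda>\<omega>. innerK K (A \<omega>) (B \<omega>))"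
proof -
  note [measurable] = assms[THEN L4_measurable]
  show m[measurable]: "(\<lambda>\<omega>. innerK K (A \<omega>) (B \<omega>)) \<in> borel_measurable M" unfolding innerK_expand by measurable
  have add: "integrable M (\<lambda>x. (f x + g x)\<^sup>2)" if "f \<in> borel_measurable M" "g \<in> borel_measurable M"
    "integrable M (\<lambda>x. (f x)\<^sup>2)" "integrable M (\<lambda>x. (g x)\<^sup>2)" for f g :: "'a \<Rightarrow> real"
    using that integrable_mult_if_squares[OF that] by (simp add: power2_sum mult.assoc)
  have diff: "integrable M (\<lambda>x. (f x - g x)\<^sup>2)" if "f \<in> borel_measurable M" "g \<in> borel_measurable M"
    "integrable M (\<lambda>x. (f x)\<^sup>2)" "integrable M (\<lambda>x. (g x)\<^sup>2)" for f g :: "'a \<Rightarrow> real"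
    using that integrable_mult_if_squares[OF that] by (simp add: power2_diff mult.assoc)
  have sc: "integrable M (\<lambda>x. (c * f x * g x)\<^sup>2)" if "L4 M f" "L4 M g" for c f g
    using L4_mult_square[OF L4_cmult[OF that(1)] that(2)] .
  show sq: "integrable M (\<lambda>\<omega>. (innerK K (A \<omega>) (B \<omega>))\<^sup>2)"
    unfolding innerK_expand by (intro add diff sc assms) measurable
  show "integrable M (\<lambda>\<omega>. innerK K (A \<omega>) (B \<omega>))"
    by (rule square_integrable_imp_integrable[OF m sq])
qed

text \<open>One direction of the gradient at a single observation. Index \<open>t\<close> belongs to
  time \<open>t + 1\<close>, as the martingale lemmas count from 0 and the observations from 1;
  correspondingly \<open>filt t\<close> is the information preceding the innovation at time
  \<open>t + 1\<close>.\<close>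

definition score :: "(nat \<Rightarrow> real) \<Rightarrow> nat set \<Rightarrow> nat \<Rightarrow> 'a \<Rightarrow> real" where
  "score \<eta> S t \<omega> = (\<Sum>k\<in>S. \<eta> k * innerK K (Z (int t + 1) \<omega> k) (u (int t + 1) \<omega>))"

definition filt :: "nat \<Rightarrow> 'a measure" where
  "filt t = info M Y X J (int t + 1)"

definition can_score :: "(nat \<Rightarrow> real) \<Rightarrow> nat set \<Rightarrow> (int \<times> nat \<Rightarrow> real) \<Rightarrow> real" where
  "can_score \<eta> S x = (\<Sum>k\<in>S. \<eta> k * innerK K (Zvec q s J canY canX 1 x k) (resid q s J canY canX \<theta>0 1 x))"

lemma can_score_measurable[measurable]: "can_score \<eta> S \<in> borel_measurable PS"
  unfolding can_score_def innerK_expand by measurable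

lemma score_eq_can_score:
  assumes "S \<subseteq> {..<p}"
  shows "score \<eta> S t \<omega> = can_score \<eta> S ((shift1 ^^ t) (path Y X J \<omega>))"
  unfolding score_def can_score_def shift_pow using assms
  by (intro sum.cong refl) (simp add: subset_iff Zvec_path resid_path add.commute)

lemma filt_subalgebra: "subalgebra M (filt t)"
  unfolding filt_def by (rule info_subalgebra[OF meas])

lemma filt_mono: "sets (filt t) \<subseteq> sets (filt (Suc t))"
  unfolding filt_def by (rule info_mono) simp

lemma score_adapted:
  assumes "S \<subseteq> {..<p}"
  shows "score \<eta> S t \<in> borel_measurable (filt (Suc t))"
proof -
  let ?F = "info M Y X J (int (Suc t) + 1)"
  have "subalgebra ?F (info M Y X J (int t + 1))"
    using info_mono[of "int t + 1" "int (Suc t) + 1" M Y X J] by (auto simp: subalgebra_def space_info)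
  note up = measurable_from_subalg[OF this]
  have [measurable]: "(\<lambda>\<omega>. fst (Z (int t + 1) \<omega> k)) \<in> borel_measurable ?F" "(\<lambda>\<omega>. snd (Z (int t + 1) \<omega> k)) \<in> borel_measurable ?F"
    if "k \<in> S" for k
    using that assms by (intro up Zvec_info_measurable; auto)+
  have [measurable]: "(\<lambda>\<omega>. fst (u (int t + 1) \<omega>)) \<in> borel_measurable ?F" "(\<lambda>\<omega>. snd (u (int t + 1) \<omega>)) \<in> borel_measurable ?F"
    by (rule resid_info_measurable; simp)+
  show ?thesis unfolding score_def[abs_def] filt_def innerK_expand
    by (intro borel_measurable_sum borel_measurable_times borel_measurable_const borel_measurable_add borel_measurable_diff) measurable
qed

lemma score_square_integrable:
  assumes "S \<subseteq> {..<p}"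
  shows "integrable M (\<lambda>\<omega>. (score \<eta> S t \<omega>)\<^sup>2)"
proof -
  have "integrable M (\<lambda>\<omega>. innerK K (Z (int t + 1) \<omega> k) (u (int t + 1) \<omega>) * innerK K (Z (int t + 1) \<omega> l) (u (int t + 1) \<omega>))"
    if "k \<in> S" "l \<in> S" for k l
    using that assms
    by (intro integrable_mult_if_squares innerK_integrable_square L4_Z L4_u) auto
  then have "integrable M (\<lambda>\<omega>. \<Sum>k\<in>S. \<Sum>l\<in>S. \<eta> k * \<eta> l *
      (innerK K (Z (int t + 1) \<omega> k) (u (int t + 1) \<omega>) * innerK K (Z (int t + 1) \<omega> l) (u (int t + 1) \<omega>)))"
    by (intro Bochner_Integration.integrable_sum integrable_mult_right) auto
  then show ?thesis by (simp add: score_def power2_eq_square sum_product mult_ac)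
qed

lemma score_second_moment:
  assumes "S \<subseteq> {..<p}"
  shows "expectation (\<lambda>\<omega>. (score \<eta> S 0 \<omega>)\<^sup>2) = (\<Sum>k\<in>S. \<Sum>l\<in>S. \<eta> k * Bmat M K q s J Y X \<theta>0 1 k l * \<eta> l)"
proof -
  have int: "integrable M (\<lambda>\<omega>. innerK K (Z 1 \<omega> k) (u 1 \<omega>) * innerK K (u 1 \<omega>) (Z 1 \<omega> l))"
    if "k \<in> S" "l \<in> S" for k l
    using that assms
    by (intro integrable_mult_if_squares innerK_integrable_square L4_Z L4_u) auto
  have "(score \<eta> S 0 \<omega>)\<^sup>2 = (\<Sum>k\<in>S. \<Sum>l\<in>S. \<eta> k * \<eta> l * (innerK K (Z 1 \<omega> k) (u 1 \<omega>) * innerK K (u 1 \<omega>) (Z 1 \<omega> l)))" for \<omega>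
    unfolding score_def power2_eq_square sum_product
  proof (intro sum.cong refl)
    fix k l
    show "\<eta> k * innerK K (Z (int 0 + 1) \<omega> k) (u (int 0 + 1) \<omega>) * (\<eta> l * innerK K (Z (int 0 + 1) \<omega> l) (u (int 0 + 1) \<omega>))
      = \<eta> k * \<eta> l * (innerK K (Z 1 \<omega> k) (u 1 \<omega>) * innerK K (u 1 \<omega>) (Z 1 \<omega> l))"
      using innerK_sym[OF kern, of "Z 1 \<omega> l" "u 1 \<omega>"] by simp
  qed
  then have "expectation (\<lambda>\<omega>. (score \<eta> S 0 \<omega>)\<^sup>2)
    = expectation (\<lambda>\<omega>. \<Sum>k\<in>S. \<Sum>l\<in>S. \<eta> k * \<eta> l * (innerK K (Z 1 \<omega> k) (u 1 \<omega>) * innerK K (u 1 \<omega>) (Z 1 \<omega> l)))" by simp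
  also have "\<dots> = (\<Sum>k\<in>S. \<Sum>l\<in>S. \<eta> k * \<eta> l * expectation (\<lambda>\<omega>. innerK K (Z 1 \<omega> k) (u 1 \<omega>) * innerK K (u 1 \<omega>) (Z 1 \<omega> l)))"
    using int by (subst Bochner_Integration.integral_sum; (intro Bochner_Integration.integrable_sum sum.cong refl)?; simp)+
  finally show ?thesis by (simp add: Bmat_def mult_ac)
qed

text \<open>The score is linear in the endpoints of the innovation, with coefficients
  \<open>a\<close> and \<open>b\<close> that are known to the information set. They can be pulled
  out of the conditional expectations, which vanish for both endpoints; integrability holds as
  \<open>g\<close> and the product of coefficient and endpoint are both square integrable.\<close>

lemma score_mds:
  assumes S: "S \<subseteq> {..<p}" and g: "g \<in> borel_measurable (filt t)" and g2: "integrable M (\<lambda>\<omega>. (g \<omega>)\<^sup>2)"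
  shows "expectation (\<lambda>\<omega>. g \<omega> * score \<eta> S t \<omega>) = 0"
proof -
  define r where "r = int t + 1"
  let ?F = "info M Y X J r"
  define a where "a \<omega> = (\<Sum>k\<in>S. \<eta> k * (K (-1) (-1) * fst (Z r \<omega> k) - K 1 (-1) * snd (Z r \<omega> k)))" for \<omega>
  define b where "b \<omega> = (\<Sum>k\<in>S. \<eta> k * (K 1 1 * snd (Z r \<omega> k) - K (-1) 1 * fst (Z r \<omega> k)))" for \<omega>
  have gF[measurable]: "g \<in> borel_measurable ?F" using g by (simp add: filt_def r_def)
  have ab[measurable]: "a \<in> borel_measurable ?F" "b \<in> borel_measurable ?F"
    unfolding a_def b_def using S
    by (intro borel_measurable_sum borel_measurable_times borel_measurable_diff borel_measurable_const Zvec_info_measurable; auto)+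
  have L: "L4 M a" "L4 M b"
    unfolding a_def b_def using S by (intro L4_sum L4_cmult L4_diff L4_Z; auto)+
  have split: "g \<omega> * score \<eta> S t \<omega> = (g \<omega> * a \<omega>) * fst (u r \<omega>) + (g \<omega> * b \<omega>) * snd (u r \<omega>)" for \<omega>
  proof -
    have "score \<eta> S t \<omega> = a \<omega> * fst (u r \<omega>) + b \<omega> * snd (u r \<omega>)"
      unfolding score_def r_def[symmetric] a_def b_def sum_distrib_right sum.distrib[symmetric]
      by (intro sum.cong refl) (simp add: innerK_expand algebra_simps)
    then show ?thesis by (simp add: algebra_simps)
  qed
  have sub: "sigma_finite_subalgebra M ?F"
    by (rule finite_measure_subalgebra_is_sigma_finite)
       (simp add: finite_measure_subalgebra_def finite_measure_subalgebra_axioms_def finite_measure_axioms info_subalgebra[OF meas])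
  have zero: "integrable M (\<lambda>\<omega>. (g \<omega> * c \<omega>) * v \<omega>) \<and> expectation (\<lambda>\<omega>. (g \<omega> * c \<omega>) * v \<omega>) = 0"
    if c: "c \<in> borel_measurable ?F" "L4 M c" and v: "L4 M v" and e: "AE \<omega> in M. real_cond_exp M ?F v \<omega> = 0" for c v
  proof -
    interpret A: sigma_finite_subalgebra M ?F by (rule sub)
    have [measurable]: "v \<in> borel_measurable M" "c \<in> borel_measurable M" "g \<in> borel_measurable M"
      using c v info_measurable_M[OF gF] by (simp_all add: L4_def)
    have "integrable M (\<lambda>\<omega>. g \<omega> * (c \<omega> * v \<omega>))"
      by (rule integrable_mult_if_squares) (use g2 L4_mult_square[OF c(2) v] in auto)
    then have i: "integrable M (\<lambda>\<omega>. (g \<omega> * c \<omega>) * v \<omega>)" by (simp add: mult.assoc)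
    have "expectation (\<lambda>\<omega>. (g \<omega> * c \<omega>) * v \<omega>) = expectation (\<lambda>\<omega>. (g \<omega> * c \<omega>) * real_cond_exp M ?F v \<omega>)"
      by (rule A.real_cond_exp_intg(2)[OF i, symmetric]) (use c gF in auto)
    also have "\<dots> = expectation (\<lambda>\<omega>. 0)"
      using e by (intro integral_cong_AE) auto
    finally show ?thesis using i by simp
  qed
  show ?thesis
    unfolding split using zero[OF ab(1) L(1) L4_u(1) mds_L] zero[OF ab(2) L(2) L4_u(2) mds_R] by simp
qed

lemma score_stationary:
  assumes "S \<subseteq> {..<p}"
  shows "distr M borel (score \<eta> S t) = distr M borel (score \<eta> S 0)"
    "expectation (\<lambda>\<omega>. (score \<eta> S t \<omega>)\<^sup>2) = expectation (\<lambda>\<omega>. (score \<eta> S 0 \<omega>)\<^sup>2)"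
proof -
  have eq: "score \<eta> S t = (\<lambda>\<omega>. can_score \<eta> S ((shift1 ^^ t) (path Y X J \<omega>)))" for t
    using score_eq_can_score[OF assms] by auto
  show d: "distr M borel (score \<eta> S t) = distr M borel (score \<eta> S 0)"
    using stationary_distr[OF can_score_measurable, of \<eta> S t] by (simp add: eq)
  have m: "score \<eta> S t \<in> borel_measurable M" for t unfolding eq by measurable
  have "expectation (\<lambda>\<omega>. (score \<eta> S t \<omega>)\<^sup>2) = (\<integral>x. x\<^sup>2 \<partial>distr M borel (score \<eta> S t))" for t
    by (rule integral_distr[symmetric]) (use m in auto)
  then show "expectation (\<lambda>\<omega>. (score \<eta> S t \<omega>)\<^sup>2) = expectation (\<lambda>\<omega>. (score \<eta> S 0 \<omega>)\<^sup>2)"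
    using d by simp
qed

text \<open>The martingale theorem asks for convergence of the averaged squares; these are
  functionals of the shifted path, so the law of large numbers on path space delivers it.\<close>

lemma score_clt:
  assumes S: "S \<subseteq> {..<p}"
  shows "(\<lambda>n. expectation (\<lambda>\<omega>. cis ((\<Sum>t<n. score \<eta> S t \<omega>) / sqrt (real n))))
    \<longlonglongrightarrow> of_real (exp (- (\<Sum>k\<in>S. \<Sum>l\<in>S. \<eta> k * Bmat M K q s J Y X \<theta>0 1 k l * \<eta> l) / 2))"
  unfolding score_second_moment[OF S, symmetric]
proof (rule martingale_clt)
  fix e :: real assume e: "e > 0"
  have eq: "score \<eta> S t \<omega> = can_score \<eta> S ((shift1 ^^ t) (path Y X J \<omega>))" for t \<omega>
    by (rule score_eq_can_score[OF S])
  have "integrable M (\<lambda>\<omega>. (can_score \<eta> S (path Y X J \<omega>))\<^sup>2)"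
    using score_square_integrable[OF S, of \<eta> 0] by (simp add: eq)
  then show "(\<lambda>n. prob {\<omega> \<in> space M. e < \<bar>(\<Sum>t<n. (score \<eta> S t \<omega>)\<^sup>2) / real n - expectation (\<lambda>\<omega>. (score \<eta> S 0 \<omega>)\<^sup>2)\<bar>}) \<longlonglongrightarrow> 0"
    using process_lln[of "\<lambda>x. (can_score \<eta> S x)\<^sup>2" e] e by (simp add: eq)
qed (rule filt_subalgebra filt_mono score_adapted[OF S] score_mds[OF S] score_stationary(1)[OF S]
  score_square_integrable[OF S] refl; assumption)+

text \<open>Chebyshev's inequality: by orthogonality the second moment of the sum is exactly
  \<open>T * v\<close>, so a bound uniform in \<open>T\<close> results.\<close>

lemma score_sum_tight:
  assumes S: "S \<subseteq> {..<p}" and e: "e > 0"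
  shows "\<exists>R>0. \<forall>T>0. prob {\<omega> \<in> space M. \<bar>\<Sum>t<T. score \<eta> S t \<omega>\<bar> > R * sqrt (real T)} \<le> e"
proof -
  define v where "v = expectation (\<lambda>\<omega>. (score \<eta> S 0 \<omega>)\<^sup>2)"
  have v0: "v \<ge> 0" by (simp add: v_def)
  have mom: "(\<lambda>\<omega>. \<Sum>t<n. score \<eta> S t \<omega>) \<in> borel_measurable (filt n) \<and>
    integrable M (\<lambda>\<omega>. (\<Sum>t<n. score \<eta> S t \<omega>)\<^sup>2) \<and> expectation (\<lambda>\<omega>. (\<Sum>t<n. score \<eta> S t \<omega>)\<^sup>2) = real n * v" for n
  proof (rule martingale_second_moment)
    show "expectation (\<lambda>\<omega>. (score \<eta> S t \<omega>)\<^sup>2) = v" for t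
      unfolding v_def by (rule score_stationary(2)[OF S])
  qed (rule filt_subalgebra filt_mono score_adapted[OF S] score_mds[OF S] score_square_integrable[OF S]; assumption)+
  \<comment> \<open>Chosen so that \<open>v / R\<^sup>2 \<le> e\<close>; the added 1 keeps
    \<open>R\<close> positive when \<open>v = 0\<close>.\<close>
  define R where "R = sqrt ((v + 1) / e)"
  have R: "R > 0" "R\<^sup>2 = (v + 1) / e" using v0 e by (auto simp: R_def)
  have "prob {\<omega> \<in> space M. \<bar>\<Sum>t<T. score \<eta> S t \<omega>\<bar> > R * sqrt (real T)} \<le> e" if T: "T > 0" for T :: nat
  proof -
    let ?G = "\<lambda>\<omega>. \<Sum>t<T. score \<eta> S t \<omega>"
    have [measurable]: "?G \<in> borel_measurable M" using mom measurable_from_subalg[OF filt_subalgebra] by blast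
    have "prob {\<omega> \<in> space M. \<bar>?G \<omega>\<bar> > R * sqrt (real T)} \<le> prob {\<omega> \<in> space M. (?G \<omega>)\<^sup>2 \<ge> R\<^sup>2 * real T}"
    proof (intro finite_measure_mono subsetI)
      fix \<omega> assume "\<omega> \<in> {\<omega> \<in> space M. \<bar>?G \<omega>\<bar> > R * sqrt (real T)}"
      then have "\<omega> \<in> space M" "R * sqrt (real T) \<le> \<bar>?G \<omega>\<bar>" by auto
      moreover from this have "(R * sqrt (real T))\<^sup>2 \<le> \<bar>?G \<omega>\<bar>\<^sup>2" using R(1) by (intro power_mono) auto
      ultimately show "\<omega> \<in> {\<omega> \<in> space M. (?G \<omega>)\<^sup>2 \<ge> R\<^sup>2 * real T}" by (simp add: power_mult_distrib)
    qed measurable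
    also have "\<dots> \<le> expectation (\<lambda>\<omega>. (?G \<omega>)\<^sup>2) / (R\<^sup>2 * real T)"
      using mom R(1) T by (intro integral_Markov_inequality_measure[where A="{}"]) auto
    also have "\<dots> = v / ((v + 1) / e)" using mom T by (simp add: R(2))
    also have "\<dots> \<le> e" using v0 e by (simp add: divide_le_eq mult.commute mult_left_mono)
    finally show ?thesis .
  qed
  then show ?thesis using R(1) by blast
qed

text \<open>By stationarity the summand at time \<open>1 + t\<close> is the time-1 functional
  evaluated on the path shifted \<open>t\<close> times, whose mean is \<open>Cmat\<close> at time
  1.\<close>

lemma design_lln:
  assumes ik: "i < p" "k < p" and e: "e > 0"
  shows "(\<lambda>T. prob {\<omega> \<in> space M. \<bar>(\<Sum>t=1..T. innerK K (Z (int t) \<omega> i) (Z (int t) \<omega> k)) / real T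
    - Cmat M K q s J Y X 1 i k\<bar> > e}) \<longlonglongrightarrow> 0"
proof -
  define \<Phi> where "\<Phi> x = innerK K (Zvec q s J canY canX 1 x i) (Zvec q s J canY canX 1 x k)" for x
  have [measurable]: "\<Phi> \<in> borel_measurable PS" unfolding \<Phi>_def innerK_expand by measurable
  have eq: "innerK K (Z (1 + int t) \<omega> i) (Z (1 + int t) \<omega> k) = \<Phi> ((shift1 ^^ t) (path Y X J \<omega>))" for t \<omega>
    unfolding \<Phi>_def shift_pow using ik by (simp add: Zvec_path)
  have eq0: "\<Phi> (path Y X J \<omega>) = innerK K (Z 1 \<omega> i) (Z 1 \<omega> k)" for \<omega> using eq[of 0 \<omega>] by simp
  have "integrable M (\<lambda>\<omega>. \<Phi> (path Y X J \<omega>))" unfolding eq0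
    by (intro innerK_integrable_square L4_Z ik)
  moreover have "(\<Sum>t=1..T. innerK K (Z (int t) \<omega> i) (Z (int t) \<omega> k)) = (\<Sum>t<T. \<Phi> ((shift1 ^^ t) (path Y X J \<omega>)))" for T \<omega>
    unfolding eq[symmetric] by (simp add: sum.atLeast1_atMost_eq add.commute)
  ultimately show ?thesis using process_lln[of \<Phi> e] e by (simp add: Cmat_def eq0)
qed

lemma score_sum:
  "(\<Sum>k\<in>S. \<eta> k * (\<Sum>t=1..T. innerK K (Z (int t) \<omega> k) (u (int t) \<omega>))) = (\<Sum>t<T. score \<eta> S t \<omega>)"
proof -
  have "(\<Sum>t=1..T. innerK K (Z (int t) \<omega> k) (u (int t) \<omega>)) = (\<Sum>t<T. innerK K (Z (int t + 1) \<omega> k) (u (int t + 1) \<omega>))" for k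
    by (simp add: sum.atLeast1_atMost_eq add.commute)
  then show ?thesis unfolding score_def by (subst sum.swap) (simp add: sum_distrib_left)
qed

end

section \<open>Oracle property of the adaptive lasso for intervals\<close>

theorem theorem2:
  fixes M :: "'a measure" and K :: "int \<Rightarrow> int \<Rightarrow> real"
    and Y :: "int \<Rightarrow> 'a \<Rightarrow> real \<times> real" and X :: "nat \<Rightarrow> int \<Rightarrow> 'a \<Rightarrow> real \<times> real"
    and q s J :: nat and \<theta>0 :: "nat \<Rightarrow> real" and \<Theta> :: "(nat \<Rightarrow> real) set"
    and \<sigma>2 \<gamma> :: real and lam :: "nat \<Rightarrow> real"
    and \<theta>t \<theta>h :: "nat \<Rightarrow> 'a \<Rightarrow> nat \<Rightarrow> real"
  defines "p \<equiv> dimZ q s J"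
    and "S0 \<equiv> {i. i < dimZ q s J \<and> \<theta>0 i \<noteq> 0}"
  assumes prob: "prob_space M"
    and kern: "kernel_pd K"
    \<comment> \<open>(A1)\<close>
    and meas: "process_measurable M Y X J"
    and stat: "strictly_stationary M Y X J"
    and erg: "ergodic M Y X J"
    and momY: "\<forall>t. integrable M (\<lambda>\<omega>. (normK2 K (Y t \<omega>))\<^sup>2)"
    and momX: "\<forall>j<J. \<forall>t. integrable M (\<lambda>\<omega>. (normK2 K (X j t \<omega>))\<^sup>2)"
    and mds_L: "\<forall>t. AE \<omega> in M. real_cond_exp M (info M Y X J t) (\<lambda>\<omega>. fst (resid q s J Y X \<theta>0 t \<omega>)) \<omega> = 0"
    and mds_R: "\<forall>t. AE \<omega> in M. real_cond_exp M (info M Y X J t) (\<lambda>\<omega>. snd (resid q s J Y X \<theta>0 t \<omega>)) \<omega> = 0"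
    and condvar: "\<forall>t. AE \<omega> in M. real_cond_exp M (info M Y X J t)
                      (\<lambda>\<omega>. normK2 K (resid q s J Y X \<theta>0 t \<omega>)) \<omega> = \<sigma>2"
    \<comment> \<open>(A2)\<close>
    and Theta_sub: "\<Theta> \<subseteq> Rp p"
    and Theta_compact: "compact \<Theta>"
    and interior: "\<exists>U. openin (top_of_set (Rp p)) U \<and> \<theta>0 \<in> U \<and> U \<subseteq> \<Theta>"
    \<comment> \<open>(A3)\<close>
    and pd: "\<exists>U. openin (top_of_set (Rp p)) U \<and> \<theta>0 \<in> U \<and>
               (\<forall>\<theta>\<in>U. \<forall>t.
                  posdef_on {..<p} (Cmat M K q s J Y X t) \<and>
                  posdef_on {..<p} (Bmat M K q s J Y X \<theta> t))"
    \<comment> \<open>(A4) and tuning constants\<close>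
    and gam: "\<gamma> > 0"
    and lam_pos: "\<forall>T. lam T > 0"
    and lam1: "(\<lambda>T. lam T / sqrt (real T)) \<longlonglongrightarrow> 0"
    and lam2: "filterlim (\<lambda>T. lam T * real T powr ((\<gamma> - 1) / 2)) at_top sequentially"
    \<comment> \<open>the minimum D_K-distance estimator\<close>
    and tilde_min: "\<forall>T. \<forall>\<omega>\<in>space M. \<theta>t T \<omega> \<in> \<Theta> \<and>
                       (\<forall>\<theta>\<in>\<Theta>. DKobj K q s J Y X T \<omega> (\<theta>t T \<omega>) \<le> DKobj K q s J Y X T \<omega> \<theta>)"
    \<comment> \<open>the adaptive-lasso estimator (penalty +infinity on coordinates with tilde theta_j = 0)\<close>
    and hat_min: "\<forall>T. \<forall>\<omega>\<in>space M. \<theta>h T \<omega> \<in> \<Theta> \<and>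
                     (\<forall>j<p. \<theta>t T \<omega> j = 0 \<longrightarrow> \<theta>h T \<omega> j = 0) \<and>
                     (\<forall>\<theta>\<in>\<Theta>. (\<forall>j<p. \<theta>t T \<omega> j = 0 \<longrightarrow> \<theta> j = 0) \<longrightarrow>
                        DKobj K q s J Y X T \<omega> (\<theta>h T \<omega>) + lam T * adapt_pen p \<gamma> (\<theta>t T \<omega>) (\<theta>h T \<omega>)
                        \<le> DKobj K q s J Y X T \<omega> \<theta> + lam T * adapt_pen p \<gamma> (\<theta>t T \<omega>) \<theta>)"
    and hat_meas: "\<forall>T i. (\<lambda>\<omega>. \<theta>h T \<omega> i) \<in> borel_measurable M"
  shows "((\<lambda>T. measure M {\<omega> \<in> space M. \<forall>i<p. i \<notin> S0 \<longrightarrow> \<theta>h T \<omega> i = 0}) \<longlonglongrightarrow> 1) \<and>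
         (\<exists>\<mu>. gaussian_on S0 (sandwich S0 (Cmat M K q s J Y X 1) (Bmat M K q s J Y X \<theta>0 1)) \<mu> \<and>
           conv_dist_to M S0 (\<lambda>T \<omega>. \<lambda>i\<in>S0. sqrt (real T) * (\<theta>h T \<omega> i - \<theta>0 i)) \<mu>)"
proof -
  interpret R: interval_regression M Y X J K q s \<theta>0
    using prob kern meas stat erg momY momX mds_L mds_R
    by (intro interval_regression.intro stationary_ergodic_process.intro interval_regression_axioms.intro
        stationary_ergodic_process_axioms.intro) auto
  let ?A = "\<lambda>T \<omega> i k. \<Sum>t=1..T. innerK K (Zvec q s J Y X (int t) \<omega> i) (Zvec q s J Y X (int t) \<omega> k)"
  let ?G = "\<lambda>T \<omega> i. \<Sum>t=1..T. innerK K (Zvec q s J Y X (int t) \<omega> i) (resid q s J Y X \<theta>0 (int t) \<omega>)"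
  have S0: "S0 = {i. i < p \<and> \<theta>0 i \<noteq> 0}" by (simp add: S0_def p_def)
  have S0p: "S0 \<subseteq> {..<dimZ q s J}" by (auto simp: S0_def)
  obtain U where U: "openin (top_of_set (Rp p)) U" "\<theta>0 \<in> U" "U \<subseteq> \<Theta>" using interior by blast
  \<comment> \<open>Interiority is relative to \<open>Rp p\<close>, the copy of the parameter space
    among sequences, hence a box in the first \<open>p\<close> coordinates.\<close>
  obtain r where r: "r > 0" "\<And>\<theta>. \<theta> \<in> Rp p \<Longrightarrow> (\<And>i. i < p \<Longrightarrow> \<bar>\<theta> i - \<theta>0 i\<bar> < r) \<Longrightarrow> \<theta> \<in> \<Theta>"
    using box_in_relative_neighbourhood[OF U(1,2)] U(3) by blast
  have \<theta>0: "\<theta>0 \<in> Rp p" using U Theta_sub by blast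
  have CB: "posdef_on {..<p} (Cmat M K q s J Y X 1)" "posdef_on {..<p} (Bmat M K q s J Y X \<theta>0 1)" using pd by blast+
  have Am: "(\<lambda>\<omega>. ?A T \<omega> i k) \<in> borel_measurable M" if "i < p" "k < p" for T i k
    using that R.L4_Z unfolding p_def by (intro borel_measurable_sum R.innerK_integrable_square) auto
  have Gm: "(\<lambda>\<omega>. ?G T \<omega> i) \<in> borel_measurable M" if "i < p" for T i
    using that R.L4_Z R.L4_u unfolding p_def by (intro borel_measurable_sum R.innerK_integrable_square) auto
  have hm: "(\<lambda>\<omega>. \<theta>h T \<omega> i) \<in> borel_measurable M" for T i using hat_meas by blast
  have sym: "?A T \<omega> i k = ?A T \<omega> k i" for T \<omega> i k
    by (intro sum.cong refl innerK_sym[OF kern])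
  have quad: "DKobj K q s J Y X T \<omega> \<theta> = DKobj K q s J Y X T \<omega> \<theta>0 - 2 * (\<Sum>i<p. (\<theta> i - \<theta>0 i) * ?G T \<omega> i)
     + (\<Sum>i<p. \<Sum>k<p. (\<theta> i - \<theta>0 i) * ?A T \<omega> i k * (\<theta> k - \<theta>0 k))" for T \<omega> \<theta>
    unfolding p_def by (rule DKobj_quadratic[OF kern])
  have lln: "(\<lambda>T. measure M {\<omega> \<in> space M. \<bar>?A T \<omega> i k / real T - Cmat M K q s J Y X 1 i k\<bar> > e}) \<longlonglongrightarrow> 0"
    if "i < p" "k < p" "e > 0" for i k e
    using R.design_lln[OF that[unfolded p_def]] .
  have tight: "\<exists>R>0. \<forall>T>0. measure M {\<omega> \<in> space M. \<bar>?G T \<omega> i\<bar> > R * sqrt (real T)} \<le> e" if "i < p" "e > 0" for i e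
  proof -
    \<comment> \<open>One coordinate of the gradient is the score sum over the singleton
      \<open>{i}\<close> with weight 1.\<close>
    have "?G T \<omega> i = (\<Sum>t<T. R.score (\<lambda>_. 1) {i} t \<omega>)" for T \<omega>
      using R.score_sum[where \<eta>="\<lambda>_. 1" and S="{i}" and T=T and \<omega>=\<omega>] by simp
    then show ?thesis using R.score_sum_tight[where S="{i}" and e=e and \<eta>="\<lambda>_. 1"] that by (simp add: p_def)
  qed
  have clt: "(\<lambda>T. \<integral>\<omega>. cis ((\<Sum>k\<in>S0. \<eta> k * ?G T \<omega> k) / sqrt (real T)) \<partial>M)
        \<longlonglongrightarrow> of_real (exp (- (\<Sum>k\<in>S0. \<Sum>l\<in>S0. \<eta> k * Bmat M K q s J Y X \<theta>0 1 k l * \<eta> l) / 2))" for \<eta>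
    unfolding R.score_sum by (rule R.score_clt[OF S0p])
  have tilde: "DKobj K q s J Y X T \<omega> (\<theta>t T \<omega>) \<le> DKobj K q s J Y X T \<omega> \<theta>" if "\<omega> \<in> space M" "\<theta> \<in> \<Theta>" for T \<omega> \<theta>
    using tilde_min that by blast
  have hat: "\<theta>h T \<omega> \<in> \<Theta>" "j < p \<Longrightarrow> \<theta>t T \<omega> j = 0 \<Longrightarrow> \<theta>h T \<omega> j = 0" if "\<omega> \<in> space M" for T \<omega> j
    using hat_min that by blast+
  have hat3: "DKobj K q s J Y X T \<omega> (\<theta>h T \<omega>) + lam T * adapt_pen p \<gamma> (\<theta>t T \<omega>) (\<theta>h T \<omega>)
        \<le> DKobj K q s J Y X T \<omega> \<theta> + lam T * adapt_pen p \<gamma> (\<theta>t T \<omega>) \<theta>"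
    if "\<omega> \<in> space M" "\<theta> \<in> \<Theta>" "\<And>j. j < p \<Longrightarrow> \<theta>t T \<omega> j = 0 \<Longrightarrow> \<theta> j = 0" for T \<omega> \<theta>
    using hat_min that by blast
  have lam_pos': "lam T > 0" for T using lam_pos by blast
  show ?thesis
    by (intro conjI; rule adaptive_lasso_asymptotics[where p=p and M=M and A="?A" and G="?G" and obj="DKobj K q s J Y X"
      and C="Cmat M K q s J Y X 1" and B="Bmat M K q s J Y X \<theta>0 1" and ?\<theta>0.0=\<theta>0 and \<theta>t=\<theta>t and \<theta>h=\<theta>h
      and \<gamma>=\<gamma> and lam=lam and \<Theta>=\<Theta> and r=r, folded S0])
      (rule prob Am Gm hm sym quad CB lln tight clt gam lam_pos' lam1 lam2 \<theta>0 Theta_sub r tilde hat hat3; assumption)+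
qed

end
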